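(* Let $\mathbb{A}_0:(0,2)\to\mathbb{R}^{(n+1)\times(n+1)}$ be a symmetric measurable matrix. Assume that there are a positive number $\Lambda$ and a weight function $\mu$ such that $$\Lambda^{-1}\mu(y)|\xi|^2\le\langle\mathbb{A}_0(y)\xi,\xi\rangle\le\Lambda\mu(y)|\xi|^2,\quad\forall\,\xi\in\mathbb{R}^{n+1},\ \text{for a.e. }y\in(0,2).$$ Moreover, assume that there is $C_1>0$ such that for a.e. $y\in(0,1)$ and all $0<\tau<y/2$ the quantities $\inf_{s\in(y-3\tau/2,\,y+3\tau/2)}\mu(s)$ and $\sup_{s\in(y-3\tau/2,\,y+3\tau/2)}\mu(s)$ both exist (are finite), $\inf_{s\in(y-3\tau/2,\,y+3\tau/2)}\mu(s)>0$, and $$\sup_{y\in(0,1),\ \tau<y/2}\ \frac{\sup_{s\in(y-3\tau/2,\,y+3\tau/2)}\mu(s)}{\inf_{s\in(y-3\tau/2,\,y+3\tau/2)}\mu(s)}\le C_1 .$$ Then for every $\theta\in(0,1)$ there is $C=C(\Lambda,\theta,C_1,n)$ such that the following holds: for every $X_0=(x_0,y_0)\in\overline{Q}_1$ and $\tau\in(0,1)$ with $y_0-2\tau>0$, if $v\in W^{1,2}(D_{3\tau/2}(X_0),\mu)$ is a weak solution of $$\operatorname{div}[\mathbb{A}_0(y)\nabla v]=0\quad\text{in }D_{3\tau/2}(X_0),$$ then $$\|\nabla v\|_{L^\infty(D_{3\theta\tau/2}(X_0))}\le C\left[\frac1{\hat\mu(D_{3\tau/2}(X_0))}\int_{D_{3\tau/2}(X_0)}|\nabla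 v(x,y)|^2\mu(y)\,dx\,dy\right]^{1/2}.$$
   Context: $X=(x,y)\in\mathbb{R}^n\times\mathbb{R}$, $\nabla=(\nabla_x,\partial_y)$; $B_r(x_0)\subset\mathbb{R}^n$ is the ball, $B_1=B_1(0)$, $Q_1=B_1\times(0,1)$, $D_r(x_0,y_0)=B_r(x_0)\times(y_0-r,y_0+r)$. A weight function is a non-negative function $\mu:\mathbb{R}\to[0,\infty)$ (it is not assumed to be in $A_2$ and may be degenerate or singular at $y=0$); $\hat\mu(E)=\int_E\mu(y)\,dX$. $W^{1,2}(E,\mu)$: functions which together with their weak gradients are square integrable on $E$ with respect to $\mu(y)\,dx\,dy$. Weak solution: $\int_{D_{3\tau/2}(X_0)}\langle\mathbb{A}_0(y)\nabla v,\nabla\phi\rangle dX=0$ for all $\phi\in C_0^\infty(D_{3\tau/2}(X_0))$. *)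

theory Defs
  imports "HOL-Analysis.Analysis" "HOL-Probability.Essential_Supremum"
begin

text \<open>
  A point \<open>X = (x, y)\<close> of \<open>\<real>\<^sup>n \<times> \<real>\<close> has type \<open>(real ^ 'n) \<times> real\<close>, where \<open>n = CARD('n)\<close>. Gradients
  and the \<open>(n+1) \<times> (n+1)\<close> coefficient matrices are indexed by \<open>'n option\<close>: the index \<open>Some j\<close>
  stands for the variable \<open>x\<^sub>j\<close> and \<open>None\<close> for \<open>y\<close>, so that a gradient is \<open>(\<nabla>\<^sub>x, \<partial>\<^sub>y)\<close>.
\<close>

definition cylinder :: "(real ^ 'n) \<times> real \<Rightarrow> real \<Rightarrow> ((real ^ 'n) \<times> real) set"
  where "cylinder X0 r = ball (fst X0) r \<times> {snd X0 - r <..< snd X0 + r}"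

definition Q1 :: "((real ^ 'n) \<times> real) set"
  where "Q1 = ball 0 1 \<times> {0<..<1}"

text \<open>Being measurable is part of being a weight; otherwise \<open>\<integral> \<mu>\<close> has no meaning.\<close>

definition weight :: "(real \<Rightarrow> real) \<Rightarrow> bool"
  where "weight \<mu> \<longleftrightarrow> \<mu> \<in> borel_measurable lebesgue \<and> (\<forall>y. 0 \<le> \<mu> y)"

text \<open>As a Bochner integral, this is \<open>0\<close> if \<open>\<mu>\<close> is not integrable over \<open>E\<close>.\<close>

definition weighted_vol :: "(real \<Rightarrow> real) \<Rightarrow> ((real ^ 'n) \<times> real) set \<Rightarrow> real"
  where "weighted_vol \<mu> E = (LINT X:E|lebesgue. \<mu> (snd X))"

primrec Ck :: "nat \<Rightarrow> ('a::euclidean_space \<Rightarrow> real) \<Rightarrow> bool"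
  where
    "Ck 0 f \<longleftrightarrow> continuous_on UNIV f"
  | "Ck (Suc k) f \<longleftrightarrow> (\<forall>x. f differentiable (at x)) \<and>
       (\<forall>v. Ck k (\<lambda>x. frechet_derivative f (at x) v))"

definition test_function :: "'a::euclidean_space set \<Rightarrow> ('a \<Rightarrow> real) \<Rightarrow> bool"
  where "test_function E \<phi> \<longleftrightarrow>
    (\<forall>k. Ck k \<phi>) \<and> compact (closure {X. \<phi> X \<noteq> 0}) \<and> closure {X. \<phi> X \<noteq> 0} \<subseteq> E"

definition coord_dir :: "'n::finite option \<Rightarrow> (real ^ 'n) \<times> real"
  where "coord_dir i = (case i of None \<Rightarrow> (0, 1) | Some j \<Rightarrow> (axis j 1, 0))"

definition grad :: "((real ^ 'n) \<times> real \<Rightarrow> real) \<Rightarrow> (real ^ 'n) \<times> real \<Rightarrow> real ^ 'n::finite option"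
  where "grad \<phi> X = (\<chi> i. frechet_derivative \<phi> (at X) (coord_dir i))"

definition locally_integrable ::
    "'a::euclidean_space set \<Rightarrow> ('a \<Rightarrow> 'b::euclidean_space) \<Rightarrow> bool"
  where "locally_integrable E f \<longleftrightarrow> (\<forall>K. compact K \<and> K \<subseteq> E \<longrightarrow> f absolutely_integrable_on K)"

text \<open>
  The weak gradient is determined only almost everywhere, so it is treated as a relation
  between a function and any representative of its weak gradient.
\<close>

definition has_weak_gradient ::
    "((real ^ 'n) \<times> real) set \<Rightarrow> ((real ^ 'n) \<times> real \<Rightarrow> real) \<Rightarrow>
     ((real ^ 'n) \<times> real \<Rightarrow> real ^ 'n::finite option) \<Rightarrow> bool"
  where "has_weak_gradient E v G \<longleftrightarrow>
    locally_integrable E v \<and> locally_integrable E G \<and>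
    (\<forall>\<phi>. test_function E \<phi> \<longrightarrow>
      (\<forall>i. (LINT X:E|lebesgue. v X * grad \<phi> X $ i) = - (LINT X:E|lebesgue. G X $ i * \<phi> X)))"

text \<open>\<open>W12 E \<mu> v G\<close>: \<open>v\<close> lies in \<open>W\<^sup>1\<^sup>,\<^sup>2(E, \<mu>)\<close> and \<open>G\<close> represents its weak gradient.\<close>

definition W12 ::
    "((real ^ 'n) \<times> real) set \<Rightarrow> (real \<Rightarrow> real) \<Rightarrow> ((real ^ 'n) \<times> real \<Rightarrow> real) \<Rightarrow>
     ((real ^ 'n) \<times> real \<Rightarrow> real ^ 'n::finite option) \<Rightarrow> bool"
  where "W12 E \<mu> v G \<longleftrightarrow>
    has_weak_gradient E v G \<and>
    set_integrable lebesgue E (\<lambda>X. (v X)\<^sup>2 * \<mu> (snd X)) \<and>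
    set_integrable lebesgue E (\<lambda>X. (norm (G X))\<^sup>2 * \<mu> (snd X))"

text \<open>\<open>G\<close> is a weak gradient of the solution \<open>v\<close> of \<open>div (A\<^sub>0(y) \<nabla>v) = 0\<close> in \<open>E\<close>; \<open>v\<close> itself does not
  enter the weak formulation.\<close>

definition weak_solution ::
    "(real \<Rightarrow> real ^ 'n option ^ 'n option) \<Rightarrow> ((real ^ 'n) \<times> real) set \<Rightarrow>
     ((real ^ 'n) \<times> real \<Rightarrow> real ^ 'n::finite option) \<Rightarrow> bool"
  where "weak_solution A0 E G \<longleftrightarrow>
    (\<forall>\<phi>. test_function E \<phi> \<longrightarrow> (LINT X:E|lebesgue. (A0 (snd X) *v G X) \<bullet> grad \<phi> X) = 0)"

definition Linf_norm ::
    "'a::euclidean_space set \<Rightarrow> ('a \<Rightarrow> 'b::euclidean_space) \<Rightarrow> ereal"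
  where "Linf_norm E G = esssup (lebesgue_on E) (\<lambda>X. ereal (norm (G X)))"

end

theory Submission
  imports Defs
begin

text \<open>
  On the cylinder the weight \<open>\<mu>\<close> is comparable to a constant \<open>m\<close>, by the oscillation hypothesis
  (\<open>weight_comparable\<close>). Hence \<open>A\<^sub>0 / m\<close> is uniformly elliptic there, with a ratio of
  ellipticity constants bounded by \<open>\<Lambda>\<^sup>2 C\<^sub>1\<close>, and what has to be shown is a gradient bound for
  uniformly elliptic equations whose coefficients are merely measurable but depend on \<open>y\<close> alone.

  Such equations are invariant under translations in \<open>x\<close>. So every difference quotient
  \<open>(v (x + h e\<^sub>j, y) - v (x, y)) / h\<close> is again a solution, and the energy inequality
  (\<open>caccioppoli\<close>) bounds the \<open>L\<^sup>2\<close> norm of its gradient on a smaller ball by the \<open>L\<^sup>2\<close> norm of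
  \<open>\<nabla>v\<close>, uniformly in \<open>h\<close>. By iteration all horizontal difference quotients of \<open>\<nabla>v\<close> are
  controlled in \<open>L\<^sup>2\<close> (\<open>diff_quots_energy\<close>). This does not reach the second derivative in \<open>y\<close>,
  since \<open>\<partial>\<^sub>y v\<close> may jump with the coefficients. But the equation expresses the \<open>y\<close>-derivative of
  the vertical flux \<open>U = (A \<nabla>v)\<^sub>y\<close> by horizontal derivatives of the horizontal fluxes, so that
  \<open>\<partial>\<^sub>j v\<close> and \<open>U\<close> each have one derivative in \<open>y\<close> and any number of derivatives in \<open>x\<close> in \<open>L\<^sup>2\<close>.
  A Sobolev inequality that uses every coordinate direction at most once bounds both in
  \<open>L\<^sup>\<infinity>\<close>; finally \<open>\<partial>\<^sub>y v\<close> is recovered from \<open>U\<close> because \<open>A\<^sub>y\<^sub>y\<close> is bounded from below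
  (\<open>gradient_bound\<close>).

  Weak derivatives are handled by duality: \<open>\<partial>\<^sub>e f\<close> is square integrable iff
  \<open>\<integral> f \<partial>\<^sub>e \<phi>\<close> is bounded by the \<open>L\<^sup>2\<close> norm of \<open>\<phi>\<close>, and this is equivalent to bounds on difference
  quotients that are uniform in the step (\<open>diff_quot_l2_bound\<close>, \<open>dual_bound_of_diff_quot\<close>). The
  Sobolev inequality is discrete as well (\<open>discrete_sobolev\<close>): it telescopes along a grid of mesh
  \<open>h\<close> and lets \<open>h\<close> tend to \<open>0\<close>, so that the bounds on difference quotients enter directly.
  All functions are cut off to be defined and square integrable on the whole space, and are
  represented by Borel functions; the equations hold against test functions of a ball only.
\<close>

section \<open>Smooth functions and test functions\<close>

text \<open>
  The directional derivative, with the point as last argument so that \<open>dd f v\<close> is again a function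
  on the space.
\<close>

abbreviation dd :: "('a::euclidean_space \<Rightarrow> real) \<Rightarrow> 'a \<Rightarrow> 'a \<Rightarrow> real"
  where "dd f v X \<equiv> frechet_derivative f (at X) v"

lemma frechet_derivative_eqI: "(f has_derivative f') (at x) \<Longrightarrow> frechet_derivative f (at x) = f'"
  by (rule frechet_derivative_at[symmetric])

lemma dd_eqI: "(\<And>X. (f has_derivative F X) (at X)) \<Longrightarrow> (\<lambda>X. dd f v X) = (\<lambda>X. F X v)"
  by (rule ext) (metis frechet_derivative_eqI)

lemma Ck_SucI:
  assumes "\<And>X. (f has_derivative F X) (at X)" "\<And>v. Ck k (\<lambda>X. F X v)"
  shows "Ck (Suc k) f"
proof -
  have "f differentiable at x" for x using assms(1) differentiable_def by blast
  then show ?thesis using assms(2) by (simp add: dd_eqI[OF assms(1)])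
qed

lemma Ck_has_derivative:
  "Ck (Suc k) f \<Longrightarrow> (f has_derivative frechet_derivative f (at X)) (at X)"
  using frechet_derivative_works by auto

lemma Ck_Suc_D: "Ck (Suc k) f \<Longrightarrow> Ck k f"
proof (induction k arbitrary: f)
  case 0
  then show ?case
    by (simp add: continuous_at_imp_continuous_on differentiable_imp_continuous_within)
next
  case (Suc k)
  show ?case
    by (rule Ck_SucI[OF Ck_has_derivative[OF Suc.prems]]) (use Suc in simp)
qed

lemma Ck_continuous: "Ck k f \<Longrightarrow> continuous_on UNIV f"
  by (induction k arbitrary: f) (use Ck_Suc_D in auto)

lemma Ck_const: "Ck k (\<lambda>X. c)"
proof (induction k arbitrary: c)
  case (Suc k)
  show ?case by (rule Ck_SucI[where F = "\<lambda>X v. 0"]) (use Suc in auto)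
qed simp

lemma Ck_add: "Ck k f \<Longrightarrow> Ck k g \<Longrightarrow> Ck k (\<lambda>X. f X + g X)"
proof (induction k arbitrary: f g)
  case 0
  then show ?case by (simp add: continuous_on_add)
next
  case (Suc k)
  show ?case
    by (rule Ck_SucI[OF has_derivative_add[OF Ck_has_derivative Ck_has_derivative]])
      (use Suc in auto)
qed

lemma Ck_mult: "Ck k f \<Longrightarrow> Ck k g \<Longrightarrow> Ck k (\<lambda>X. f X * g X)"
proof (induction k arbitrary: f g)
  case 0
  then show ?case by (simp add: continuous_on_mult)
next
  case (Suc k)
  show ?case
    by (rule Ck_SucI[OF has_derivative_mult[OF Ck_has_derivative Ck_has_derivative]])
      (use Suc Ck_Suc_D[OF Suc.prems(1)] Ck_Suc_D[OF Suc.prems(2)] in \<open>auto intro!: Ck_add\<close>)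
qed

lemma Ck_inner: "Ck k (\<lambda>X. X \<bullet> v)"
proof (cases k)
  case 0 then show ?thesis by (auto intro!: continuous_intros)
next
  case (Suc m)
  show ?thesis unfolding Suc
    by (rule Ck_SucI[where F = "\<lambda>X u. u \<bullet> v"]) (auto intro!: derivative_eq_intros Ck_const)
qed

lemma has_derivative_affine:
  assumes "(f has_derivative F) (at (a + c *\<^sub>R X))"
  shows "((\<lambda>X. f (a + c *\<^sub>R X)) has_derivative (\<lambda>v. F (c *\<^sub>R v))) (at X)"
proof -
  have "((\<lambda>X. a + c *\<^sub>R X) has_derivative (\<lambda>v. c *\<^sub>R v)) (at X)"
    by (auto intro!: derivative_eq_intros)
  from has_derivative_compose[OF this assms] show ?thesis .
qed

lemma dd_affine:
  fixes f :: "'a::euclidean_space \<Rightarrow> real"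
  assumes "Ck (Suc 0) f"
  shows "dd (\<lambda>X. f (a + c *\<^sub>R X)) v X = c * dd f v (a + c *\<^sub>R X)"
proof -
  note hd = Ck_has_derivative[OF assms, of "a + c *\<^sub>R X"]
  have "linear (frechet_derivative f (at (a + c *\<^sub>R X)))"
    using hd has_derivative_linear by blast
  then show ?thesis
    using frechet_derivative_eqI[OF has_derivative_affine[OF hd]] by (simp add: linear_cmul)
qed

lemma Ck_affine: "Ck k f \<Longrightarrow> Ck k (\<lambda>X. f (a + c *\<^sub>R X))"
proof (induction k arbitrary: f)
  case 0
  then show ?case
    by (auto intro!: continuous_on_compose2[of UNIV f] continuous_intros)
next
  case (Suc k)
  have 1: "Ck (Suc 0) f" using Suc.prems
    by (simp) (use Ck_continuous in blast)
  have "f differentiable at x" for x using Suc.prems by simp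
  then have df: "(\<lambda>X. f (a + c *\<^sub>R X)) differentiable at x" for x
    using has_derivative_affine[of f _ a c x] frechet_derivative_works
    by (meson differentiable_def)
  have "Ck k (\<lambda>X. c * dd f v (a + c *\<^sub>R X))" for v
    by (rule Ck_mult[OF Ck_const]) (use Suc in auto)
  then show ?case using df by (simp add: dd_affine[OF 1])
qed

text \<open>
  For \<open>p = 1\<close> this is the flat function \<open>exp (- 1 / t)\<close> extended by \<open>0\<close>. The family indexed by
  polynomials is closed under differentiation, which turns smoothness at \<open>t = 0\<close> into an induction.
\<close>

definition flat :: "real poly \<Rightarrow> real \<Rightarrow> real"
  where "flat p t = (if t > 0 then poly p (1 / t) * exp (- (1 / t)) else 0)"

lemma poly_exp_tendsto: "((\<lambda>s::real. poly p s * exp (- s)) \<longlongrightarrow> 0) at_top"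
proof -
  have "((\<lambda>s. \<Sum>i\<le>degree p. coeff p i * (s ^ i / exp s)) \<longlongrightarrow> (\<Sum>i\<le>degree p. coeff p i * 0)) at_top"
    by (intro tendsto_sum tendsto_mult tendsto_const tendsto_power_div_exp_0)
  then show ?thesis
    by (simp add: poly_altdef sum_distrib_right exp_minus divide_inverse mult.assoc)
qed

text \<open>
  Only \<open>t = 0\<close> needs an argument: there the difference quotient is \<open>s p(s) exp (- s)\<close> with
  \<open>s = 1 / t\<close>, and the exponential wins as \<open>s\<close> tends to infinity.
\<close>

lemma flat_has_derivative:
  "(flat p has_real_derivative flat (monom 1 2 * (p - pderiv p)) t) (at t)"
proof -
  consider "t > 0" | "t < 0" | "t = 0" by linarith
  then show ?thesis
  proof cases
    case 1
    have "((\<lambda>t. poly p (1 / t) * exp (- (1 / t))) has_real_derivative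
       flat (monom 1 2 * (p - pderiv p)) t) (at t)"
      using 1 by (auto intro!: derivative_eq_intros poly_DERIV
          simp: flat_def poly_monom field_simps power2_eq_square)
    then show ?thesis
      by (rule has_field_derivative_transform_within_open[where S = "{0<..}"])
        (use 1 in \<open>auto simp: flat_def\<close>)
  next
    case 2
    have "((\<lambda>t. 0) has_real_derivative flat (monom 1 2 * (p - pderiv p)) t) (at t)"
      using 2 by (auto simp: flat_def)
    then show ?thesis
      by (rule has_field_derivative_transform_within_open[where S = "{..<0}"])
        (use 2 in \<open>auto simp: flat_def\<close>)
  next
    case 3
    have "((\<lambda>h. poly (monom 1 1 * p) (inverse h) * exp (- inverse h)) \<longlongrightarrow> 0) (at_right 0)"
      by (rule filterlim_compose[OF poly_exp_tendsto filterlim_inverse_at_top_right])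
    moreover have "eventually (\<lambda>h. poly (monom 1 1 * p) (inverse h) * exp (- inverse h)
        = (flat p h - flat p 0) / (h - 0)) (at_right 0)"
      by (rule eventually_at_rightI[of 0 1]) (auto simp: flat_def poly_monom field_simps)
    ultimately have R: "((\<lambda>h. (flat p h - flat p 0) / (h - 0)) \<longlongrightarrow> 0) (at_right 0)"
      by (simp add: tendsto_cong)
    have "eventually (\<lambda>h. 0 = (flat p h - flat p 0) / (h - 0)) (at_left 0)"
      by (rule eventually_at_leftI[of "-1" 0]) (auto simp: flat_def)
    then have L: "((\<lambda>h. (flat p h - flat p 0) / (h - 0)) \<longlongrightarrow> 0) (at_left 0)"
      by (rule tendsto_eventually[OF eventually_mono]) auto
    have "((\<lambda>h. (flat p h - flat p 0) / (h - 0)) \<longlongrightarrow> 0) (at 0)"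
      using L R by (rule filterlim_split_at_real)
    then show ?thesis using 3
      by (simp add: has_field_derivative_iff flat_def)
  qed
qed

lemma Ck_flat: "Ck k (\<lambda>X::'a::euclidean_space. flat p (1 - X \<bullet> X))"
proof (induction k arbitrary: p)
  case 0
  have "continuous_on UNIV (flat p)"
    using flat_has_derivative DERIV_isCont continuous_at_imp_continuous_on by blast
  then show ?case
    by (auto intro!: continuous_on_compose2[of UNIV "flat p"] continuous_intros)
next
  case (Suc k)
  show ?case
  proof (rule Ck_SucI)
    fix X :: 'a
    have "((\<lambda>X. 1 - X \<bullet> X) has_derivative (\<lambda>v. -2 * (X \<bullet> v))) (at X)"
      by (auto intro!: derivative_eq_intros simp: inner_commute)
    from has_derivative_compose[OF this flat_has_derivative[unfolded has_field_derivative_def]]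
    show "((\<lambda>X. flat p (1 - X \<bullet> X)) has_derivative
       (\<lambda>v. flat (monom 1 2 * (p - pderiv p)) (1 - X \<bullet> X) * (-2 * (X \<bullet> v)))) (at X)" .
  next
    fix v :: 'a
    show "Ck k (\<lambda>X. flat (monom 1 2 * (p - pderiv p)) (1 - X \<bullet> X) * (-2 * (X \<bullet> v)))"
      by (intro Ck_mult Suc Ck_const Ck_inner)
  qed
qed

definition bump :: "'a::euclidean_space \<Rightarrow> real"
  where "bump X = flat 1 (1 - X \<bullet> X)"

lemma bump_nonneg: "0 \<le> bump X" by (simp add: bump_def flat_def)

lemma bump_zero: "1 \<le> norm X \<Longrightarrow> bump X = 0"
  using one_le_power[of "norm X" 2] by (simp add: bump_def flat_def dot_square_norm not_less)

text \<open>
  A positive lower bound on the half ball replaces the usual plateau of a cutoff function.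
\<close>

lemma bump_lower:
  assumes "norm X \<le> 1/2" shows "exp (-2) \<le> bump X"
proof -
  have "X \<bullet> X \<le> (1/2)^2" using assms
    by (metis dot_square_norm norm_ge_zero power_mono)
  then have n: "X \<bullet> X \<le> 1/4" by (simp add: power2_eq_square)
  then have "1 / (1 - X \<bullet> X) \<le> 2" by (simp add: field_simps)
  then show ?thesis using n by (simp add: bump_def flat_def)
qed

lemma Ck_bump: "Ck k bump"
  unfolding bump_def[abs_def] by (rule Ck_flat)

text \<open>
  Any compact set outside of which the function vanishes can serve in place of the support.
\<close>

lemma test_function_alt:
  "test_function E \<phi> \<longleftrightarrow> (\<forall>k. Ck k \<phi>) \<and> (\<exists>K. compact K \<and> K \<subseteq> E \<and> (\<forall>X. X \<notin> K \<longrightarrow> \<phi> X = 0))"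
  (is "_ = (_ \<and> ?R)")
proof -
  have "compact (closure {X. \<phi> X \<noteq> 0}) \<and> closure {X. \<phi> X \<noteq> 0} \<subseteq> E \<longleftrightarrow> ?R" (is "?L = _")
  proof
    assume ?L
    then show ?R
      by (intro exI[of _ "closure {X. \<phi> X \<noteq> 0}"]) (use closure_subset[of "{X. \<phi> X \<noteq> 0}"] in auto)
  next
    assume ?R
    then obtain K where K: "compact K" "K \<subseteq> E" "\<forall>X. X \<notin> K \<longrightarrow> \<phi> X = 0" by auto
    then have "closure {X. \<phi> X \<noteq> 0} \<subseteq> K"
      by (intro closure_minimal) (auto simp: compact_imp_closed)
    then show ?L using K
      by (meson bounded_subset closed_closure compact_eq_bounded_closed subset_trans)
  qed
  then show ?thesis by (auto simp: test_function_def)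
qed

lemma test_functionI:
  "(\<And>k. Ck k \<phi>) \<Longrightarrow> compact K \<Longrightarrow> K \<subseteq> E \<Longrightarrow> (\<And>X. X \<notin> K \<Longrightarrow> \<phi> X = 0) \<Longrightarrow> test_function E \<phi>"
  by (auto simp: test_function_alt)

lemma test_function_Ck: "test_function E \<phi> \<Longrightarrow> Ck k \<phi>"
  by (auto simp: test_function_def)

lemma test_function_mono: "test_function E \<phi> \<Longrightarrow> E \<subseteq> F \<Longrightarrow> test_function F \<phi>"
  by (auto simp: test_function_def)

lemma test_function_zero: "test_function E \<phi> \<Longrightarrow> X \<notin> E \<Longrightarrow> \<phi> X = 0"
  by (auto simp: test_function_alt)

lemma test_function_continuous: "test_function E \<phi> \<Longrightarrow> continuous_on UNIV \<phi>"
  using test_function_Ck Ck_continuous by blast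

lemma test_function_has_derivative:
  "test_function E \<phi> \<Longrightarrow> (\<phi> has_derivative frechet_derivative \<phi> (at X)) (at X)"
  using test_function_Ck Ck_has_derivative by blast

lemma test_function_mult:
  assumes "test_function E \<phi>" "\<And>k. Ck k \<psi>"
  shows "test_function E (\<lambda>X. \<phi> X * \<psi> X)"
proof -
  obtain K where "compact K" "K \<subseteq> E" "\<And>X. X \<notin> K \<Longrightarrow> \<phi> X = 0"
    using assms(1) by (auto simp: test_function_alt)
  then show ?thesis
    by (intro test_functionI[where K = K] Ck_mult) (use assms test_function_Ck in auto)
qed

lemma test_function_dd:
  assumes "test_function E \<phi>" shows "test_function E (dd \<phi> v)"
proof -
  obtain K where K: "compact K" "K \<subseteq> E" "\<And>X. X \<notin> K \<Longrightarrow> \<phi> X = 0"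
    using assms(1) by (auto simp: test_function_alt)
  have "dd \<phi> v X = 0" if "X \<notin> K" for X
  proof -
    have o: "open (- K)" using K compact_imp_closed by blast
    have "((\<lambda>X. 0) has_derivative (\<lambda>v. 0)) (at X)" by simp
    then have "(\<phi> has_derivative (\<lambda>v. 0)) (at X)"
      by (rule has_derivative_transform_within_open[OF _ o]) (use that K in auto)
    then show ?thesis by (simp add: frechet_derivative_eqI)
  qed
  moreover have "Ck k (dd \<phi> v)" for k
    using test_function_Ck[OF assms, of "Suc k"] by simp
  ultimately show ?thesis by (intro test_functionI[where K = K]) (use K in auto)
qed

lemma test_function_translate:
  assumes "test_function E \<phi>"
  shows "test_function ((\<lambda>X. X + a) ` E) (\<lambda>X. \<phi> (X - a))"
proof -
  obtain K where K: "compact K" "K \<subseteq> E" "\<And>X. X \<notin> K \<Longrightarrow> \<phi> X = 0"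
    using assms(1) by (auto simp: test_function_alt)
  have "Ck k (\<lambda>X. \<phi> (X - a))" for k
    using Ck_affine[OF test_function_Ck[OF assms], of k "- a" 1] by (simp add: algebra_simps)
  moreover have "\<phi> (X - a) = 0" if "X \<notin> (\<lambda>X. X + a) ` K" for X
    using that K(3)[of "X - a"] by (metis diff_add_cancel image_eqI)
  moreover have "compact ((\<lambda>X. X + a) ` K)"
    using compact_translation[OF K(1), of a] by (simp add: add.commute)
  ultimately show ?thesis
    using K by (intro test_functionI[where K = "(\<lambda>X. X + a) ` K"]) auto
qed

lemma dd_translate:
  assumes "test_function E \<phi>"
  shows "dd (\<lambda>X. \<phi> (X - a)) v X = dd \<phi> v (X - a)"
  using dd_affine[OF test_function_Ck[OF assms], where a = "- a" and c = 1 and v = v and X = X] by (simp add: algebra_simps)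

lemma dd_linear: "test_function E \<phi> \<Longrightarrow> linear (\<lambda>v. dd \<phi> v X)"
  using test_function_has_derivative has_derivative_linear by blast

lemma test_function_bounded:
  assumes "test_function E \<phi>" shows "\<exists>B>0. \<forall>X. \<bar>\<phi> X\<bar> \<le> B"
proof -
  obtain K where K: "compact K" "K \<subseteq> E" "\<And>X. X \<notin> K \<Longrightarrow> \<phi> X = 0"
    using assms(1) by (auto simp: test_function_alt)
  have "compact (\<phi> ` K)"
    by (rule compact_continuous_image[OF continuous_on_subset[OF test_function_continuous[OF assms]] K(1)]) auto
  then obtain B where B: "B > 0" "\<And>y. y \<in> \<phi> ` K \<Longrightarrow> norm y \<le> B"
    using bounded_pos[THEN iffD1, OF compact_imp_bounded] by metis
  have "\<bar>\<phi> X\<bar> \<le> B" for X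
    using B(1) B(2)[of "\<phi> X"] K(3)[of X] by (cases "X \<in> K") auto
  then show ?thesis using B(1) by blast
qed

text \<open>
  Two points at distance less than \<open>1\<close>, one of them in the support, both lie in a compact
  neighbourhood of it, where continuity is uniform.
\<close>

lemma compact_support_uniformly_continuous:
  fixes g :: "'a::euclidean_space \<Rightarrow> real"
  assumes "continuous_on UNIV g" "compact K" "\<And>X. X \<notin> K \<Longrightarrow> g X = 0"
  shows "uniformly_continuous_on UNIV g"
proof -
  obtain R where R: "\<And>X. X \<in> K \<Longrightarrow> norm X \<le> R"
    using compact_imp_bounded[OF assms(2)] bounded_iff by blast
  have uc: "uniformly_continuous_on (cball 0 (R + 1)) g"
    by (rule compact_uniformly_continuous[OF continuous_on_subset[OF assms(1)]]) auto
  show ?thesis unfolding uniformly_continuous_on_def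
  proof (intro allI impI)
    fix e :: real assume "e > 0"
    then obtain d where d: "d > 0" "\<And>X Y. X \<in> cball 0 (R+1) \<Longrightarrow> Y \<in> cball 0 (R+1) \<Longrightarrow> dist Y X < d \<Longrightarrow> dist (g Y) (g X) < e"
      using uc unfolding uniformly_continuous_on_def by metis
    have "dist (g Y) (g X) < e" if "dist Y X < min d 1" for X Y
    proof (cases "X \<in> K \<or> Y \<in> K")
      case True
      have "norm X \<le> R + 1 \<and> norm Y \<le> R + 1"
        using True that R[of X] R[of Y] norm_triangle_ineq2[of X Y] norm_triangle_ineq2[of Y X]
        by (auto simp: dist_norm norm_minus_commute)
      then show ?thesis using d that by (auto simp: dist_norm)
    next
      case False
      then show ?thesis using assms(3) \<open>e > 0\<close> by simp
    qed
    then show "\<exists>d>0. \<forall>x\<in>UNIV. \<forall>x'\<in>UNIV. dist x' x < d \<longrightarrow> dist (g x') (g x) < e"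
      using d(1) by (intro exI[of _ "min d 1"]) auto
  qed
qed

lemma test_function_uniformly_continuous:
  assumes "test_function E \<phi>" shows "uniformly_continuous_on UNIV \<phi>"
proof -
  obtain K where "compact K" "\<And>X. X \<notin> K \<Longrightarrow> \<phi> X = 0"
    using assms(1) by (auto simp: test_function_alt)
  then show ?thesis
    by (rule compact_support_uniformly_continuous[OF test_function_continuous[OF assms]])
qed

text \<open>
  The error is uniform in the base point, by the mean value theorem and the uniform continuity of
  the partial derivatives. It can therefore be integrated against any integrable function.
\<close>

lemma test_function_uniformly_differentiable:
  fixes \<phi> :: "'a::euclidean_space \<Rightarrow> real"
  assumes t: "test_function E \<phi>" and "e > 0"
  shows "\<exists>d>0. \<forall>Z H. norm H < d \<longrightarrow> \<bar>\<phi> (Z + H) - \<phi> Z - dd \<phi> H Z\<bar> \<le> e * norm H"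
proof -
  define e' where "e' = e / DIM('a)"
  have e': "e' > 0" using assms by (simp add: e'_def)
  have "\<forall>b\<in>Basis. \<exists>d>0. \<forall>X Y. norm (Y - X) < d \<longrightarrow> \<bar>dd \<phi> b Y - dd \<phi> b X\<bar> < e'"
  proof
    fix b :: 'a assume "b \<in> Basis"
    show "\<exists>d>0. \<forall>X Y. norm (Y - X) < d \<longrightarrow> \<bar>dd \<phi> b Y - dd \<phi> b X\<bar> < e'"
      using test_function_uniformly_continuous[OF test_function_dd[OF t, of b]] e'
      unfolding uniformly_continuous_on_def by (simp add: dist_norm)
  qed
  then obtain D where D: "\<And>b. b \<in> Basis \<Longrightarrow> D b > 0"
    "\<And>b X Y. b \<in> Basis \<Longrightarrow> norm (Y - X) < D b \<Longrightarrow> \<bar>dd \<phi> b Y - dd \<phi> b X\<bar> < e'" by metis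
  define d where "d = Min (D ` Basis)"
  have d: "d > 0" "\<And>b. b \<in> Basis \<Longrightarrow> d \<le> D b" using D(1) by (auto simp: d_def)
  have expand: "dd \<phi> H X = (\<Sum>b\<in>Basis. (H \<bullet> b) * dd \<phi> b X)" for H X
  proof -
    have l: "linear (\<lambda>v. dd \<phi> v X)" using dd_linear[OF t] .
    have "dd \<phi> H X = dd \<phi> (\<Sum>b\<in>Basis. (H \<bullet> b) *\<^sub>R b) X" by (simp add: euclidean_representation)
    also have "\<dots> = (\<Sum>b\<in>Basis. (H \<bullet> b) * dd \<phi> b X)"
      by (simp only: linear_sum[OF l] linear_cmul[OF l] real_scaleR_def)
    finally show ?thesis .
  qed
  have "\<bar>\<phi> (Z + H) - \<phi> Z - dd \<phi> H Z\<bar> \<le> e * norm H" if H: "norm H < d" for Z H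
  proof -
    have der: "((\<lambda>s. \<phi> (Z + s *\<^sub>R H)) has_real_derivative dd \<phi> H (Z + s *\<^sub>R H)) (at s)" for s
    proof -
      have "((\<lambda>s. Z + s *\<^sub>R H) has_derivative (\<lambda>u. u *\<^sub>R H)) (at s)"
        by (auto intro!: derivative_eq_intros)
      from has_derivative_compose[OF this test_function_has_derivative[OF t]]
      have "((\<lambda>s. \<phi> (Z + s *\<^sub>R H)) has_derivative (\<lambda>u. dd \<phi> (u *\<^sub>R H) (Z + s *\<^sub>R H))) (at s)" .
      moreover have "dd \<phi> (u *\<^sub>R H) (Z + s *\<^sub>R H) = dd \<phi> H (Z + s *\<^sub>R H) * u" for u
        using linear_cmul[OF dd_linear[OF t]] by simp
      ultimately show ?thesis by (simp add: has_field_derivative_def)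
    qed
    obtain s where s: "0 < s" "s < 1" "\<phi> (Z + 1 *\<^sub>R H) - \<phi> (Z + 0 *\<^sub>R H) = (1 - 0) * dd \<phi> H (Z + s *\<^sub>R H)"
      using MVT2[of 0 1 "\<lambda>s. \<phi> (Z + s *\<^sub>R H)" "\<lambda>s. dd \<phi> H (Z + s *\<^sub>R H)"] der by auto
    have "norm (s *\<^sub>R H) < d"
      using s H mult_left_le_one_le[of "norm H" s] by simp
    then have b: "\<bar>dd \<phi> b (Z + s *\<^sub>R H) - dd \<phi> b Z\<bar> \<le> e'" if "b \<in> Basis" for b
      using D(2)[OF that, of "Z + s *\<^sub>R H" Z] d(2)[OF that] by simp
    have "\<bar>\<phi> (Z + H) - \<phi> Z - dd \<phi> H Z\<bar> = \<bar>dd \<phi> H (Z + s *\<^sub>R H) - dd \<phi> H Z\<bar>" using s by simp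
    also have "\<dots> = \<bar>\<Sum>b\<in>Basis. (H \<bullet> b) * (dd \<phi> b (Z + s *\<^sub>R H) - dd \<phi> b Z)\<bar>"
      by (simp only: expand[where H = H] sum_subtractf right_diff_distrib)
    also have "\<dots> \<le> (\<Sum>b\<in>(Basis::'a set). norm H * e')"
      by (intro order_trans[OF sum_abs] sum_mono)
        (use b in \<open>auto simp: abs_mult intro!: mult_mono Basis_le_norm\<close>)
    also have "\<dots> = e * norm H" by (simp add: e'_def)
    finally show ?thesis .
  qed
  then show ?thesis using d(1) by blast
qed

lemma test_function_measurable:
  "test_function E \<phi> \<Longrightarrow> \<phi> \<in> borel_measurable borel"
  using borel_measurable_continuous_onI[OF test_function_continuous[of E \<phi>]] by simp

section \<open>Square-integrable functions\<close>

text \<open>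
  Borel measurability is built in, so that translates and products with two variables are
  measurable without passing to the completion.
\<close>

definition sq_integrable :: "('a::euclidean_space \<Rightarrow> real) \<Rightarrow> bool"
  where "sq_integrable f \<longleftrightarrow> f \<in> borel_measurable borel \<and> integrable lborel (\<lambda>x. (f x)\<^sup>2)"

lemma sq_integrableD[dest]: "sq_integrable f \<Longrightarrow> f \<in> borel_measurable borel" "sq_integrable f \<Longrightarrow> integrable lborel (\<lambda>x. (f x)\<^sup>2)"
  by (auto simp: sq_integrable_def)

lemma integrable_dominated:
  fixes f g :: "'a::euclidean_space \<Rightarrow> real"
  assumes "integrable lborel g" "f \<in> borel_measurable borel" "\<And>x. \<bar>f x\<bar> \<le> g x"
  shows "integrable lborel f"
proof (rule Bochner_Integration.integrable_bound[OF assms(1)])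
  show "AE x in lborel. norm (f x) \<le> norm (g x)"
    using assms(3) by (intro AE_I2) (smt (verit) real_norm_def)
qed (use assms in simp)

lemma integrable_mult_bounded:
  fixes f b :: "'a::euclidean_space \<Rightarrow> real"
  assumes "integrable lborel f" "b \<in> borel_measurable borel" "\<And>x. \<bar>b x\<bar> \<le> B"
  shows "integrable lborel (\<lambda>x. f x * b x)"
proof (rule integrable_dominated)
  show "integrable lborel (\<lambda>x. \<bar>f x\<bar> * B)" using assms(1) by simp
  show "(\<lambda>x. f x * b x) \<in> borel_measurable borel"
    using assms(1,2) by (auto dest: borel_measurable_integrable)
  show "\<bar>f x * b x\<bar> \<le> \<bar>f x\<bar> * B" for x using assms(3) by (simp add: abs_mult mult_left_mono)
qed

lemma abs_mult_le_sum_squares: "\<bar>x * y\<bar> \<le> x\<^sup>2 + (y::real)\<^sup>2"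
proof -
  have "2 * (\<bar>x\<bar> * \<bar>y\<bar>) \<le> \<bar>x\<bar>\<^sup>2 + \<bar>y\<bar>\<^sup>2" using sum_squares_bound[of "\<bar>x\<bar>" "\<bar>y\<bar>"] by (simp add: mult.assoc)
  moreover have "0 \<le> \<bar>x\<bar> * \<bar>y\<bar>" by simp
  ultimately have "\<bar>x\<bar> * \<bar>y\<bar> \<le> \<bar>x\<bar>\<^sup>2 + \<bar>y\<bar>\<^sup>2" by linarith
  then show ?thesis by (simp add: abs_mult)
qed

lemma sq_mult_integrable: "sq_integrable f \<Longrightarrow> sq_integrable g \<Longrightarrow> integrable lborel (\<lambda>x. f x * g x)"
  by (rule integrable_dominated[where g = "\<lambda>x. (f x)\<^sup>2 + (g x)\<^sup>2"]) (auto simp: abs_mult_le_sum_squares sq_integrable_def)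

lemma sq_dominated:
  assumes "sq_integrable g" "f \<in> borel_measurable borel" "\<And>x. \<bar>f x\<bar> \<le> \<bar>g x\<bar>"
  shows "sq_integrable f"
  unfolding sq_integrable_def
proof
  show "integrable lborel (\<lambda>x. (f x)\<^sup>2)"
    by (rule integrable_dominated[where g = "\<lambda>x. (g x)\<^sup>2"])
       (use assms in \<open>auto simp: sq_integrable_def abs_le_square_iff\<close>)
qed fact

lemma sq_cmult: "sq_integrable f \<Longrightarrow> sq_integrable (\<lambda>x. c * f x)"
  by (auto simp: sq_integrable_def power_mult_distrib)

lemma sq_add: assumes "sq_integrable f" "sq_integrable g" shows "sq_integrable (\<lambda>x. f x + g x)"
  unfolding sq_integrable_def
proof
  show "integrable lborel (\<lambda>x. (f x + g x)\<^sup>2)"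
    unfolding power2_sum mult.assoc
    using sq_integrableD(2)[OF assms(1)] sq_integrableD(2)[OF assms(2)] sq_mult_integrable[OF assms] by simp
qed (use sq_integrableD(1)[OF assms(1)] sq_integrableD(1)[OF assms(2)] in measurable)

lemma sq_diff: "sq_integrable f \<Longrightarrow> sq_integrable g \<Longrightarrow> sq_integrable (\<lambda>x. f x - g x)"
  using sq_add[of f "\<lambda>x. (-1) * g x"] sq_cmult[of g "-1"] by simp

lemma sq_sum: "(\<And>i. i \<in> I \<Longrightarrow> sq_integrable (f i)) \<Longrightarrow> sq_integrable (\<lambda>x. \<Sum>i\<in>I. f i x)"
  by (induction I rule: infinite_finite_induct) (auto simp: sq_integrable_def[of "\<lambda>x. 0"] intro!: sq_add)

lemma sq_mult_bounded:
  assumes "sq_integrable f" "b \<in> borel_measurable borel" "\<And>x. \<bar>b x\<bar> \<le> B"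
  shows "sq_integrable (\<lambda>x. b x * f x)"
proof (rule sq_dominated)
  show "sq_integrable (\<lambda>x. B * f x)" by (rule sq_cmult) fact
  show "\<bar>b x * f x\<bar> \<le> \<bar>B * f x\<bar>" for x
    using assms(3)[of x] by (simp add: abs_mult mult_right_mono)
qed (use assms in auto)

lemma sq_indicator: "sq_integrable f \<Longrightarrow> A \<in> sets borel \<Longrightarrow> sq_integrable (\<lambda>x. indicator A x * f x)"
  by (rule sq_mult_bounded[where B = 1]) (auto simp: indicator_def)

text \<open>
  The quadratic polynomial \<open>t \<mapsto> \<integral> (f - t g)\<^sup>2\<close> is nonnegative.
\<close>

lemma cauchy_schwarz_sq:
  assumes f: "sq_integrable f" and g: "sq_integrable g"
  shows "(LINT x|lborel. f x * g x)\<^sup>2 \<le> (LINT x|lborel. (f x)\<^sup>2) * (LINT x|lborel. (g x)\<^sup>2)"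
proof -
  let ?F = "LINT x|lborel. (f x)\<^sup>2" and ?G = "LINT x|lborel. (g x)\<^sup>2" and ?I = "LINT x|lborel. f x * g x"
  note int = sq_integrableD(2)[OF f] sq_integrableD(2)[OF g] sq_mult_integrable[OF f g]
  have F: "0 \<le> ?F" and G: "0 \<le> ?G" by simp_all
  have q: "0 \<le> ?F - 2 * t * ?I + t\<^sup>2 * ?G" for t
  proof -
    have "0 \<le> (LINT x|lborel. (f x - t * g x)\<^sup>2)" by simp
    also have "\<dots> = (LINT x|lborel. (f x)\<^sup>2 - (2 * t) * (f x * g x) + t\<^sup>2 * (g x)\<^sup>2)"
      by (rule Bochner_Integration.integral_cong) (auto simp: power2_eq_square algebra_simps)
    also have "\<dots> = ?F - 2 * t * ?I + t\<^sup>2 * ?G"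
      using int by simp
    finally show ?thesis .
  qed
  show ?thesis
  proof (cases "?G = 0")
    case True
    have "?I = 0"
    proof (rule ccontr)
      assume "?I \<noteq> 0"
      then show False using q[of "(?F + 1) / (2 * ?I)"] True by simp
    qed
    then show ?thesis using True by simp
  next
    case False
    then have "?G > 0" using G by linarith
    with q[of "?I / ?G"] show ?thesis
      by (simp add: field_simps power2_eq_square)
  qed
qed

lemma cauchy_schwarz_sq_abs:
  assumes f: "sq_integrable f" and g: "sq_integrable g"
  shows "\<bar>LINT x|lborel. f x * g x\<bar> \<le> sqrt (LINT x|lborel. (f x)\<^sup>2) * sqrt (LINT x|lborel. (g x)\<^sup>2)"
  using real_sqrt_le_mono[OF cauchy_schwarz_sq[OF assms]] by (simp add: real_sqrt_mult)

lemma integral_translate: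
  fixes f :: "'a::euclidean_space \<Rightarrow> 'b::{banach, second_countable_topology}"
  assumes [measurable]: "f \<in> borel_measurable borel"
  shows "(LINT x|lborel. f (x + a)) = (LINT x|lborel. f x)"
proof -
  have "(LINT x|lborel. f x) = (LINT x|distr lborel borel ((+) a). f x)"
    by (simp add: lborel_distr_plus)
  also have "\<dots> = (LINT x|lborel. f (a + x))" by (subst integral_distr) auto
  finally show ?thesis by (simp add: add.commute)
qed

lemma integrable_translate:
  fixes f :: "'a::euclidean_space \<Rightarrow> 'b::{banach, second_countable_topology}"
  assumes "integrable lborel f"
  shows "integrable lborel (\<lambda>x. f (x + a))"
proof -
  have "integrable (distr lborel borel ((+) a)) f" using assms by (simp add: lborel_distr_plus)
  then have "integrable lborel (\<lambda>x. f (a + x))"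
    using borel_measurable_integrable[OF assms] by (subst (asm) integrable_distr_eq) auto
  then show ?thesis by (simp add: add.commute)
qed

lemma sq_translate: "sq_integrable f \<Longrightarrow> sq_integrable (\<lambda>x. f (x + a))"
  unfolding sq_integrable_def using integrable_translate[of "\<lambda>x. (f x)\<^sup>2" a] by auto

lemma integral_le_of_dominated:
  fixes f g :: "'a::euclidean_space \<Rightarrow> real"
  assumes "integrable lborel g" "\<And>x. 0 \<le> g x" "\<And>x. f x \<le> g x"
  shows "(LINT x|lborel. f x) \<le> (LINT x|lborel. g x)"
  by (rule Bochner_Integration.integral_mono') (use assms in auto)

lemma square_sum_le: "((x::real) + y)\<^sup>2 \<le> 2 * x\<^sup>2 + 2 * y\<^sup>2"
proof -
  have "0 \<le> (x - y)\<^sup>2" by simp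
  then show ?thesis by (simp add: power2_eq_square algebra_simps)
qed

lemma integral_square_add_le:
  assumes f: "sq_integrable f" and g: "sq_integrable g"
  shows "(LINT x|lborel. (f x + g x)\<^sup>2) \<le> 2 * (LINT x|lborel. (f x)\<^sup>2) + 2 * (LINT x|lborel. (g x)\<^sup>2)"
proof -
  have "(LINT x|lborel. (f x + g x)\<^sup>2) \<le> (LINT x|lborel. 2 * (f x)\<^sup>2 + 2 * (g x)\<^sup>2)"
    by (rule integral_le_of_dominated) (use sq_integrableD[OF f] sq_integrableD[OF g] in \<open>auto simp: square_sum_le\<close>)
  also have "\<dots> = 2 * (LINT x|lborel. (f x)\<^sup>2) + 2 * (LINT x|lborel. (g x)\<^sup>2)"
    using sq_integrableD[OF f] sq_integrableD[OF g] by simp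
  finally show ?thesis .
qed

lemma integrable_indicator_bounded:
  "bounded S \<Longrightarrow> (S::'a::euclidean_space set) \<in> sets borel \<Longrightarrow> integrable lborel (indicat_real S)"
  using emeasure_bounded_finite[of S] by (simp add: integrable_indicator_iff)

text \<open>
  Clip the values to \<open>[- n, n]\<close> and cut off outside the ball of radius \<open>n\<close>; dominated convergence
  with majorant \<open>f\<^sup>2\<close> applies.
\<close>

lemma sq_approx_bounded:
  fixes f :: "'a::euclidean_space \<Rightarrow> real"
  assumes f: "sq_integrable f" and "e > 0"
  shows "\<exists>g (n::nat). g \<in> borel_measurable borel \<and> (\<forall>x. \<bar>g x\<bar> \<le> n \<and> (n < norm x \<longrightarrow> g x = 0)) \<and>
     (LINT x|lborel. (f x - g x)\<^sup>2) < e"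
proof -
  define g where "g n x = (if norm x \<le> real n then max (- real n) (min (real n) (f x)) else 0)" for n x
  have [measurable]: "f \<in> borel_measurable borel" using f by auto
  have gm[measurable]: "g n \<in> borel_measurable borel" for n unfolding g_def[abs_def] by measurable
  have "(\<lambda>n. LINT x|lborel. (f x - g n x)\<^sup>2) \<longlonglongrightarrow> (LINT x::'a|lborel. 0)"
  proof (rule integral_dominated_convergence[where w = "\<lambda>x. (f x)\<^sup>2"])
    show "AE x in lborel. (\<lambda>n. (f x - g n x)\<^sup>2) \<longlonglongrightarrow> 0"
    proof (rule AE_I2)
      fix x :: 'a
      obtain N :: nat where N: "norm x + \<bar>f x\<bar> \<le> N" using real_arch_simple by blast
      have "eventually (\<lambda>n. (f x - g n x)\<^sup>2 = 0) sequentially"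
        unfolding eventually_sequentially
      proof (intro exI[of _ N] allI impI)
        fix n assume "N \<le> n"
        then have "real N \<le> real n" by simp
        then have "norm x \<le> real n" "\<bar>f x\<bar> \<le> real n" using N norm_ge_zero[of x] by linarith+
        then have "g n x = f x" by (auto simp: g_def)
        then show "(f x - g n x)\<^sup>2 = 0" by simp
      qed
      then show "(\<lambda>n. (f x - g n x)\<^sup>2) \<longlonglongrightarrow> 0" by (rule tendsto_eventually)
    qed
    show "AE x in lborel. norm ((f x - g n x)\<^sup>2) \<le> (f x)\<^sup>2" for n
      by (intro AE_I2) (auto simp: g_def abs_le_square_iff[symmetric])
  qed (use f in auto)
  then have "eventually (\<lambda>n. (LINT x|lborel. (f x - g n x)\<^sup>2) < e) sequentially"
    using \<open>e > 0\<close> by (auto intro: order_tendstoD)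
  then obtain n where "(LINT x|lborel. (f x - g n x)\<^sup>2) < e"
    by (auto simp: eventually_sequentially)
  moreover have "\<bar>g n x\<bar> \<le> n \<and> (n < norm x \<longrightarrow> g n x = 0)" for x by (auto simp: g_def)
  ultimately show ?thesis using gm by blast
qed

text \<open>
  A measurable function is almost everywhere a limit of continuous functions. Clipped and
  multiplied by a continuous cutoff these have a common integrable majorant.
\<close>

lemma bounded_approx_continuous:
  fixes f :: "'a::euclidean_space \<Rightarrow> real"
  assumes [measurable]: "f \<in> borel_measurable borel"
    and B: "\<And>x. \<bar>f x\<bar> \<le> B" and R: "\<And>x. R < norm x \<Longrightarrow> f x = 0" and "e > 0"
  shows "\<exists>g K. continuous_on UNIV g \<and> compact K \<and> (\<forall>x. x \<notin> K \<longrightarrow> g x = 0) \<and>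
     (LINT x|lborel. (f x - g x)\<^sup>2) < e"
proof -
  have "f measurable_on UNIV"
    by (rule lebesgue_measurable_imp_measurable_on_real) (auto intro: measurable_completion)
  then obtain N g where N: "negligible N" and g: "\<And>n. continuous_on UNIV (g n)"
    and lim: "\<And>x. x \<notin> N \<Longrightarrow> (\<lambda>n. g n x) \<longlonglongrightarrow> f x"
    unfolding measurable_on_def by auto
  define h where "h n x = max (- B) (min B (g n x)) * max 0 (min 1 (R + 1 - norm x))" for n x
  have hc: "continuous_on UNIV (h n)" for n
    unfolding h_def[abs_def] by (intro continuous_intros g)
  then have hm[measurable]: "h n \<in> borel_measurable borel" for n
    by (rule borel_measurable_continuous_onI)
  have h0: "h n x = 0" if "x \<notin> cball 0 (R + 1)" for n x using that by (auto simp: h_def)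
  have B0: "0 \<le> B" using B[of 0] by simp
  have hb: "\<bar>h n x\<bar> \<le> B" for n x
  proof -
    have "\<bar>h n x\<bar> \<le> B * 1" unfolding h_def abs_mult
      by (intro mult_mono) (use B0 in auto)
    then show ?thesis by simp
  qed
  have "(\<lambda>n. LINT x|lborel. (f x - h n x)\<^sup>2) \<longlonglongrightarrow> (LINT x::'a|lborel. 0)"
  proof (rule integral_dominated_convergence[where w = "\<lambda>x. (2 * B)\<^sup>2 * indicator (cball 0 (R+1)) x"])
    have "AE x in lebesgue. x \<notin> N"
      using N by (simp add: AE_not_in negligible_iff_null_sets)
    then have "AE x in lborel. x \<notin> N" by (simp add: AE_completion_iff)
    then show "AE x in lborel. (\<lambda>n. (f x - h n x)\<^sup>2) \<longlonglongrightarrow> 0"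
    proof eventually_elim
      case (elim x)
      have "(\<lambda>n. h n x) \<longlonglongrightarrow> max (- B) (min B (f x)) * max 0 (min 1 (R + 1 - norm x))"
        unfolding h_def by (intro tendsto_intros lim[OF elim])
      also have "max (- B) (min B (f x)) * max 0 (min 1 (R + 1 - norm x)) = f x"
        using B[of x] R[of x] by (cases "R < norm x") (auto simp: abs_le_iff max_def min_def)
      finally have "(\<lambda>n. (f x - h n x)\<^sup>2) \<longlonglongrightarrow> (f x - f x)\<^sup>2"
        by (intro tendsto_intros)
      then show ?case by simp
    qed
    show "AE x in lborel. norm ((f x - h n x)\<^sup>2) \<le> (2 * B)\<^sup>2 * indicator (cball 0 (R+1)) x" for n
    proof (rule AE_I2)
      fix x :: 'a
      show "norm ((f x - h n x)\<^sup>2) \<le> (2 * B)\<^sup>2 * indicator (cball 0 (R+1)) x"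
      proof (cases "x \<in> cball 0 (R+1)")
        case True
        have "\<bar>f x - h n x\<bar> \<le> 2 * B" using B[of x] hb[of n x] by linarith
        then have "(f x - h n x)\<^sup>2 \<le> (2*B)\<^sup>2" using B0 abs_le_square_iff[of "f x - h n x" "2 * B"] by simp
        then show ?thesis using True by simp
      next
        case False
        then show ?thesis using h0[OF False] R[of x] by auto
      qed
    qed
    show "integrable lborel (\<lambda>x. (2 * B)\<^sup>2 * indicat_real (cball 0 (R+1)) x)"
      by (intro integrable_mult_right integrable_indicator_bounded) auto
  qed auto
  then have "eventually (\<lambda>n. (LINT x|lborel. (f x - h n x)\<^sup>2) < e) sequentially"
    using \<open>e > 0\<close> by (auto intro: order_tendstoD)
  then obtain n where "(LINT x|lborel. (f x - h n x)\<^sup>2) < e"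
    by (auto simp: eventually_sequentially)
  then show ?thesis using hc h0 by (intro exI[of _ "h n"] exI[of _ "cball 0 (R+1)"]) auto
qed

lemma continuous_compact_support_sq:
  fixes g :: "'a::euclidean_space \<Rightarrow> real"
  assumes "continuous_on UNIV g" "compact K" "\<And>x. x \<notin> K \<Longrightarrow> g x = 0"
  shows "sq_integrable g" "integrable lborel g"
proof -
  have m[measurable]: "g \<in> borel_measurable borel" using assms(1) by (rule borel_measurable_continuous_onI)
  have K[measurable]: "K \<in> sets borel" using assms(2) by (simp add: borel_compact)
  have "bounded (g ` K)"
    using compact_imp_bounded compact_continuous_image[OF continuous_on_subset[OF assms(1)] assms(2)] by blast
  then obtain B where B: "\<And>x. x \<in> K \<Longrightarrow> \<bar>g x\<bar> \<le> B" by (auto simp: bounded_iff)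
  have i: "integrable lborel (\<lambda>x. c * indicat_real K x)" for c
    by (intro integrable_mult_right integrable_indicator_bounded compact_imp_bounded assms K)
  show "integrable lborel g"
    by (rule integrable_dominated[OF i[of B]]) (use B assms(3) in \<open>auto simp: indicator_def\<close>)
  have "integrable lborel (\<lambda>x. (g x)\<^sup>2)"
  proof (rule integrable_dominated[OF i[of "B\<^sup>2"]])
    fix x show "\<bar>(g x)\<^sup>2\<bar> \<le> B\<^sup>2 * indicat_real K x"
      using B[of x] assms(3)[of x] power_mono[of "\<bar>g x\<bar>" B 2] by (cases "x \<in> K") auto
  qed simp
  then show "sq_integrable g" by (simp add: sq_integrable_def)
qed

lemma sq_approx_continuous:
  fixes f :: "'a::euclidean_space \<Rightarrow> real"
  assumes f: "sq_integrable f" and "e > 0"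
  shows "\<exists>g K. continuous_on UNIV g \<and> compact K \<and> (\<forall>x. x \<notin> K \<longrightarrow> g x = 0) \<and>
     (LINT x|lborel. (f x - g x)\<^sup>2) < e"
proof -
  obtain g1 n where g1: "g1 \<in> borel_measurable borel" "\<And>x. \<bar>g1 x\<bar> \<le> real n" "\<And>x. real n < norm x \<Longrightarrow> g1 x = 0"
     "(LINT x|lborel. (f x - g1 x)\<^sup>2) < e / 4"
    using sq_approx_bounded[OF f, of "e/4"] \<open>e > 0\<close> by auto
  obtain g K where g: "continuous_on UNIV g" "compact K" "\<And>x. x \<notin> K \<Longrightarrow> g x = 0"
     "(LINT x|lborel. (g1 x - g x)\<^sup>2) < e / 4"
    using bounded_approx_continuous[OF g1(1,2,3), where e = "e/4" and R = "real n"] \<open>e > 0\<close> by auto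
  have sg: "sq_integrable g" using continuous_compact_support_sq[OF g(1,2,3)] by simp
  have s1: "sq_integrable g1"
    unfolding sq_integrable_def
  proof
    show "integrable lborel (\<lambda>x. (g1 x)\<^sup>2)"
    proof (rule integrable_dominated[where g = "\<lambda>x. (real n)\<^sup>2 * indicat_real (cball 0 n) x"])
      show "\<bar>(g1 x)\<^sup>2\<bar> \<le> (real n)\<^sup>2 * indicat_real (cball 0 n) x" for x
        using g1(2)[of x] g1(3)[of x] power_mono[of "\<bar>g1 x\<bar>" n 2] by (auto simp: indicator_def)
      show "integrable lborel (\<lambda>x. (real n)\<^sup>2 * indicat_real (cball 0 n) x)"
        by (intro integrable_mult_right integrable_indicator_bounded) auto
    qed (use g1 in auto)
  qed fact
  have "(LINT x|lborel. (f x - g x)\<^sup>2) \<le> 2 * (LINT x|lborel. (f x - g1 x)\<^sup>2) + 2 * (LINT x|lborel. (g1 x - g x)\<^sup>2)"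
    using integral_square_add_le[OF sq_diff[OF f s1] sq_diff[OF s1 sg]] by simp
  also have "\<dots> < e" using g g1 by simp
  finally show ?thesis using g by blast
qed

text \<open>
  Obvious for continuous functions of compact support, which are uniformly continuous; the general
  case follows by density, since translations are isometries of \<open>L\<^sup>2\<close>.
\<close>

lemma sq_translation_continuous:
  fixes f :: "'a::euclidean_space \<Rightarrow> real"
  assumes f: "sq_integrable f" and "e > 0"
  shows "\<exists>d>0. \<forall>a. norm a < d \<longrightarrow> (LINT x|lborel. (f (x + a) - f x)\<^sup>2) < e"
proof -
  obtain g K where g: "continuous_on UNIV g" "compact K" "\<And>x. x \<notin> K \<Longrightarrow> g x = 0"
     and fg: "(LINT x|lborel. (f x - g x)\<^sup>2) < e / 16"
    using sq_approx_continuous[OF f, of "e/16"] \<open>e > 0\<close> by auto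
  have sg: "sq_integrable g" using continuous_compact_support_sq[OF g(1,2,3)] by simp
  obtain R where R: "R > 0" "\<And>x. x \<in> K \<Longrightarrow> norm x \<le> R"
    using bounded_pos[THEN iffD1, OF compact_imp_bounded[OF g(2)]] by metis
  define V where "V = measure lborel (cball (0::'a) (R + 1))"
  have V: "V \<ge> 0" by (simp add: V_def)
  define w where "w = sqrt (e / (8 * (V + 1)))"
  have w: "w > 0" "w\<^sup>2 = e / (8 * (V + 1))" using \<open>e > 0\<close> V by (auto simp: w_def)
  obtain d where d: "d > 0" "\<And>x y. dist y x < d \<Longrightarrow> \<bar>g y - g x\<bar> < w"
    using compact_support_uniformly_continuous[OF g(1,2,3)] w(1)
    unfolding uniformly_continuous_on_def by (auto simp: dist_real_def) 
  have "(LINT x|lborel. (f (x + a) - f x)\<^sup>2) < e" if a: "norm a < min d 1" for a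
  proof -
    let ?u = "\<lambda>x. f x - g x"
    have su: "sq_integrable ?u" by (rule sq_diff[OF f sg])
    have sga: "sq_integrable (\<lambda>x. g (x + a) - g x)" by (rule sq_diff[OF sq_translate[OF sg] sg])
    have b: "(g (x + a) - g x)\<^sup>2 \<le> w\<^sup>2 * indicator (cball 0 (R + 1)) x" for x
    proof (cases "x \<in> cball 0 (R + 1)")
      case True
      have "\<bar>g (x + a) - g x\<bar> < w" using d(2)[of "x + a" x] a by (simp add: dist_norm)
      then show ?thesis using True w(1) by (simp add: abs_le_square_iff[symmetric])
    next
      case False
      then have "x \<notin> K" "x + a \<notin> K"
        using R(2)[of x] R(2)[of "x + a"] a norm_triangle_ineq4[of "x + a" a] by auto
      then show ?thesis using g(3) by simp
    qed
    have "(LINT x|lborel. (g (x + a) - g x)\<^sup>2) \<le> (LINT x|lborel. w\<^sup>2 * indicator (cball (0::'a) (R + 1)) x)"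
      by (rule integral_le_of_dominated[OF _ _ b]) (auto intro!: integrable_mult_right integrable_indicator_bounded)
    also have "\<dots> = w\<^sup>2 * V" by (simp add: V_def)
    also have "\<dots> \<le> e / 8" using V \<open>e > 0\<close> unfolding w(2) by (simp add: field_simps)
    finally have 1: "(LINT x|lborel. (g (x + a) - g x)\<^sup>2) \<le> e / 8" .
    have 2: "(LINT x|lborel. (?u (x + a))\<^sup>2) = (LINT x|lborel. (?u x)\<^sup>2)"
      by (rule integral_translate[where f = "\<lambda>x. (?u x)\<^sup>2"]) (use su in auto)
    have 3: "(LINT x|lborel. (?u (x + a) - ?u x)\<^sup>2) \<le> e / 4"
      using integral_square_add_le[OF sq_translate[OF su, of a] sq_cmult[OF su, of "-1"]] 2 fg
      by (simp add: power2_commute[of "g _" "f _"] algebra_simps)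
    have "(LINT x|lborel. (f (x + a) - f x)\<^sup>2) =
      (LINT x|lborel. ((?u (x + a) - ?u x) + (g (x + a) - g x))\<^sup>2)" by simp
    also have "\<dots> \<le> 2 * (e/4) + 2 * (e / 8)"
      using integral_square_add_le[OF sq_diff[OF sq_translate[OF su, of a] su] sga] 1 3 by simp
    also have "\<dots> < e" using \<open>e > 0\<close> by simp
    finally show ?thesis .
  qed
  then show ?thesis using d(1) by (intro exI[of _ "min d 1"]) auto
qed

section \<open>Mollification and duality\<close>

text \<open>
  The convolution of \<open>f\<close> with the reflection of \<open>k\<close>. For a smooth \<open>k\<close> it is the mollification of
  \<open>f\<close>; read as a function of \<open>X\<close> it is also the pairing of \<open>f\<close> with the translates of a fixed test
  function, which is how difference quotients enter.
\<close>

definition correlation :: "('a::euclidean_space \<Rightarrow> real) \<Rightarrow> ('a \<Rightarrow> real) \<Rightarrow> 'a \<Rightarrow> real"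
  where "correlation f k X = (LINT Z|lborel. f Z * k (Z - X))"

lemma correlation_shift:
  assumes [measurable]: "f \<in> borel_measurable borel" "k \<in> borel_measurable borel"
  shows "correlation f k X = (LINT Z|lborel. f (Z + X) * k Z)"
  unfolding correlation_def by (subst integral_translate[of _ X, symmetric]) auto

lemma test_function_sq:
  assumes "test_function E \<phi>" shows "sq_integrable \<phi>" "integrable lborel \<phi>"
proof -
  obtain K where "compact K" "\<And>X. X \<notin> K \<Longrightarrow> \<phi> X = 0"
    using assms(1) by (auto simp: test_function_alt)
  then show "sq_integrable \<phi>" "integrable lborel \<phi>"
    using continuous_compact_support_sq[OF test_function_continuous[OF assms]] by auto
qed

lemma integrable_mult_test:
  assumes "integrable lborel f" "test_function E \<phi>"
  shows "integrable lborel (\<lambda>Z. f Z * \<phi> (Z - X))"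
proof -
  obtain B where "\<And>X. \<bar>\<phi> X\<bar> \<le> B" using test_function_bounded[OF assms(2)] by auto
  moreover have "(\<lambda>Z. \<phi> (Z - X)) \<in> borel_measurable borel"
    using test_function_measurable[OF assms(2)] by measurable
  ultimately show ?thesis by (intro integrable_mult_bounded[OF assms(1)]) auto
qed

text \<open>
  Differentiation under the integral sign. The remainder is at most \<open>\<epsilon> |Y - X| \<integral> |f|\<close> by uniform
  differentiability of the test function.
\<close>

lemma correlation_has_derivative:
  fixes f :: "'a::euclidean_space \<Rightarrow> real"
  assumes f: "integrable lborel f" and t: "test_function E \<phi>"
  shows "(correlation f \<phi> has_derivative (\<lambda>v. - correlation f (dd \<phi> v) X)) (at X)"
  unfolding has_derivative_at_alt
proof (intro conjI allI impI)
  note int = integrable_mult_test[OF f]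
  have lin: "dd \<phi> (u + v) Z = dd \<phi> u Z + dd \<phi> v Z" "dd \<phi> (c *\<^sub>R v) Z = c * dd \<phi> v Z" for u v Z c
    using dd_linear[OF t, of Z] by (auto simp: linear_add linear_cmul)
  have "linear (\<lambda>v. - correlation f (dd \<phi> v) X)"
  proof (rule linearI)
    fix u v :: 'a and c :: real
    show "- correlation f (dd \<phi> (u + v)) X = - correlation f (dd \<phi> u) X + - correlation f (dd \<phi> v) X"
      using int[OF test_function_dd[OF t]] by (simp add: correlation_def lin distrib_left)
    show "- correlation f (dd \<phi> (c *\<^sub>R v)) X = c *\<^sub>R - correlation f (dd \<phi> v) X"
      by (simp add: correlation_def lin mult.left_commute)
  qed
  then show "bounded_linear (\<lambda>v. - correlation f (dd \<phi> v) X)" by (rule linear_conv_bounded_linear[THEN iffD1])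
next
  note int = integrable_mult_test[OF f]
  fix e :: real assume "e > 0"
  define I where "I = (LINT Z|lborel. \<bar>f Z\<bar>)"
  have I: "I \<ge> 0" by (simp add: I_def)
  define e' where "e' = e / (I + 1)"
  have e': "e' > 0" "I * e' \<le> e" using \<open>e > 0\<close> I by (auto simp: e'_def field_simps)
  obtain d where d: "d > 0" "\<And>Z H. norm H < d \<Longrightarrow> \<bar>\<phi> (Z + H) - \<phi> Z - dd \<phi> H Z\<bar> \<le> e' * norm H"
    using test_function_uniformly_differentiable[OF t e'(1)] by auto
  have "norm (correlation f \<phi> Y - correlation f \<phi> X - - correlation f (dd \<phi> (Y - X)) X) \<le> e * norm (Y - X)"
    if Y: "norm (Y - X) < d" for Y
  proof -
    define H where "H = X - Y"
    have H: "norm H < d" "norm H = norm (Y - X)" using Y by (auto simp: H_def norm_minus_commute)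
    have neg: "dd \<phi> (Y - X) Z = - dd \<phi> H Z" for Z
      using linear_neg[OF dd_linear[OF t, of Z], of H] by (simp add: H_def)
    have b: "\<bar>f Z * \<phi> (Z - Y) - f Z * \<phi> (Z - X) - f Z * dd \<phi> H (Z - X)\<bar> \<le> \<bar>f Z\<bar> * (e' * norm H)" for Z
    proof -
      have "f Z * \<phi> (Z - Y) - f Z * \<phi> (Z - X) - f Z * dd \<phi> H (Z - X) =
         f Z * (\<phi> ((Z - X) + H) - \<phi> (Z - X) - dd \<phi> H (Z - X))"
        by (simp add: H_def algebra_simps)
      then show ?thesis using d(2)[OF H(1), of "Z - X"] by (simp add: abs_mult mult_left_mono)
    qed
    have "correlation f \<phi> Y - correlation f \<phi> X - - correlation f (dd \<phi> (Y - X)) X =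
       (LINT Z|lborel. f Z * \<phi> (Z - Y) - f Z * \<phi> (Z - X) - f Z * dd \<phi> H (Z - X))"
      using int[OF t] int[OF test_function_dd[OF t]] by (simp add: correlation_def neg)
    then have "norm (correlation f \<phi> Y - correlation f \<phi> X - - correlation f (dd \<phi> (Y - X)) X) \<le>
       (LINT Z|lborel. \<bar>f Z * \<phi> (Z - Y) - f Z * \<phi> (Z - X) - f Z * dd \<phi> H (Z - X)\<bar>)"
      by (simp only: real_norm_def integral_abs_bound)
    moreover have "(LINT Z|lborel. \<bar>f Z * \<phi> (Z - Y) - f Z * \<phi> (Z - X) - f Z * dd \<phi> H (Z - X)\<bar>)
        \<le> (LINT Z|lborel. \<bar>f Z\<bar> * (e' * norm H))"
      by (rule integral_le_of_dominated) (use f b e' in auto)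
    moreover have "(LINT Z|lborel. \<bar>f Z\<bar> * (e' * norm H)) = I * e' * norm H" by (simp add: I_def)
    moreover have "I * e' * norm H \<le> e * norm (Y - X)" using e'(2) H(2) by (simp add: mult_right_mono)
    ultimately show ?thesis by linarith
  qed
  then show "\<exists>d>0. \<forall>Y. norm (Y - X) < d \<longrightarrow>
      norm (correlation f \<phi> Y - correlation f \<phi> X - - correlation f (dd \<phi> (Y - X)) X) \<le> e * norm (Y - X)"
    using d(1) by blast
qed

lemma Ck_correlation:
  assumes f: "integrable lborel f"
  shows "test_function E \<phi> \<Longrightarrow> Ck k (correlation f \<phi>)"
proof (induction k arbitrary: \<phi>)
  case 0
  then show ?case
    using has_derivative_continuous[OF correlation_has_derivative[OF f 0]]
    by (auto intro!: continuous_at_imp_continuous_on)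
next
  case (Suc k)
  show ?case
  proof (rule Ck_SucI[OF correlation_has_derivative[OF f Suc.prems]])
    fix v
    have "Ck k (\<lambda>X. (-1) * correlation f (dd \<phi> v) X)"
      by (intro Ck_mult Ck_const Suc.IH test_function_dd[OF Suc.prems])
    then show "Ck k (\<lambda>X. - correlation f (dd \<phi> v) X)" by simp
  qed
qed

lemma dd_correlation:
  assumes "integrable lborel f" "test_function E \<phi>"
  shows "dd (correlation f \<phi>) v X = - correlation f (dd \<phi> v) X"
  using frechet_derivative_eqI[OF correlation_has_derivative[OF assms]] by simp

definition kernel :: "real \<Rightarrow> ('a::euclidean_space \<Rightarrow> real) \<Rightarrow> bool"
  where "kernel d k \<longleftrightarrow> k \<in> borel_measurable borel \<and> (\<forall>x. 0 \<le> k x) \<and> (\<exists>B. \<forall>x. k x \<le> B) \<and>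
     (\<forall>x. d \<le> norm x \<longrightarrow> k x = 0) \<and> integrable lborel k \<and> (LINT x|lborel. k x) = 1"

text \<open>
  By the Cauchy--Schwarz inequality for the probability density \<open>k\<close>, the squared deviation at \<open>X\<close>
  is at most \<open>\<integral> k Z (f (X + Z) - f X)\<^sup>2\<close>. After integration in \<open>X\<close> this is an average of squared
  \<open>L\<^sup>2\<close> distances between \<open>f\<close> and its translates by small vectors. The choice of \<open>d\<close> is uniform
  over all kernels, so the lemma serves for mollifiers and for averages over grid cells alike.
\<close>

lemma approximate_identity:
  fixes f :: "'a::euclidean_space \<Rightarrow> real"
  assumes f: "sq_integrable f" "integrable lborel f" and "e > 0"
  shows "\<exists>d>0. \<forall>k. kernel d k \<longrightarrow>
     sq_integrable (\<lambda>X. correlation f k X - f X) \<and> (LINT X|lborel. (correlation f k X - f X)\<^sup>2) \<le> e"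
proof -
  obtain d where d: "d > 0" "\<And>a. norm a < d \<Longrightarrow> (LINT x|lborel. (f (x + a) - f x)\<^sup>2) < e"
    using sq_translation_continuous[OF f(1) \<open>e > 0\<close>] by auto
  have [measurable]: "f \<in> borel_measurable borel" using f by auto
  have "sq_integrable (\<lambda>X. correlation f k X - f X) \<and> (LINT X|lborel. (correlation f k X - f X)\<^sup>2) \<le> e" if k: "kernel d k" for k
  proof -
    obtain B where [measurable]: "k \<in> borel_measurable borel" and k0: "\<And>x. 0 \<le> k x" and kB: "\<And>x. k x \<le> B"
      and kd: "\<And>x. d \<le> norm x \<Longrightarrow> k x = 0" and ki: "integrable lborel k" and k1: "(LINT x|lborel. k x) = 1"
      using k by (auto simp: kernel_def)
    have "(\<lambda>X. correlation f k X) \<in> borel_measurable borel"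
      unfolding correlation_def by measurable
    then have m[measurable]: "(\<lambda>X. correlation f k X - f X) \<in> borel_measurable borel" by measurable
    have kn: "(\<integral>\<^sup>+Z. ennreal (k Z) \<partial>lborel) = 1"
      using nn_integral_eq_integral[OF ki] k0 k1 by simp
    have pw: "ennreal ((correlation f k X - f X)\<^sup>2) \<le> (\<integral>\<^sup>+Z. ennreal (k Z * (f (X + Z) - f X)\<^sup>2) \<partial>lborel)" for X
    proof -
      have i1: "integrable lborel (\<lambda>Z. f (Z + X) * k Z)"
        by (rule integrable_mult_bounded[OF integrable_translate[OF f(2)], where B = B])
          (use k0 kB in auto)
      have i2: "integrable lborel (\<lambda>Z. (f (Z + X) - f X) * k Z)"
        unfolding left_diff_distrib using i1 ki by simp
      have "correlation f k X - f X = (LINT Z|lborel. (f (Z + X) - f X) * k Z)"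
        unfolding left_diff_distrib using i1 ki k1 by (simp add: correlation_shift)
      then have "\<bar>correlation f k X - f X\<bar> \<le> (LINT Z|lborel. \<bar>(f (Z + X) - f X) * k Z\<bar>)"
        using integral_abs_bound by metis
      then have "ennreal \<bar>correlation f k X - f X\<bar> \<le> (\<integral>\<^sup>+Z. ennreal \<bar>(f (Z + X) - f X) * k Z\<bar> \<partial>lborel)"
        using nn_integral_eq_integral[of lborel "\<lambda>Z. \<bar>(f (Z + X) - f X) * k Z\<bar>"] i2 by (simp add: ennreal_leI)
      also have "\<dots> = (\<integral>\<^sup>+Z. ennreal (sqrt (k Z)) * ennreal (sqrt (k Z) * \<bar>f (X + Z) - f X\<bar>) \<partial>lborel)"
        using k0 by (intro nn_integral_cong) (simp add: ennreal_mult[symmetric] abs_mult add.commute mult.commute flip: mult.assoc)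
      finally have "(ennreal \<bar>correlation f k X - f X\<bar>)\<^sup>2 \<le> \<dots>\<^sup>2" by (intro power_mono) auto
      also have "\<dots> \<le> (\<integral>\<^sup>+Z. (ennreal (sqrt (k Z)))\<^sup>2 \<partial>lborel) *
          (\<integral>\<^sup>+Z. (ennreal (sqrt (k Z) * \<bar>f (X + Z) - f X\<bar>))\<^sup>2 \<partial>lborel)"
        by (rule Cauchy_Schwarz_nn_integral) measurable
      also have "(\<integral>\<^sup>+Z. (ennreal (sqrt (k Z)))\<^sup>2 \<partial>lborel) = 1"
        using k0 kn by (simp add: ennreal_power)
      also have "(\<integral>\<^sup>+Z. (ennreal (sqrt (k Z) * \<bar>f (X + Z) - f X\<bar>))\<^sup>2 \<partial>lborel) =
          (\<integral>\<^sup>+Z. ennreal (k Z * (f (X + Z) - f X)\<^sup>2) \<partial>lborel)"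
        using k0 by (intro nn_integral_cong) (simp add: ennreal_power power_mult_distrib)
      finally show ?thesis by (simp add: ennreal_power)
    qed
    have "(\<integral>\<^sup>+X. ennreal ((correlation f k X - f X)\<^sup>2) \<partial>lborel) \<le>
       (\<integral>\<^sup>+X. (\<integral>\<^sup>+Z. ennreal (k Z * (f (X + Z) - f X)\<^sup>2) \<partial>lborel) \<partial>lborel)"
      by (intro nn_integral_mono pw)
    also have "\<dots> = (\<integral>\<^sup>+Z. (\<integral>\<^sup>+X. ennreal (k Z * (f (X + Z) - f X)\<^sup>2) \<partial>lborel) \<partial>lborel)"
      by (rule lborel_pair.Fubini') measurable
    also have "\<dots> \<le> (\<integral>\<^sup>+Z. ennreal (k Z * e) \<partial>lborel)"
    proof (rule nn_integral_mono)
      fix Z :: 'a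
      have s: "sq_integrable (\<lambda>X. f (X + Z) - f X)" by (intro sq_diff sq_translate f)
      have "(\<integral>\<^sup>+X. ennreal (k Z * (f (X + Z) - f X)\<^sup>2) \<partial>lborel) = ennreal (k Z * (LINT X|lborel. (f (X + Z) - f X)\<^sup>2))"
        using sq_integrableD(2)[OF s] k0 by (subst nn_integral_eq_integral) auto
      also have "\<dots> \<le> ennreal (k Z * e)"
      proof (cases "d \<le> norm Z")
        case True then show ?thesis using kd by simp
      next
        case False
        then show ?thesis using d(2)[of Z] k0 by (intro ennreal_leI mult_left_mono) auto
      qed
      finally show "(\<integral>\<^sup>+X. ennreal (k Z * (f (X + Z) - f X)\<^sup>2) \<partial>lborel) \<le> ennreal (k Z * e)" .
    qed
    also have "\<dots> = ennreal e"
      using ki k1 k0 \<open>e > 0\<close> by (subst nn_integral_eq_integral) auto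
    finally have n: "(\<integral>\<^sup>+X. ennreal ((correlation f k X - f X)\<^sup>2) \<partial>lborel) \<le> ennreal e" .
    then have s: "sq_integrable (\<lambda>X. correlation f k X - f X)"
      unfolding sq_integrable_def by (auto simp: integrable_iff_bounded intro: le_less_trans)
    then have "ennreal (LINT X|lborel. (correlation f k X - f X)\<^sup>2) \<le> ennreal e"
      using n by (subst nn_integral_eq_integral[symmetric]) auto
    then show ?thesis using s \<open>e > 0\<close> by (simp add: ennreal_le_iff)
  qed
  then show ?thesis using d(1) by blast
qed

lemma smooth_kernel_exists:
  assumes "d > 0"
  shows "\<exists>k :: 'a::euclidean_space \<Rightarrow> real. kernel d k \<and> test_function UNIV k"
proof -
  define b :: "'a \<Rightarrow> real" where "b x = bump ((1/d) *\<^sub>R x)" for x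
  have Ckb: "Ck j b" for j
    using Ck_affine[OF Ck_bump, of j 0 "1/d"] by (simp add: b_def[abs_def])
  have b0: "b x = 0" if "d \<le> norm x" for x
    using that assms bump_zero[of "(1/d) *\<^sub>R x"] by (simp add: b_def)
  have t: "test_function UNIV b"
    by (rule test_functionI[where K = "cball 0 d"]) (use Ckb b0 in \<open>auto simp: not_le\<close>)
  have i: "integrable lborel b" using test_function_sq(2)[OF t] .
  define I where "I = (LINT x|lborel. b x)"
  have "exp (-2) * measure lborel (ball (0::'a) (d/2)) = (LINT x|lborel. exp (-2) * indicator (ball (0::'a) (d/2)) x)"
    by simp
  also have "\<dots> \<le> I" unfolding I_def
  proof (rule integral_le_of_dominated[OF i])
    show "exp (-2) * indicator (ball (0::'a) (d/2)) x \<le> b x" for x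
      using bump_lower[of "(1/d) *\<^sub>R x"] bump_nonneg assms
      by (auto simp: b_def indicator_def field_simps)
  qed (simp add: b_def bump_nonneg)
  finally have I: "I > 0"
    using content_ball_pos[of "d/2" "0::'a"] assms
    by (smt (verit, best) exp_gt_zero mult_pos_pos half_gt_zero)
  obtain B where B: "\<And>x. \<bar>b x\<bar> \<le> B" using test_function_bounded[OF t] by auto
  define k where "k x = b x * (1 / I)" for x
  have "test_function UNIV k" unfolding k_def[abs_def]
    by (rule test_function_mult[OF t Ck_const])
  moreover have "kernel d k"
    unfolding kernel_def
  proof (intro conjI allI impI exI[of _ "B / I"])
    show "k \<in> borel_measurable borel" by (rule test_function_measurable) fact
    show "0 \<le> k x" for x using I by (simp add: k_def b_def bump_nonneg)
    show "k x \<le> B / I" for x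
      unfolding k_def using I B[of x] by (simp add: divide_right_mono)
    show "k x = 0" if "d \<le> norm x" for x using b0[OF that] by (simp add: k_def)
    show "integrable lborel k" using i by (simp add: k_def[abs_def])
    show "(LINT x|lborel. k x) = 1" using I by (simp add: k_def[abs_def] I_def[symmetric])
  qed
  ultimately show ?thesis by blast
qed

lemma correlation_eq_zero:
  assumes "kernel d k" "\<And>Z. Z \<notin> ball X0 r \<Longrightarrow> f Z = 0" "X \<notin> cball X0 (r + d)"
  shows "correlation f k X = 0"
proof -
  have "f Z * k (Z - X) = 0" for Z
  proof (cases "Z \<in> ball X0 r")
    case True
    have "dist X0 X \<le> dist X0 Z + dist Z X" by (rule dist_triangle)
    then have "d \<le> norm (Z - X)" using True assms(3) by (auto simp: dist_norm)
    then show ?thesis using assms(1) by (simp add: kernel_def)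
  qed (use assms in auto)
  then have "(\<lambda>Z. f Z * k (Z - X)) = (\<lambda>Z. 0)" by (rule ext)
  then show ?thesis by (simp add: correlation_def)
qed

lemma test_functions_dense:
  fixes f :: "'a::euclidean_space \<Rightarrow> real"
  assumes f: "sq_integrable f" "integrable lborel f" "\<And>Z. Z \<notin> ball X0 r \<Longrightarrow> f Z = 0" and "r < R" "e > 0"
  shows "\<exists>\<phi>. test_function (ball X0 R) \<phi> \<and> (LINT X|lborel. (\<phi> X - f X)\<^sup>2) \<le> e"
proof -
  obtain d where d: "d > 0" "\<And>k. kernel d k \<Longrightarrow> (LINT X|lborel. (correlation f k X - f X)\<^sup>2) \<le> e"
    using approximate_identity[OF f(1,2) \<open>e > 0\<close>] by auto
  define d' where "d' = min d ((R - r) / 2)"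
  have d': "d' > 0" "d' \<le> d" "r + d' < R" using d(1) \<open>r < R\<close> by (auto simp: d'_def min_def field_simps)
  obtain k :: "'a \<Rightarrow> real" where k: "kernel d' k" "test_function UNIV k"
    using smooth_kernel_exists[OF d'(1)] by blast
  have "kernel d k" using k(1) d'(2) by (auto simp: kernel_def)
  then have "(LINT X|lborel. (correlation f k X - f X)\<^sup>2) \<le> e" by (rule d(2))
  moreover have "test_function (ball X0 R) (correlation f k)"
  proof (rule test_functionI[where K = "cball X0 (r + d')"])
    show "Ck j (correlation f k)" for j by (rule Ck_correlation[OF f(2) k(2)])
    show "cball X0 (r + d') \<subseteq> ball X0 R" using d'(3) by (auto simp: subset_iff)
    show "correlation f k X = 0" if "X \<notin> cball X0 (r + d')" for X
      by (rule correlation_eq_zero[OF k(1) f(3) that])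
  qed auto
  ultimately show ?thesis by blast
qed

definition l2_norm :: "('a::euclidean_space \<Rightarrow> real) \<Rightarrow> real"
  where "l2_norm f = sqrt (LINT x|lborel. (f x)\<^sup>2)"

lemma l2_nonneg[simp]: "0 \<le> l2_norm f" by (simp add: l2_norm_def)

lemma l2_power2: "(l2_norm f)\<^sup>2 = (LINT x|lborel. (f x)\<^sup>2)" by (simp add: l2_norm_def)

lemma l2_cauchy_schwarz: "sq_integrable f \<Longrightarrow> sq_integrable g \<Longrightarrow> \<bar>LINT x|lborel. f x * g x\<bar> \<le> l2_norm f * l2_norm g"
  unfolding l2_norm_def by (rule cauchy_schwarz_sq_abs)

lemma l2_triangle:
  assumes f: "sq_integrable f" and g: "sq_integrable g"
  shows "l2_norm (\<lambda>x. f x + g x) \<le> l2_norm f + l2_norm g"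
proof (rule power2_le_imp_le)
  have "(l2_norm (\<lambda>x. f x + g x))\<^sup>2 = (LINT x|lborel. (f x)\<^sup>2 + (g x)\<^sup>2 + 2 * (f x * g x))"
    unfolding l2_power2 by (rule Bochner_Integration.integral_cong) (auto simp: power2_sum)
  also have "\<dots> = (l2_norm f)\<^sup>2 + (l2_norm g)\<^sup>2 + 2 * (LINT x|lborel. f x * g x)"
    using sq_integrableD(2)[OF f] sq_integrableD(2)[OF g] sq_mult_integrable[OF f g] by (simp add: l2_power2)
  also have "\<dots> \<le> (l2_norm f)\<^sup>2 + (l2_norm g)\<^sup>2 + 2 * (l2_norm f * l2_norm g)"
    using l2_cauchy_schwarz[OF f g] by linarith
  finally show "(l2_norm (\<lambda>x. f x + g x))\<^sup>2 \<le> (l2_norm f + l2_norm g)\<^sup>2" by (simp add: power2_sum)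
qed simp

lemma le_of_le_add_small:
  fixes a b c :: real
  assumes "\<And>t. t > 0 \<Longrightarrow> a \<le> b + t * c"
  shows "a \<le> b"
proof (rule field_le_epsilon)
  fix e :: real assume "e > 0"
  define t where "t = e / (\<bar>c\<bar> + 1)"
  have t: "t > 0" "t * (\<bar>c\<bar> + 1) = e" using \<open>e > 0\<close> by (auto simp: t_def)
  have "t * c \<le> t * (\<bar>c\<bar> + 1)" using t(1) by (intro mult_left_mono) auto
  then show "a \<le> b + e" using assms[OF t(1)] t(2) by linarith
qed

definition sqnorm :: "'a::euclidean_space set \<Rightarrow> ('a \<Rightarrow> real) \<Rightarrow> real"
  where "sqnorm A f = (LINT x|lborel. indicator A x * (f x)\<^sup>2)"

lemma sqnorm_nonneg[simp]: "0 \<le> sqnorm A f" by (simp add: sqnorm_def)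

lemma indicator_power2: "(indicat_real A x)\<^sup>2 = indicator A x"
  by (simp add: indicator_def)

lemma sqnorm_l2: "sqnorm A f = (l2_norm (\<lambda>x. indicator A x * f x))\<^sup>2"
  unfolding sqnorm_def l2_power2 by (rule Bochner_Integration.integral_cong) (auto simp: indicator_def)

lemma sqnorm_integrable: "sq_integrable f \<Longrightarrow> A \<in> sets borel \<Longrightarrow> integrable lborel (\<lambda>x. indicator A x * (f x)\<^sup>2)"
  using sq_integrableD(2)[OF sq_indicator[of f A]] by (simp add: power_mult_distrib indicator_power2)

lemma sqnorm_mono_set:
  assumes "sq_integrable f" "A \<subseteq> B" "B \<in> sets borel"
  shows "sqnorm A f \<le> sqnorm B f"
  unfolding sqnorm_def
  by (rule integral_le_of_dominated[OF sqnorm_integrable])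
     (use assms in \<open>auto simp: indicator_def\<close>)

lemma sq_bounded_integrable:
  assumes "sq_integrable f" "bounded A" "A \<in> sets borel"
  shows "integrable lborel (\<lambda>x. indicator A x * f x)"
proof -
  have "sq_integrable (indicat_real A)"
    using integrable_indicator_bounded[OF assms(2,3)] assms(3) unfolding sq_integrable_def
    by (simp add: indicator_power2)
  from sq_mult_integrable[OF this assms(1)] show ?thesis .
qed

text \<open>
  Test with approximations of \<open>f\<close> restricted to the smaller ball: in the limit
  \<open>(\<integral> f\<^sup>2)\<^sup>2 \<le> C \<integral> f\<^sup>2\<close>.
\<close>

lemma l2_dual:
  fixes f :: "'a::euclidean_space \<Rightarrow> real"
  assumes f: "sq_integrable f" and "r < R" "0 \<le> C"
    and dual: "\<And>\<phi>. test_function (ball X0 R) \<phi> \<Longrightarrow>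
       (LINT X|lborel. f X * \<phi> X)\<^sup>2 \<le> C * (LINT X|lborel. (\<phi> X)\<^sup>2)"
  shows "sqnorm (ball X0 r) f \<le> C"
proof -
  define g where "g x = indicator (ball X0 r) x * f x" for x
  have g: "sq_integrable g" "integrable lborel g" "\<And>Z. Z \<notin> ball X0 r \<Longrightarrow> g Z = 0"
    using sq_indicator[OF f] sq_bounded_integrable[OF f] by (auto simp: g_def[abs_def])
  have fg: "(l2_norm g)\<^sup>2 = (LINT x|lborel. f x * g x)"
    unfolding l2_power2
    by (rule Bochner_Integration.integral_cong) (auto simp: g_def indicator_def power2_eq_square)
  have "(l2_norm g)\<^sup>2 \<le> sqrt C * l2_norm g + t * (sqrt C + l2_norm f)" if "t > 0" for t
  proof -
    have "t\<^sup>2 > 0" using that by simp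
    then obtain \<phi> where \<phi>: "test_function (ball X0 R) \<phi>" "(LINT X|lborel. (\<phi> X - g X)\<^sup>2) \<le> t\<^sup>2"
      using test_functions_dense[OF g \<open>r < R\<close>] by blast
    have s\<phi>: "sq_integrable \<phi>" using test_function_sq \<phi>(1) by blast
    have sd: "sq_integrable (\<lambda>x. \<phi> x - g x)" by (rule sq_diff[OF s\<phi> g(1)])
    have lt: "l2_norm (\<lambda>x. \<phi> x - g x) \<le> t" using \<phi>(2) that unfolding l2_norm_def by (simp add: real_le_lsqrt)
    have l\<phi>: "l2_norm \<phi> \<le> l2_norm g + t"
      using l2_triangle[OF g(1) sd] lt by simp
    have "\<bar>LINT X|lborel. f X * \<phi> X\<bar> \<le> sqrt C * l2_norm \<phi>"
      using real_sqrt_le_mono[OF dual[OF \<phi>(1)]] by (simp add: real_sqrt_mult l2_norm_def)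
    also have "\<dots> \<le> sqrt C * (l2_norm g + t)" using l\<phi> \<open>0 \<le> C\<close> by (simp add: mult_left_mono)
    finally have 1: "\<bar>LINT X|lborel. f X * \<phi> X\<bar> \<le> sqrt C * (l2_norm g + t)" .
    have "\<bar>LINT X|lborel. f X * (\<phi> X - g X)\<bar> \<le> l2_norm f * l2_norm (\<lambda>x. \<phi> x - g x)"
      by (rule l2_cauchy_schwarz[OF f sd])
    also have "\<dots> \<le> l2_norm f * t" by (simp add: lt mult_left_mono)
    finally have 2: "\<bar>LINT X|lborel. f X * (\<phi> X - g X)\<bar> \<le> l2_norm f * t" .
    have "(LINT X|lborel. f X * (\<phi> X - g X)) = (LINT X|lborel. f X * \<phi> X) - (LINT X|lborel. f X * g X)"
      unfolding right_diff_distrib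
      using sq_mult_integrable[OF f s\<phi>] sq_mult_integrable[OF f g(1)] by simp
    then show ?thesis using 1 2 fg by (simp add: algebra_simps)
  qed
  then have *: "(l2_norm g)\<^sup>2 \<le> sqrt C * l2_norm g" by (rule le_of_le_add_small)
  have "l2_norm g \<le> sqrt C"
  proof (cases "l2_norm g = 0")
    case False
    then have "l2_norm g > 0" using l2_nonneg[of g] by linarith
    then show ?thesis using * by (simp add: power2_eq_square)
  qed (use \<open>0 \<le> C\<close> in simp)
  then have "(l2_norm g)\<^sup>2 \<le> (sqrt C)\<^sup>2" by (intro power_mono) auto
  then show ?thesis using \<open>0 \<le> C\<close> by (simp add: sqnorm_l2 g_def[abs_def])
qed

text \<open>
  Test with approximations of the sign of \<open>f\<close> on the set \<open>P\<close> where \<open>|f| > M + \<delta>\<close>: in the limit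
  \<open>(M + \<delta>) |P| \<le> M |P|\<close>, so \<open>P\<close> is a null set.
\<close>

lemma linf_dual:
  fixes f :: "'a::euclidean_space \<Rightarrow> real"
  assumes f: "sq_integrable f" and "r < R" "0 \<le> M"
    and dual: "\<And>\<phi>. test_function (ball X0 R) \<phi> \<Longrightarrow>
       \<bar>LINT X|lborel. f X * \<phi> X\<bar> \<le> M * (LINT X|lborel. \<bar>\<phi> X\<bar>)"
  shows "AE X in lborel. X \<in> ball X0 r \<longrightarrow> \<bar>f X\<bar> \<le> M"
proof -
  have [measurable]: "f \<in> borel_measurable borel" using f by auto
  have "AE X in lborel. X \<in> ball X0 r \<longrightarrow> \<bar>f X\<bar> \<le> M + \<delta>" if \<delta>: "\<delta> > 0" for \<delta>
  proof -
    define P where "P = {X. X \<in> ball X0 r \<and> M + \<delta> < \<bar>f X\<bar>}"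
    have Pm[measurable]: "P \<in> sets borel" unfolding P_def by measurable
    have Pb: "bounded P" by (rule bounded_subset[of "ball X0 r"]) (auto simp: P_def)
    have Pfin: "emeasure lborel P < \<infinity>" by (rule emeasure_bounded_finite[OF Pb])
    define g where "g x = sgn (f x) * indicat_real P x" for x
    have gm[measurable]: "g \<in> borel_measurable borel" unfolding g_def[abs_def] by measurable
    have iP: "integrable lborel (indicat_real P)" by (rule integrable_indicator_bounded[OF Pb Pm])
    have g1: "\<bar>g x\<bar> = indicat_real P x" "(g x)\<^sup>2 = indicat_real P x" for x
      using \<open>0 \<le> M\<close> \<delta> by (auto simp: g_def P_def indicator_def sgn_if)
    have g: "sq_integrable g" "integrable lborel g" "\<And>Z. Z \<notin> ball X0 r \<Longrightarrow> g Z = 0"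
    proof -
      show "sq_integrable g" using iP by (simp add: sq_integrable_def g1)
      show "integrable lborel g" by (rule integrable_dominated[OF iP]) (auto simp: g1)
      show "\<And>Z. Z \<notin> ball X0 r \<Longrightarrow> g Z = 0" by (auto simp: g_def P_def)
    qed
    have "(M + \<delta>) * measure lborel P = (LINT x|lborel. (M + \<delta>) * indicator P x)" by simp
    also have "\<dots> \<le> (LINT x|lborel. f x * g x)"
    proof (rule integral_le_of_dominated)
      show "integrable lborel (\<lambda>x. f x * g x)" by (rule sq_mult_integrable[OF f g(1)])
      have "f x * g x = \<bar>f x\<bar> * indicator P x" for x by (auto simp: g_def sgn_if)
      then show "0 \<le> f x * g x" "(M + \<delta>) * indicator P x \<le> f x * g x" for x
        by (auto simp: indicator_def P_def)
    qed
    finally have lower: "(M + \<delta>) * measure lborel P \<le> (LINT x|lborel. f x * g x)" .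
    define V where "V = sqrt (measure lborel (ball X0 R))"
    have "(M + \<delta>) * measure lborel P \<le> M * measure lborel P + t * (l2_norm f + M * V)" if t: "t > 0" for t
    proof -
      have "t\<^sup>2 > 0" using that by simp
      then obtain \<phi> where \<phi>: "test_function (ball X0 R) \<phi>" "(LINT X|lborel. (\<phi> X - g X)\<^sup>2) \<le> t\<^sup>2"
        using test_functions_dense[OF g \<open>r < R\<close>] by blast
      have s\<phi>: "sq_integrable \<phi>" "integrable lborel \<phi>" using test_function_sq \<phi>(1) by blast+
      have sd: "sq_integrable (\<lambda>x. \<phi> x - g x)" by (rule sq_diff[OF s\<phi>(1) g(1)])
      have lt: "l2_norm (\<lambda>x. \<phi> x - g x) \<le> t" using \<phi>(2) that unfolding l2_norm_def by (simp add: real_le_lsqrt)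
      have iB: "integrable lborel (indicat_real (ball X0 R))" by (rule integrable_indicator_bounded) auto
      have sB: "sq_integrable (indicat_real (ball X0 R))"
        unfolding sq_integrable_def using iB by (simp add: indicator_power2)
      have lB: "l2_norm (indicat_real (ball X0 R)) = V"
      proof -
        have "(LINT x|lborel. (indicat_real (ball X0 R) x)\<^sup>2) = (LINT x|lborel. indicat_real (ball X0 R) x)"
          by (rule Bochner_Integration.integral_cong) (auto simp: indicator_def)
        then show ?thesis by (simp add: l2_norm_def V_def)
      qed
      have sda: "sq_integrable (\<lambda>x. \<bar>\<phi> x - g x\<bar>)" by (rule sq_dominated[OF sd]) (use sd in auto)
      have "(LINT x|lborel. \<bar>\<phi> x\<bar>) \<le> (LINT x|lborel. \<bar>g x\<bar> + indicator (ball X0 R) x * \<bar>\<phi> x - g x\<bar>)"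
      proof (rule integral_le_of_dominated)
        show "integrable lborel (\<lambda>x. \<bar>g x\<bar> + indicat_real (ball X0 R) x * \<bar>\<phi> x - g x\<bar>)"
          using g(2) sq_mult_integrable[OF sB sda] by simp
        show "\<bar>\<phi> x\<bar> \<le> \<bar>g x\<bar> + indicator (ball X0 R) x * \<bar>\<phi> x - g x\<bar>" for x
          using test_function_zero[OF \<phi>(1), of x] by (cases "x \<in> ball X0 R") auto
      qed simp
      also have "\<dots> = measure lborel P + (LINT x|lborel. indicator (ball X0 R) x * \<bar>\<phi> x - g x\<bar>)"
        using g(2) sq_mult_integrable[OF sB sda] iP by (simp add: g1)
      also have "(LINT x|lborel. indicator (ball X0 R) x * \<bar>\<phi> x - g x\<bar>) \<le> V * l2_norm (\<lambda>x. \<bar>\<phi> x - g x\<bar>)"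
        using l2_cauchy_schwarz[OF sB sda] lB by simp
      also have "V * l2_norm (\<lambda>x. \<bar>\<phi> x - g x\<bar>) \<le> V * t"
        using lt by (intro mult_left_mono) (auto simp: l2_norm_def V_def)
      finally have L1: "(LINT x|lborel. \<bar>\<phi> x\<bar>) \<le> measure lborel P + V * t" by simp
      have "\<bar>LINT X|lborel. f X * \<phi> X\<bar> \<le> M * (measure lborel P + V * t)"
        by (rule order_trans[OF dual[OF \<phi>(1)]]) (use L1 \<open>0 \<le> M\<close> in \<open>simp add: mult_left_mono\<close>)
      moreover have "\<bar>LINT X|lborel. f X * (\<phi> X - g X)\<bar> \<le> l2_norm f * t"
        by (rule order_trans[OF l2_cauchy_schwarz[OF f sd]]) (simp add: lt mult_left_mono)
      moreover have "(LINT X|lborel. f X * (\<phi> X - g X)) = (LINT X|lborel. f X * \<phi> X) - (LINT X|lborel. f X * g X)"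
        unfolding right_diff_distrib
        using sq_mult_integrable[OF f s\<phi>(1)] sq_mult_integrable[OF f g(1)] by simp
      ultimately show ?thesis using lower by (simp add: algebra_simps)
    qed
    then have "(M + \<delta>) * measure lborel P \<le> M * measure lborel P" by (rule le_of_le_add_small)
    then have "measure lborel P = 0" using \<delta> measure_nonneg[of lborel P] by (simp add: distrib_right mult_le_0_iff)
    then have "emeasure lborel P = 0" using Pfin by (simp add: measure_eq_0_null_sets emeasure_eq_ennreal_measure top.not_eq_extremum)
    then have "AE x in lborel. x \<notin> P" by (intro AE_not_in) (auto simp: null_sets_def)
    then show ?thesis by eventually_elim (auto simp: P_def not_less)
  qed
  then have "AE X in lborel. \<forall>n::nat. X \<in> ball X0 r \<longrightarrow> \<bar>f X\<bar> \<le> M + 1 / real (Suc n)"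
    by (subst AE_all_countable) simp
  then show ?thesis
  proof eventually_elim
    case (elim X)
    show ?case
    proof
      assume X: "X \<in> ball X0 r"
      show "\<bar>f X\<bar> \<le> M"
      proof (rule field_le_epsilon)
        fix e :: real assume "e > 0"
        then obtain n where "inverse (real (Suc n)) < e" using reals_Archimedean by blast
        then show "\<bar>f X\<bar> \<le> M + e" using elim X by (smt (verit) inverse_eq_divide)
      qed
    qed
  qed
qed

section \<open>Difference quotients\<close>

definition diff_quot :: "'a::euclidean_space \<Rightarrow> real \<Rightarrow> ('a \<Rightarrow> 'b::real_vector) \<Rightarrow> 'a \<Rightarrow> 'b"
  where "diff_quot e h f X = (1 / h) *\<^sub>R (f (X + h *\<^sub>R e) - f X)"

lemma sq_diff_quot: "sq_integrable f \<Longrightarrow> sq_integrable (diff_quot e h f)"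
  unfolding diff_quot_def[abs_def] real_scaleR_def by (intro sq_cmult sq_diff sq_translate)

lemma integrable_diff_quot: "integrable lborel (f :: 'a::euclidean_space \<Rightarrow> real) \<Longrightarrow> integrable lborel (diff_quot e h f)"
  unfolding diff_quot_def[abs_def] real_scaleR_def using integrable_translate[of f "h *\<^sub>R e"] by simp


text \<open>
  Moving the difference quotient to the test function turns it into a difference quotient of the
  smooth function \<open>correlation f \<phi>\<close>.
\<close>

lemma diff_quot_test:
  assumes f: "integrable lborel f" and t: "test_function E \<phi>"
  shows "(LINT X|lborel. diff_quot e h f X * \<phi> X) = (correlation f \<phi> (h *\<^sub>R e) - correlation f \<phi> 0) / h"
proof -
  have [measurable]: "f \<in> borel_measurable borel" "\<phi> \<in> borel_measurable borel"
    using f test_function_measurable[OF t] by auto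
  have "\<And>a. integrable lborel (\<lambda>X. f (X + a) * \<phi> X)"
    using integrable_mult_test[OF integrable_translate[OF f] t, of _ 0] by simp
  from this[of 0] this[of "h *\<^sub>R e"] show ?thesis
    by (simp add: correlation_shift diff_quot_def[abs_def] left_diff_distrib mult.assoc diff_divide_distrib)
qed

lemma ball_translate_subset:
  assumes "norm a + r \<le> R" shows "(\<lambda>X. X + a) ` ball X0 r \<subseteq> ball X0 R"
proof (clarsimp)
  fix X assume "dist X0 X < r"
  have "dist X0 (X + a) \<le> dist X0 X + dist X (X + a)" by (rule dist_triangle)
  also have "dist X (X + a) = norm a" by (simp add: dist_norm)
  finally show "dist X0 (X + a) < R" using \<open>dist X0 X < r\<close> assms by linarith
qed

lemma test_function_translate_ball:
  assumes "test_function (ball X0 r) \<phi>" "norm a + r \<le> R"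
  shows "test_function (ball X0 R) (\<lambda>X. \<phi> (X - a))"
  using test_function_mono[OF test_function_translate[OF assms(1)] ball_translate_subset[OF assms(2)]] .

text \<open>
  By \<open>l2_dual\<close> it suffices to pair the difference quotient with a test function \<open>\<phi>\<close>. That pairing
  is a difference quotient of \<open>correlation f \<phi>\<close> and so, by the mean value theorem, equals the
  pairing of \<open>f\<close> with the derivative of a translate of \<open>\<phi>\<close>.
\<close>

lemma diff_quot_l2_bound:
  fixes f :: "'a::euclidean_space \<Rightarrow> real"
  assumes f: "sq_integrable f" "integrable lborel f" and e: "norm e = 1" and "0 \<le> C" "h \<noteq> 0" "r + \<bar>h\<bar> < R"
    and dual: "\<And>\<phi>. test_function (ball X0 R) \<phi> \<Longrightarrow>
       (LINT X|lborel. f X * dd \<phi> e X)\<^sup>2 \<le> C * (LINT X|lborel. (\<phi> X)\<^sup>2)"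
  shows "sqnorm (ball X0 r) (diff_quot e h f) \<le> C"
proof (rule l2_dual[where R = "R - \<bar>h\<bar>"])
  fix \<phi> assume t: "test_function (ball X0 (R - \<bar>h\<bar>)) \<phi>"
  have der: "((\<lambda>s. correlation f \<phi> ((s * h) *\<^sub>R e)) has_real_derivative - h * correlation f (dd \<phi> e) ((s * h) *\<^sub>R e)) (at s)" for s
  proof -
    have "((\<lambda>s. (s * h) *\<^sub>R e) has_derivative (\<lambda>u. (u * h) *\<^sub>R e)) (at s)"
      by (auto intro!: derivative_eq_intros)
    from has_derivative_compose[OF this correlation_has_derivative[OF f(2) t]]
    have "((\<lambda>s. correlation f \<phi> ((s * h) *\<^sub>R e)) has_derivative (\<lambda>u. - correlation f (dd \<phi> ((u * h) *\<^sub>R e)) ((s * h) *\<^sub>R e))) (at s)" .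
    moreover have "- correlation f (dd \<phi> ((u * h) *\<^sub>R e)) Y = - h * correlation f (dd \<phi> e) Y * u" for u Y
      using linear_cmul[OF dd_linear[OF t]] by (simp add: correlation_def mult.left_commute mult.assoc)
    ultimately show ?thesis by (simp only: has_field_derivative_def)
  qed
  obtain s where s: "0 < s" "s < 1"
    "correlation f \<phi> ((1 * h) *\<^sub>R e) - correlation f \<phi> ((0 * h) *\<^sub>R e) = (1 - 0) * (- h * correlation f (dd \<phi> e) ((s * h) *\<^sub>R e))"
    using MVT2[of 0 1 "\<lambda>s. correlation f \<phi> ((s * h) *\<^sub>R e)" "\<lambda>s. - h * correlation f (dd \<phi> e) ((s * h) *\<^sub>R e)"] der by auto
  define a where "a = (s * h) *\<^sub>R e"
  have "norm a \<le> \<bar>h\<bar>" using s e mult_left_le_one_le[of "\<bar>h\<bar>" s] by (simp add: a_def abs_mult)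
  then have ta: "test_function (ball X0 R) (\<lambda>X. \<phi> (X - a))"
    by (intro test_function_translate_ball[OF t]) simp
  have "(LINT X|lborel. diff_quot e h f X * \<phi> X) = - correlation f (dd \<phi> e) a"
    using s(3) \<open>h \<noteq> 0\<close> by (simp add: diff_quot_test[OF f(2) t] a_def)
  also have "\<dots> = - (LINT X|lborel. f X * dd (\<lambda>X. \<phi> (X - a)) e X)"
    by (simp add: correlation_def dd_translate[OF t])
  finally have "(LINT X|lborel. diff_quot e h f X * \<phi> X)\<^sup>2 = (LINT X|lborel. f X * dd (\<lambda>X. \<phi> (X - a)) e X)\<^sup>2" by simp
  also have "\<dots> \<le> C * (LINT X|lborel. (\<phi> (X - a))\<^sup>2)" by (rule dual[OF ta])
  also have "(LINT X|lborel. (\<phi> (X - a))\<^sup>2) = (LINT X|lborel. (\<phi> X)\<^sup>2)"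
    using integral_translate[of "\<lambda>X. (\<phi> X)\<^sup>2" "- a"] test_function_measurable[OF t] by simp
  finally show "(LINT X|lborel. diff_quot e h f X * \<phi> X)\<^sup>2 \<le> C * (LINT X|lborel. (\<phi> X)\<^sup>2)" .
qed (use assms sq_diff_quot in auto)

lemma diff_quot_test_tendsto:
  assumes f: "integrable lborel f" and t: "test_function E \<phi>"
  shows "((\<lambda>h. LINT X|lborel. diff_quot e h f X * \<phi> X) \<longlongrightarrow> - (LINT X|lborel. f X * dd \<phi> e X)) (at 0)"
proof -
  have "((\<lambda>h. h *\<^sub>R e) has_derivative (\<lambda>u. u *\<^sub>R e)) (at 0)"
    by (auto intro!: derivative_eq_intros)
  from has_derivative_compose[OF this correlation_has_derivative[OF f t]]
  have "((\<lambda>h. correlation f \<phi> (h *\<^sub>R e)) has_derivative (\<lambda>u. - correlation f (dd \<phi> (u *\<^sub>R e)) 0)) (at 0)" by simp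
  moreover have "- correlation f (dd \<phi> (u *\<^sub>R e)) 0 = - (LINT X|lborel. f X * dd \<phi> e X) * u" for u
    using linear_cmul[OF dd_linear[OF t]] by (simp add: correlation_def mult.left_commute mult.commute)
  ultimately have "((\<lambda>h. correlation f \<phi> (h *\<^sub>R e)) has_real_derivative - (LINT X|lborel. f X * dd \<phi> e X)) (at 0)"
    by (simp only: has_field_derivative_def)
  then show ?thesis by (simp add: has_field_derivative_iff diff_quot_test[OF f t])
qed

text \<open>
  The converse of \<open>diff_quot_l2_bound\<close>, by letting the step tend to \<open>0\<close>.
\<close>

lemma dual_bound_of_diff_quot:
  fixes f :: "'a::euclidean_space \<Rightarrow> real"
  assumes f: "sq_integrable f" "integrable lborel f" and "\<delta> > 0"
    and bound: "\<And>h. 0 < \<bar>h\<bar> \<Longrightarrow> \<bar>h\<bar> < \<delta> \<Longrightarrow> sqnorm (ball X0 r) (diff_quot e h f) \<le> C"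
    and t: "test_function (ball X0 r) \<phi>"
  shows "(LINT X|lborel. f X * dd \<phi> e X)\<^sup>2 \<le> C * (LINT X|lborel. (\<phi> X)\<^sup>2)"
proof -
  have "((\<lambda>h. (LINT X|lborel. diff_quot e h f X * \<phi> X)\<^sup>2) \<longlongrightarrow> (- (LINT X|lborel. f X * dd \<phi> e X))\<^sup>2) (at 0)"
    by (intro tendsto_power diff_quot_test_tendsto[OF f(2) t])
  moreover have "eventually (\<lambda>h. (LINT X|lborel. diff_quot e h f X * \<phi> X)\<^sup>2 \<le> C * (LINT X|lborel. (\<phi> X)\<^sup>2)) (at (0::real))"
    unfolding eventually_at
  proof (intro exI[of _ \<delta>] conjI ballI impI)
    fix h :: real assume "h \<noteq> 0 \<and> dist h 0 < \<delta>"
    then have h: "0 < \<bar>h\<bar>" "\<bar>h\<bar> < \<delta>" by auto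
    have s: "sq_integrable (\<lambda>X. indicator (ball X0 r) X * diff_quot e h f X)" by (intro sq_indicator sq_diff_quot f) auto
    have "(LINT X|lborel. diff_quot e h f X * \<phi> X) = (LINT X|lborel. indicator (ball X0 r) X * diff_quot e h f X * \<phi> X)"
      by (rule Bochner_Integration.integral_cong) (use test_function_zero[OF t] in \<open>auto simp: indicator_def\<close>)
    then have "(LINT X|lborel. diff_quot e h f X * \<phi> X)\<^sup>2 \<le>
       (LINT X|lborel. (indicator (ball X0 r) X * diff_quot e h f X)\<^sup>2) * (LINT X|lborel. (\<phi> X)\<^sup>2)"
      using cauchy_schwarz_sq[OF s test_function_sq(1)[OF t]] by simp
    also have "(LINT X|lborel. (indicator (ball X0 r) X * diff_quot e h f X)\<^sup>2) = sqnorm (ball X0 r) (diff_quot e h f)"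
      by (simp add: sqnorm_def power_mult_distrib indicator_power2)
    also have "\<dots> * (LINT X|lborel. (\<phi> X)\<^sup>2) \<le> C * (LINT X|lborel. (\<phi> X)\<^sup>2)"
      by (intro mult_right_mono bound h) auto
    finally show "(LINT X|lborel. diff_quot e h f X * \<phi> X)\<^sup>2 \<le> C * (LINT X|lborel. (\<phi> X)\<^sup>2)" .
  qed fact
  ultimately have "(- (LINT X|lborel. f X * dd \<phi> e X))\<^sup>2 \<le> C * (LINT X|lborel. (\<phi> X)\<^sup>2)"
    by (rule tendsto_upperbound) simp
  then show ?thesis by simp
qed

text \<open>
  The same limit for bounds in the supremum norm.
\<close>

lemma dual_linf_bound_of_diff_quot:
  fixes f :: "'a::euclidean_space \<Rightarrow> real"
  assumes f: "sq_integrable f" "integrable lborel f" and "\<delta> > 0"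
    and bound: "\<And>h. 0 < \<bar>h\<bar> \<Longrightarrow> \<bar>h\<bar> < \<delta> \<Longrightarrow> AE X in lborel. X \<in> ball X0 r \<longrightarrow> \<bar>diff_quot e h f X\<bar> \<le> M"
    and t: "test_function (ball X0 r) \<phi>"
  shows "\<bar>LINT X|lborel. f X * dd \<phi> e X\<bar> \<le> M * (LINT X|lborel. \<bar>\<phi> X\<bar>)"
proof -
  have "((\<lambda>h. \<bar>LINT X|lborel. diff_quot e h f X * \<phi> X\<bar>) \<longlongrightarrow> \<bar>- (LINT X|lborel. f X * dd \<phi> e X)\<bar>) (at 0)"
    by (intro tendsto_rabs diff_quot_test_tendsto[OF f(2) t])
  moreover have "eventually (\<lambda>h. \<bar>LINT X|lborel. diff_quot e h f X * \<phi> X\<bar> \<le> M * (LINT X|lborel. \<bar>\<phi> X\<bar>)) (at (0::real))"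
    unfolding eventually_at
  proof (intro exI[of _ \<delta>] conjI ballI impI)
    fix h :: real assume "h \<noteq> 0 \<and> dist h 0 < \<delta>"
    then have h: "0 < \<bar>h\<bar>" "\<bar>h\<bar> < \<delta>" by auto
    have s: "sq_integrable \<phi>" "integrable lborel \<phi>" using test_function_sq[OF t] .
    have i: "integrable lborel (\<lambda>X. diff_quot e h f X * \<phi> X)" by (rule sq_mult_integrable[OF sq_diff_quot[OF f(1)] s(1)])
    have "\<bar>LINT X|lborel. diff_quot e h f X * \<phi> X\<bar> \<le> (LINT X|lborel. \<bar>diff_quot e h f X * \<phi> X\<bar>)" by (rule integral_abs_bound)
    also have "\<dots> \<le> (LINT X|lborel. M * \<bar>\<phi> X\<bar>)"
    proof (rule integral_mono_AE)
      show "AE X in lborel. \<bar>diff_quot e h f X * \<phi> X\<bar> \<le> M * \<bar>\<phi> X\<bar>"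
        using bound[OF h]
      proof eventually_elim
        case (elim X)
        then show ?case using test_function_zero[OF t, of X]
          by (cases "X \<in> ball X0 r") (auto simp: abs_mult mult_right_mono)
      qed
    qed (use s i in auto)
    finally show "\<bar>LINT X|lborel. diff_quot e h f X * \<phi> X\<bar> \<le> M * (LINT X|lborel. \<bar>\<phi> X\<bar>)" by simp
  qed fact
  ultimately have "\<bar>- (LINT X|lborel. f X * dd \<phi> e X)\<bar> \<le> M * (LINT X|lborel. \<bar>\<phi> X\<bar>)"
    by (rule tendsto_upperbound) simp
  then show ?thesis by simp
qed

section \<open>A discrete Sobolev inequality\<close>

text \<open>
  The list gives directions together with their steps; its last entry is applied last.
\<close>

primrec diff_quots :: "('a::euclidean_space \<times> real) list \<Rightarrow> ('a \<Rightarrow> 'b::real_vector) \<Rightarrow> 'a \<Rightarrow> 'b"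
  where
    "diff_quots [] f = f"
  | "diff_quots (p # ps) f = diff_quots ps (diff_quot (fst p) (snd p) f)"

lemma diff_quots_append: "diff_quots (ps @ qs) f = diff_quots qs (diff_quots ps f)"
  by (induction ps arbitrary: f) auto

lemma sq_diff_quots: "sq_integrable f \<Longrightarrow> sq_integrable (diff_quots ps f)"
  by (induction ps arbitrary: f) (auto simp: sq_diff_quot)

text \<open>
  A set \<open>P\<close> in a slab of thickness \<open>h\<close> has disjoint translates by multiples of \<open>h b\<close>, and \<open>P'\<close> is
  the union of the first \<open>N\<close>. The integral of \<open>|w|\<close> over \<open>P\<close> differs from that over the \<open>k\<close>-th
  translate by at most the sum of the increments in between; then average over \<open>k\<close>.
\<close>

lemma set_integral_telescope:
  fixes w :: "'a::euclidean_space \<Rightarrow> real"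
  assumes w: "integrable lborel w" and P[measurable]: "P \<in> sets borel" and "h > 0" "N > 0"
    and slab: "\<And>X. X \<in> P \<Longrightarrow> \<alpha> \<le> X \<bullet> b \<and> X \<bullet> b < \<alpha> + h" and b: "norm b = 1"
  defines "P' \<equiv> {X. \<exists>k<N. X - (real k * h) *\<^sub>R b \<in> P}"
  shows "P' \<in> sets borel"
    "real N * (LINT X|lborel. indicator P X * \<bar>w X\<bar>) \<le>
       (LINT X|lborel. indicator P' X * \<bar>w X\<bar>) +
       real N * h * (LINT X|lborel. indicator P' X * \<bar>diff_quot b h w X\<bar>)"
proof -
  have [measurable]: "w \<in> borel_measurable borel" using w by auto
  have bb: "b \<bullet> b = 1" using b by (simp add: norm_eq_1)
  have "P' = (\<Union>k<N. (\<lambda>X. X - (real k * h) *\<^sub>R b) -` P)" by (auto simp: P'_def)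
  moreover have "(\<lambda>X. X - (real k * h) *\<^sub>R b) -` P \<in> sets borel" for k
    using measurable_sets[of "\<lambda>X. X - (real k * h) *\<^sub>R b" borel borel P] by simp
  ultimately show P'[measurable]: "P' \<in> sets borel" by auto
  have iset: "integrable lborel (\<lambda>X. indicator A X * \<bar>u X\<bar>)" if "integrable lborel u" "A \<in> sets borel" for u :: "'a \<Rightarrow> real" and A
    by (rule integrable_dominated[where g = "\<lambda>X. \<bar>u X\<bar>"]) (use that in \<open>auto simp: indicator_def\<close>)
  \<comment> \<open>the translates are disjoint because P lies in a slab of thickness h\<close>
  have ind: "(\<Sum>k<N. indicator P (X - (real k * h) *\<^sub>R b)) = indicat_real P' X" for X
  proof (cases "X \<in> P'")
    case True
    then obtain k where k: "k < N" "X - (real k * h) *\<^sub>R b \<in> P" by (auto simp: P'_def)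
    have uniq: "l = k" if "X - (real l * h) *\<^sub>R b \<in> P" for l
    proof -
      have "\<bar>real l * h - real k * h\<bar> < h"
        using slab[OF that] slab[OF k(2)] bb by (simp add: inner_diff_left abs_less_iff)
      then have "\<bar>real l - real k\<bar> * h < 1 * h" using \<open>h > 0\<close> by (simp add: left_diff_distrib[symmetric] abs_mult)
      then have "\<bar>real l - real k\<bar> < 1" using \<open>h > 0\<close> by (simp add: mult_less_cancel_right_pos)
      then show ?thesis by linarith
    qed
    have "indicat_real P (X - (real l * h) *\<^sub>R b) = (if l = k then 1 else 0)" for l
    proof (cases "X - (real l * h) *\<^sub>R b \<in> P")
      case True
      then show ?thesis using uniq[OF True] by simp
    next
      case False
      then have "l \<noteq> k" using k(2) by blast
      then show ?thesis using False by simp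
    qed
    then have "(\<Sum>l<N. indicat_real P (X - (real l * h) *\<^sub>R b)) = (\<Sum>l<N. if l = k then 1 else 0)"
      by simp
    then show ?thesis using True k by simp
  next
    case False
    then show ?thesis by (auto simp: P'_def indicator_def intro!: sum.neutral)
  qed
  have collect: "(\<Sum>k<N. LINT X|lborel. indicator P X * \<bar>u (X + (real k * h) *\<^sub>R b)\<bar>) =
     (LINT X|lborel. indicator P' X * \<bar>u X\<bar>)" if u: "integrable lborel u" for u :: "'a \<Rightarrow> real"
  proof -
    have [measurable]: "u \<in> borel_measurable borel" using u by auto
    have "(LINT X|lborel. indicator P X * \<bar>u (X + (real k * h) *\<^sub>R b)\<bar>) =
       (LINT X|lborel. indicator P (X - (real k * h) *\<^sub>R b) * \<bar>u X\<bar>)" for k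
      using integral_translate[of "\<lambda>X. indicator P (X - (real k * h) *\<^sub>R b) * \<bar>u X\<bar>" "(real k * h) *\<^sub>R b"]
      by simp
    then have "(\<Sum>k<N. LINT X|lborel. indicator P X * \<bar>u (X + (real k * h) *\<^sub>R b)\<bar>) =
      (\<Sum>k<N. LINT X|lborel. indicator P (X - (real k * h) *\<^sub>R b) * \<bar>u X\<bar>)" by simp
    also have "\<dots> = (LINT X|lborel. (\<Sum>k<N. indicator P (X - (real k * h) *\<^sub>R b) * \<bar>u X\<bar>))"
    proof (rule Bochner_Integration.integral_sum[symmetric])
      show "integrable lborel (\<lambda>X. indicator P (X - (real k * h) *\<^sub>R b) * \<bar>u X\<bar>)" for k
        by (rule integrable_dominated[where g = "\<lambda>X. \<bar>u X\<bar>"]) (use u in \<open>auto simp: indicator_def\<close>)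
    qed
    also have "\<dots> = (LINT X|lborel. indicator P' X * \<bar>u X\<bar>)"
      by (simp add: sum_distrib_right[symmetric] ind)
    finally show ?thesis .
  qed
  define a where "a k = (LINT X|lborel. indicator P X * \<bar>w (X + (real k * h) *\<^sub>R b)\<bar>)" for k :: nat
  define c where "c k = (LINT X|lborel. indicator P X * \<bar>diff_quot b h w (X + (real k * h) *\<^sub>R b)\<bar>)" for k :: nat
  have c0: "0 \<le> c k" for k by (auto simp: c_def)
  have step: "a k \<le> a (Suc k) + h * c k" for k
  proof -
    have eq: "h * diff_quot b h w (X + (real k * h) *\<^sub>R b) = w (X + (real (Suc k) * h) *\<^sub>R b) - w (X + (real k * h) *\<^sub>R b)" for X
      using \<open>h > 0\<close> by (simp add: diff_quot_def algebra_simps)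
    have i1: "integrable lborel (\<lambda>X. indicator P X * \<bar>w (X + (real (Suc k) * h) *\<^sub>R b)\<bar>)"
      by (rule iset[OF integrable_translate[OF w] P])
    have i2: "integrable lborel (\<lambda>X. indicator P X * \<bar>diff_quot b h w (X + (real k * h) *\<^sub>R b)\<bar>)"
      by (rule iset[OF integrable_translate[OF integrable_diff_quot[OF w]] P])
    have "a k \<le> (LINT X|lborel. indicator P X * \<bar>w (X + (real (Suc k) * h) *\<^sub>R b)\<bar> +
       h * (indicator P X * \<bar>diff_quot b h w (X + (real k * h) *\<^sub>R b)\<bar>))"
      unfolding a_def
    proof (rule integral_le_of_dominated)
      show "indicator P X * \<bar>w (X + (real k * h) *\<^sub>R b)\<bar> \<le> indicator P X * \<bar>w (X + (real (Suc k) * h) *\<^sub>R b)\<bar> +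
       h * (indicator P X * \<bar>diff_quot b h w (X + (real k * h) *\<^sub>R b)\<bar>)" for X
      proof (cases "X \<in> P")
        case True
        have "\<bar>w (X + (real k * h) *\<^sub>R b)\<bar> \<le> \<bar>w (X + (real (Suc k) * h) *\<^sub>R b)\<bar> + \<bar>h * diff_quot b h w (X + (real k * h) *\<^sub>R b)\<bar>"
          unfolding eq by linarith
        then show ?thesis using True \<open>h > 0\<close> by (simp add: abs_mult)
      qed simp
    qed (use i1 i2 \<open>h > 0\<close> in auto)
    also have "\<dots> = a (Suc k) + h * c k" using i1 i2 by (simp add: a_def c_def)
    finally show ?thesis .
  qed
  have "a 0 \<le> a k + h * (\<Sum>l<k. c l)" for k
  proof (induction k)
    case (Suc k)
    have "h * (\<Sum>l<Suc k. c l) = h * (\<Sum>l<k. c l) + h * c k" by (simp add: distrib_left)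
    then show ?case using Suc step[of k] by linarith
  qed simp
  then have "a 0 \<le> a k + h * (\<Sum>l<N. c l)" if "k < N" for k
    using that c0 \<open>h > 0\<close> sum_mono2[of "{..<N}" "{..<k}" c]
    by (smt (verit) finite_lessThan lessThan_subset_iff mult_left_mono nat_less_le)
  then have "(\<Sum>k<N. a 0) \<le> (\<Sum>k<N. a k + h * (\<Sum>l<N. c l))" by (intro sum_mono) auto
  then have "real N * a 0 \<le> (\<Sum>k<N. a k) + real N * h * (\<Sum>l<N. c l)" by (simp add: sum.distrib mult.assoc)
  also have "(\<Sum>k<N. a k) = (LINT X|lborel. indicator P' X * \<bar>w X\<bar>)"
    unfolding a_def by (rule collect[OF w])
  also have "(\<Sum>k<N. c k) = (LINT X|lborel. indicator P' X * \<bar>diff_quot b h w X\<bar>)"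
    unfolding c_def by (rule collect[OF integrable_diff_quot[OF w]])
  finally show "real N * (LINT X|lborel. indicator P X * \<bar>w X\<bar>) \<le>
       (LINT X|lborel. indicator P' X * \<bar>w X\<bar>) +
       real N * h * (LINT X|lborel. indicator P' X * \<bar>diff_quot b h w X\<bar>)" by (simp add: a_def)
qed

text \<open>
  Apply \<open>set_integral_telescope\<close> in each direction in turn. Every step replaces \<open>w\<close> by \<open>w\<close> or by
  \<open>N h\<close> times its difference quotient, whence the factor \<open>2\<close> and the sublists of \<open>bs\<close>. For a full
  basis and \<open>N h = l\<close> the bound is \<open>(2 / l) ^ d M\<close> times the volume \<open>h ^ d\<close> of a cell.
\<close>

lemma cell_estimate:
  fixes w :: "'a::euclidean_space \<Rightarrow> real"
  assumes "h > 0" "N > 0" "distinct bs" "set bs \<subseteq> Basis"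
    and "integrable lborel w" "P \<in> sets borel"
    and "\<And>b. b \<in> set bs \<Longrightarrow> \<exists>\<alpha>. \<forall>X\<in>P. \<alpha> \<le> X \<bullet> b \<and> X \<bullet> b < \<alpha> + h"
    and "P \<subseteq> ball X0 r" "r + real (length bs) * (real N * h) \<le> R"
    and "\<And>S. S \<in> set (subseqs bs) \<Longrightarrow>
       (real N * h) ^ length S * (LINT X|lborel. indicator (ball X0 R) X * \<bar>diff_quots (map (\<lambda>b. (b, h)) S) w X\<bar>) \<le> M"
  shows "(LINT X|lborel. indicator P X * \<bar>w X\<bar>) \<le> (2 / real N) ^ length bs * M"
  using assms(3-)
proof (induction bs arbitrary: w P r)
  case Nil
  have "(LINT X|lborel. indicator P X * \<bar>w X\<bar>) \<le> (LINT X|lborel. indicator (ball X0 R) X * \<bar>w X\<bar>)"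
  proof (rule integral_le_of_dominated)
    show "integrable lborel (\<lambda>X. indicator (ball X0 R) X * \<bar>w X\<bar>)"
      by (rule integrable_dominated[where g = "\<lambda>X. \<bar>w X\<bar>"]) (use Nil in \<open>auto simp: indicator_def\<close>)
    have "P \<subseteq> ball X0 R" using Nil.prems(6,7) by auto
    then show "indicator P X * \<bar>w X\<bar> \<le> indicator (ball X0 R) X * \<bar>w X\<bar>" for X by (auto simp: indicator_def)
  qed auto
  also have "\<dots> \<le> M" using Nil.prems(8)[of "[]"] by simp
  finally show ?case by simp
next
  case (Cons b bs)
  have b: "b \<in> Basis" "norm b = 1" "b \<notin> set bs" using Cons.prems by auto
  obtain \<alpha> where \<alpha>: "\<And>X. X \<in> P \<Longrightarrow> \<alpha> \<le> X \<bullet> b \<and> X \<bullet> b < \<alpha> + h" using Cons.prems(5)[of b] by auto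
  define P' where "P' = {X. \<exists>k<N. X - (real k * h) *\<^sub>R b \<in> P}"
  note tele = set_integral_telescope[OF Cons.prems(3,4) \<open>h > 0\<close> \<open>N > 0\<close> \<alpha> b(2), folded P'_def]
  have slab': "\<exists>\<alpha>. \<forall>X\<in>P'. \<alpha> \<le> X \<bullet> b' \<and> X \<bullet> b' < \<alpha> + h" if b': "b' \<in> set bs" for b'
  proof -
    have "b \<bullet> b' = 0" using b b' Cons.prems(2) by (metis inner_not_same_Basis list.set_intros(2) subsetD)
    moreover obtain \<beta> where "\<And>X. X \<in> P \<Longrightarrow> \<beta> \<le> X \<bullet> b' \<and> X \<bullet> b' < \<beta> + h" using Cons.prems(5)[of b'] b' by auto
    ultimately show ?thesis unfolding P'_def by (intro exI[of _ \<beta>]) (force simp: inner_diff_left)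
  qed
  have sub': "P' \<subseteq> ball X0 (r + real N * h)"
  proof
    fix X assume "X \<in> P'"
    then obtain k where k: "k < N" "X - (real k * h) *\<^sub>R b \<in> P" by (auto simp: P'_def)
    have "dist X0 X \<le> dist X0 (X - (real k * h) *\<^sub>R b) + dist (X - (real k * h) *\<^sub>R b) X" by (rule dist_triangle)
    moreover have "dist (X - (real k * h) *\<^sub>R b) X = real k * h" using b \<open>h > 0\<close> by (simp add: dist_norm)
    moreover have "real k * h \<le> real N * h" using k \<open>h > 0\<close> by simp
    ultimately show "X \<in> ball X0 (r + real N * h)" using k(2) Cons.prems(6) by force
  qed
  have len: "(r + real N * h) + real (length bs) * (real N * h) \<le> R"
    using Cons.prems(7) by (simp add: algebra_simps)
  have ih1: "(LINT X|lborel. indicator P' X * \<bar>w X\<bar>) \<le> (2 / real N) ^ length bs * M"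
    by (rule Cons.IH[OF _ _ _ tele(1) slab' sub' len])
       (use Cons.prems in \<open>auto simp: Let_def\<close>)
  have ih2: "(LINT X|lborel. indicator P' X * \<bar>(real N * h) * diff_quot b h w X\<bar>) \<le> (2 / real N) ^ length bs * M"
  proof (rule Cons.IH[OF _ _ _ tele(1) slab' sub' len])
    show "integrable lborel (\<lambda>X. real N * h * diff_quot b h w X)" using integrable_diff_quot[OF Cons.prems(3)] by simp
    fix S assume S: "S \<in> set (subseqs bs)"
    have lin: "diff_quots ps (\<lambda>X. c * f X) = (\<lambda>X. c * diff_quots ps f X)" for ps c and f :: "'a \<Rightarrow> real"
    proof (induction ps arbitrary: f)
      case (Cons p ps)
      have "diff_quot (fst p) (snd p) (\<lambda>X. c * f X) = (\<lambda>X. c * diff_quot (fst p) (snd p) f X)"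
        by (rule ext) (simp add: diff_quot_def algebra_simps diff_divide_distrib)
      then show ?case using Cons by simp
    qed simp
    have N: "0 \<le> real N * h" using \<open>h > 0\<close> by simp
    have "(real N * h) ^ length S * (LINT X|lborel. indicator (ball X0 R) X *
         \<bar>diff_quots (map (\<lambda>b. (b, h)) S) (\<lambda>X. (real N * h) * diff_quot b h w X) X\<bar>) =
       (real N * h) ^ length (b # S) * (LINT X|lborel. indicator (ball X0 R) X * \<bar>diff_quots (map (\<lambda>b. (b, h)) (b # S)) w X\<bar>)"
      unfolding lin abs_mult abs_of_nonneg[OF N] using \<open>h > 0\<close> by (simp add: mult.left_commute mult.assoc)
    also have "\<dots> \<le> M" using S by (intro Cons.prems(8)) (auto simp: Let_def)
    finally show "(real N * h) ^ length S * (LINT X|lborel. indicator (ball X0 R) X *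
         \<bar>diff_quots (map (\<lambda>b. (b, h)) S) (\<lambda>X. (real N * h) * diff_quot b h w X) X\<bar>) \<le> M" .
  qed (use Cons.prems in auto)
  have "(LINT X|lborel. indicator P' X * \<bar>(real N * h) * diff_quot b h w X\<bar>) =
      real N * h * (LINT X|lborel. indicator P' X * \<bar>diff_quot b h w X\<bar>)"
    using \<open>h > 0\<close> by (simp add: abs_mult mult.left_commute mult.assoc)
  then have "real N * (LINT X|lborel. indicator P X * \<bar>w X\<bar>) \<le> 2 * ((2 / real N) ^ length bs * M)"
    using tele(2) ih1 ih2 by linarith
  then show ?case using \<open>N > 0\<close> by (simp add: field_simps)
qed

lemma cell_kernel:
  fixes h :: real
  assumes "h > 0" "real DIM('a) * h \<le> d"
  defines "Q \<equiv> {Z :: 'a::euclidean_space. \<forall>b\<in>Basis. 0 \<le> Z \<bullet> b \<and> Z \<bullet> b < h}"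
  shows "kernel d (\<lambda>Z. indicator Q Z / h ^ DIM('a))"
proof -
  have [measurable]: "Q \<in> sets borel" unfolding Q_def by measurable
  let ?c = "h *\<^sub>R (\<Sum>b\<in>Basis. b) :: 'a"
  have c: "?c \<bullet> b = h" if "b \<in> Basis" for b
    using that by (simp add: inner_sum_left inner_Basis if_distrib sum.delta' cong: if_cong)
  have sub1: "box 0 ?c \<subseteq> Q" by (auto simp: Q_def box_def c less_imp_le)
  have sub2: "Q \<subseteq> cbox 0 ?c" by (auto simp: Q_def cbox_def c less_imp_le)
  have fin: "emeasure lborel Q < \<infinity>" by (rule emeasure_bounded_finite[OF bounded_subset[OF bounded_cbox sub2]])
  have mc: "measure lborel (cbox 0 ?c) = h ^ DIM('a)"
    using \<open>h > 0\<close> by (simp add: content_cbox c)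
  have mb: "measure lborel (box 0 ?c) = h ^ DIM('a)"
    using \<open>h > 0\<close> by (simp add: measure_lborel_box_eq c)
  have "measure lborel (box 0 ?c) \<le> measure lborel Q"
    using sub1 fin by (intro measure_mono_fmeasurable) (auto simp: fmeasurable_def)
  moreover have "measure lborel Q \<le> measure lborel (cbox 0 ?c)"
    using sub2 by (intro measure_mono_fmeasurable) auto
  ultimately have mQ: "measure lborel Q = h ^ DIM('a)" using mc mb by linarith
  have small: "norm Z < real DIM('a) * h" if "Z \<in> Q" for Z
  proof -
    have "norm Z \<le> (\<Sum>b\<in>Basis. \<bar>Z \<bullet> b\<bar>)" by (rule norm_le_l1)
    also have "\<dots> < (\<Sum>b\<in>(Basis::'a set). h)"
      by (rule sum_strict_mono) (use that in \<open>auto simp: Q_def\<close>)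
    finally show ?thesis by simp
  qed
  have iQ: "integrable lborel (indicat_real Q)" using fin by (simp add: integrable_indicator_iff)
  show ?thesis unfolding kernel_def
  proof (intro conjI allI impI exI[of _ "1 / h ^ DIM('a)"])
    show "indicat_real Q x / h ^ DIM('a) = 0" if "d \<le> norm x" for x
      using small[of x] that assms(2) by (auto simp: indicator_def)
    show "indicat_real Q x / h ^ DIM('a) \<le> 1 / h ^ DIM('a)" for x
      using \<open>h > 0\<close> by (auto simp: indicator_def)
  qed (use iQ mQ \<open>h > 0\<close> in auto)
qed

text \<open>
  By \<open>cell_estimate\<close> the averages of \<open>|w|\<close> over all cells of mesh \<open>h = l / N\<close> are bounded by the
  same number. These averages are correlations with a kernel and converge to \<open>|w|\<close> in \<open>L\<^sup>2\<close> as
  the mesh shrinks, so the bound passes to \<open>|w|\<close>.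
\<close>

lemma discrete_sobolev:
  fixes w :: "'a::euclidean_space \<Rightarrow> real"
  assumes w: "sq_integrable w" "integrable lborel w" and bs: "distinct bs" "set bs = Basis"
    and l: "l > 0" "r + 2 * real DIM('a) * l \<le> R" and "h0 > 0"
    and bound: "\<And>h S. 0 < h \<Longrightarrow> h < h0 \<Longrightarrow> S \<in> set (subseqs bs) \<Longrightarrow>
       l ^ (2 * length S) * sqnorm (ball X0 R) (diff_quots (map (\<lambda>b. (b, h)) S) w) \<le> K"
  shows "AE X in lborel. X \<in> ball X0 r \<longrightarrow>
     (w X)\<^sup>2 \<le> (4 / l\<^sup>2) ^ DIM('a) * (measure lborel (ball X0 R) * K)"
proof -
  let ?d = "DIM('a)"
  define V where "V = measure lborel (ball X0 R)"
  define M where "M = sqrt (V * K)"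
  define M' where "M' = (2 / l) ^ ?d * M"
  have len: "length bs = ?d" using distinct_card[OF bs(1)] bs(2) by simp
  have K: "0 \<le> K"
  proof -
    have "[] \<in> set (subseqs bs)" by (induction bs) (auto simp: Let_def)
    then have "sqnorm (ball X0 R) w \<le> K" using bound[of "h0/2" "[]"] \<open>h0 > 0\<close> by simp
    then show ?thesis using sqnorm_nonneg order_trans by blast
  qed
  have V: "0 \<le> V" by (simp add: V_def)
  have M: "0 \<le> M" "0 \<le> M'" using K V l by (auto simp: M_def M'_def)
  have [measurable]: "w \<in> borel_measurable borel" using w by auto
  have aw: "sq_integrable (\<lambda>x. \<bar>w x\<bar>)" "integrable lborel (\<lambda>x. \<bar>w x\<bar>)"
    using w by (auto intro: sq_dominated)
  have L1: "(LINT X|lborel. indicator (ball X0 R) X * \<bar>u X\<bar>) \<le> sqrt V * sqrt (sqnorm (ball X0 R) u)" if u: "sq_integrable u" for u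
  proof -
    have [measurable]: "u \<in> borel_measurable borel" using u by auto
    have iB: "integrable lborel (indicat_real (ball X0 R))" by (rule integrable_indicator_bounded) auto
    have sB: "sq_integrable (indicat_real (ball X0 R))" unfolding sq_integrable_def using iB by (simp add: indicator_power2)
    have su: "sq_integrable (\<lambda>X. indicator (ball X0 R) X * \<bar>u X\<bar>)" by (rule sq_dominated[OF u]) (auto simp: indicator_def)
    have "(LINT X|lborel. indicator (ball X0 R) X * \<bar>u X\<bar>) =
       (LINT X|lborel. indicator (ball X0 R) X * (indicator (ball X0 R) X * \<bar>u X\<bar>))"
      by (rule Bochner_Integration.integral_cong) (auto simp: indicator_def)
    also have "\<dots> \<le> sqrt (LINT X|lborel. (indicat_real (ball X0 R) X)\<^sup>2) *
        sqrt (LINT X|lborel. (indicator (ball X0 R) X * \<bar>u X\<bar>)\<^sup>2)"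
      using cauchy_schwarz_sq_abs[OF sB su] by linarith
    finally show ?thesis by (simp add: indicator_power2 V_def sqnorm_def power_mult_distrib)
  qed
  \<comment> \<open>averages of \<open>|w|\<close> over the cells with lower corner X\<close>
  have avg: "correlation (\<lambda>x. \<bar>w x\<bar>) (\<lambda>Z. indicator {Z. \<forall>b\<in>Basis. 0 \<le> Z \<bullet> b \<and> Z \<bullet> b < h} Z / h ^ ?d) X \<le> M'"
    if X: "X \<in> ball X0 r" and N: "N > 0" and h: "h = l / real N" "h < h0" for X N h
  proof -
    define P where "P = {Z. \<forall>b\<in>Basis. 0 \<le> (Z - X) \<bullet> b \<and> (Z - X) \<bullet> b < h}"
    have h0: "h > 0" "real N * h = l" using N h l by auto
    have [measurable]: "P \<in> sets borel" unfolding P_def by measurable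
    have hl: "h \<le> l" using mult_right_mono[of 1 "real N" h] N h0 by simp
    have cell: "(LINT Z|lborel. indicator P Z * \<bar>w Z\<bar>) \<le> (2 / real N) ^ ?d * M"
      unfolding len[symmetric]
    proof (rule cell_estimate[OF h0(1) N bs(1) _ w(2)])
      show "\<exists>\<alpha>. \<forall>Z\<in>P. \<alpha> \<le> Z \<bullet> b \<and> Z \<bullet> b < \<alpha> + h" if "b \<in> set bs" for b
        using that bs(2) by (intro exI[of _ "X \<bullet> b"]) (auto simp: P_def inner_diff_left)
      show "P \<subseteq> ball X0 (r + real ?d * l)"
      proof
        fix Z assume Z: "Z \<in> P"
        have "norm (Z - X) \<le> (\<Sum>b\<in>Basis. \<bar>(Z - X) \<bullet> b\<bar>)" by (rule norm_le_l1)
        also have "\<dots> \<le> (\<Sum>b\<in>(Basis::'a set). l)"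
          by (rule sum_mono) (use Z hl in \<open>auto simp: P_def\<close>)
        finally have "dist X Z \<le> real ?d * l" by (simp add: dist_norm norm_minus_commute)
        then show "Z \<in> ball X0 (r + real ?d * l)"
          using X dist_triangle[of X0 Z X] by simp
      qed
      show "r + real ?d * l + real (length bs) * (real N * h) \<le> R"
        unfolding h0(2) using l(2) by (simp add: len algebra_simps)
      fix S assume S: "S \<in> set (subseqs bs)"
      let ?u = "diff_quots (map (\<lambda>b. (b, h)) S) w"
      have "sqrt ((l ^ length S)\<^sup>2 * sqnorm (ball X0 R) ?u) \<le> sqrt K"
        using bound[OF h0(1) h(2) S] by (simp add: power_mult[symmetric] mult.commute)
      then have "l ^ length S * sqrt (sqnorm (ball X0 R) ?u) \<le> sqrt K"
        using l by (simp add: real_sqrt_mult)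
      then have "sqrt V * (l ^ length S * sqrt (sqnorm (ball X0 R) ?u)) \<le> sqrt V * sqrt K"
        using V by (intro mult_left_mono) auto
      moreover have "l ^ length S * (LINT X|lborel. indicator (ball X0 R) X * \<bar>?u X\<bar>) \<le>
          l ^ length S * (sqrt V * sqrt (sqnorm (ball X0 R) ?u))"
        using l by (intro mult_left_mono L1 sq_diff_quots w) auto
      ultimately show "(real N * h) ^ length S * (LINT X|lborel. indicator (ball X0 R) X * \<bar>?u X\<bar>) \<le> M"
        by (simp add: h0(2) M_def real_sqrt_mult mult.left_commute)
    qed (use bs in auto)
    have eq: "correlation (\<lambda>x. \<bar>w x\<bar>) (\<lambda>Z. indicator {Z. \<forall>b\<in>Basis. 0 \<le> Z \<bullet> b \<and> Z \<bullet> b < h} Z / h ^ ?d) X =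
        (LINT Z|lborel. indicator P Z * \<bar>w Z\<bar>) / h ^ ?d"
      unfolding correlation_def
      by (subst Bochner_Integration.integral_divide_zero[symmetric], rule Bochner_Integration.integral_cong)
         (auto simp: P_def indicator_def)
    have "(2 / real N) ^ ?d * M / h ^ ?d = M'"
      unfolding M'_def using N l h(1) by (simp add: power_divide)
    moreover have "(LINT Z|lborel. indicator P Z * \<bar>w Z\<bar>) / h ^ ?d \<le> (2 / real N) ^ ?d * M / h ^ ?d"
      using cell h0(1) by (intro divide_right_mono) auto
    ultimately show ?thesis unfolding eq by (simp only:)
  qed
  define g where "g X = indicator (ball X0 r) X * max 0 (\<bar>w X\<bar> - M')" for X
  have [measurable]: "g \<in> borel_measurable borel" unfolding g_def[abs_def]
    by (intro borel_measurable_times borel_measurable_indicator borel_measurable_max borel_measurable_diff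
        borel_measurable_abs borel_measurable_const \<open>w \<in> borel_measurable borel\<close>) auto
  have sg: "sq_integrable g"
    by (rule sq_dominated[OF w(1)]) (use M in \<open>auto simp: g_def indicator_def\<close>)
  have "(LINT X|lborel. (g X)\<^sup>2) \<le> 0"
  proof (rule field_le_epsilon)
    fix e :: real assume "e > 0"
    obtain \<delta> where \<delta>: "\<delta> > 0" "\<And>k. kernel \<delta> k \<Longrightarrow> sq_integrable (\<lambda>X. correlation (\<lambda>x. \<bar>w x\<bar>) k X - \<bar>w X\<bar>) \<and>
        (LINT X|lborel. (correlation (\<lambda>x. \<bar>w x\<bar>) k X - \<bar>w X\<bar>)\<^sup>2) \<le> e"
      using approximate_identity[OF aw \<open>e > 0\<close>] by blast
    define m where "m = min (\<delta> / real ?d) h0"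
    have m: "m > 0" using \<delta>(1) \<open>h0 > 0\<close> by (simp add: m_def)
    obtain N :: nat where N0: "l / m < real N" using reals_Archimedean2 by blast
    have "0 < l / m" using l(1) m by simp
    then have "0 < real N" using N0 by linarith
    then have N: "N > 0" "l / real N < m"
      using N0 m by (auto simp: divide_less_eq mult.commute)
    define h where "h = l / real N"
    have h: "h > 0" "h < h0" "real ?d * h \<le> \<delta>"
      using N l unfolding h_def m_def by (auto simp: field_simps)
    define k where "k Z = indicator {Z :: 'a. \<forall>b\<in>Basis. 0 \<le> Z \<bullet> b \<and> Z \<bullet> b < h} Z / h ^ ?d" for Z
    have "kernel \<delta> k" unfolding k_def[abs_def] by (rule cell_kernel[OF h(1,3)])
    note * = \<delta>(2)[OF this]
    have "(LINT X|lborel. (g X)\<^sup>2) \<le> (LINT X|lborel. (correlation (\<lambda>x. \<bar>w x\<bar>) k X - \<bar>w X\<bar>)\<^sup>2)"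
    proof (rule integral_le_of_dominated)
      show "integrable lborel (\<lambda>X. (correlation (\<lambda>x. \<bar>w x\<bar>) k X - \<bar>w X\<bar>)\<^sup>2)" using * by auto
      show "(g X)\<^sup>2 \<le> (correlation (\<lambda>x. \<bar>w x\<bar>) k X - \<bar>w X\<bar>)\<^sup>2" for X
      proof (cases "X \<in> ball X0 r \<and> M' < \<bar>w X\<bar>")
        case True
        then have "correlation (\<lambda>x. \<bar>w x\<bar>) k X \<le> M'" using avg[of X N h] N h(2) by (simp add: h_def k_def[abs_def])
        then have "\<bar>g X\<bar> \<le> \<bar>correlation (\<lambda>x. \<bar>w x\<bar>) k X - \<bar>w X\<bar>\<bar>" using True by (simp add: g_def)
        then show ?thesis by (simp only: abs_le_square_iff)
      next
        case False
        then have "g X = 0" by (auto simp: g_def)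
        then show ?thesis by simp
      qed
    qed simp
    then show "(LINT X|lborel. (g X)\<^sup>2) \<le> 0 + e" using * by linarith
  qed
  then have "(LINT X|lborel. (g X)\<^sup>2) = 0" by (simp add: order_antisym)
  then have "AE X in lborel. (g X)\<^sup>2 = 0"
    using integral_nonneg_eq_0_iff_AE[OF sq_integrableD(2)[OF sg]] by auto
  then show ?thesis
  proof eventually_elim
    case (elim X)
    show ?case
    proof
      assume "X \<in> ball X0 r"
      then have "\<bar>w X\<bar> \<le> M'" using elim by (simp add: g_def max_def split: if_splits)
      then have "(w X)\<^sup>2 \<le> M'\<^sup>2" using M by (simp add: abs_le_square_iff[symmetric])
      also have "M'\<^sup>2 = (4 / l\<^sup>2) ^ ?d * (V * K)"
      proof -
        have "M'\<^sup>2 = (((2 / l)\<^sup>2) ^ ?d) * M\<^sup>2"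
          unfolding M'_def power_mult_distrib power_mult[symmetric] by (simp add: mult.commute)
        then show ?thesis using V K by (simp add: M_def power_divide)
      qed
      finally show "(w X)\<^sup>2 \<le> (4 / l\<^sup>2) ^ ?d * (measure lborel (ball X0 R) * K)" by (simp add: V_def)
    qed
  qed
qed

section \<open>Layered elliptic equations and the energy inequality\<close>

type_synonym 'n point = "(real ^ 'n) \<times> real"

definition elliptic :: "real \<Rightarrow> real \<Rightarrow> (real \<Rightarrow> real ^ 'n::finite option ^ 'n option) \<Rightarrow> bool"
  where "elliptic \<nu> L A \<longleftrightarrow> (\<forall>i j. (\<lambda>y. A y $ i $ j) \<in> borel_measurable borel) \<and>
     (\<forall>y. transpose (A y) = A y \<and>
        (\<forall>\<xi>. \<nu> * (norm \<xi>)\<^sup>2 \<le> (A y *v \<xi>) \<bullet> \<xi> \<and> (A y *v \<xi>) \<bullet> \<xi> \<le> L * (norm \<xi>)\<^sup>2))"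

text \<open>
  The quadratic form of \<open>A y\<close> is nonnegative at \<open>\<xi> - (1 / L) A \<xi>\<close>; expand and use the upper bound
  at \<open>\<xi>\<close> and at \<open>A \<xi>\<close>.
\<close>

lemma elliptic_norm_le:
  assumes A: "elliptic \<nu> L A" and "0 < \<nu>" "0 < L"
  shows "norm (A y *v \<xi>) \<le> L * norm \<xi>"
proof -
  let ?\<zeta> = "A y *v \<xi>"
  have sym: "(A y *v u) \<bullet> v = u \<bullet> (A y *v v)" for u v
    using A by (metis dot_lmul_matrix elliptic_def vector_transpose_matrix)
  have pos: "0 \<le> (A y *v u) \<bullet> u" for u
    using A \<open>0 < \<nu>\<close> unfolding elliptic_def by (smt (verit) mult_nonneg_nonneg zero_le_power2)
  have up: "(A y *v u) \<bullet> u \<le> L * (norm u)\<^sup>2" for u using A by (auto simp: elliptic_def)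
  have "0 \<le> (A y *v (\<xi> - (1 / L) *\<^sub>R ?\<zeta>)) \<bullet> (\<xi> - (1 / L) *\<^sub>R ?\<zeta>)" by (rule pos)
  also have "\<dots> = (A y *v \<xi>) \<bullet> \<xi> - (2 / L) * (norm ?\<zeta>)\<^sup>2 + (1 / L)\<^sup>2 * ((A y *v ?\<zeta>) \<bullet> ?\<zeta>)"
    unfolding power2_norm_eq_inner using sym[of ?\<zeta> \<xi>]
    by (simp add: matrix_vector_mult_diff_distrib matrix_vector_mult_scaleR inner_diff_left inner_diff_right
        power2_eq_square inner_commute algebra_simps)
  also have "\<dots> \<le> L * (norm \<xi>)\<^sup>2 - (2 / L) * (norm ?\<zeta>)\<^sup>2 + (1 / L)\<^sup>2 * (L * (norm ?\<zeta>)\<^sup>2)"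
    by (intro add_mono diff_mono up mult_left_mono) (use \<open>0 < L\<close> in auto)
  also have "\<dots> = L * (norm \<xi>)\<^sup>2 - (norm ?\<zeta>)\<^sup>2 / L"
    using \<open>0 < L\<close> by (simp add: power2_eq_square field_simps)
  finally have "(norm ?\<zeta>)\<^sup>2 \<le> (L * norm \<xi>)\<^sup>2" using \<open>0 < L\<close> by (simp add: field_simps power2_eq_square)
  then show ?thesis by (rule power2_le_imp_le) (use \<open>0 < L\<close> in simp)
qed

lemma elliptic_entry_le:
  assumes A: "elliptic \<nu> L A" and "0 < \<nu>" "0 < L"
  shows "\<bar>A y $ i $ j\<bar> \<le> L"
proof -
  have "A y $ i $ j = (A y *v axis j 1) $ i"
    by (simp add: matrix_vector_mult_basis column_def)
  also have "\<bar>\<dots>\<bar> \<le> norm (A y *v axis j 1)" by (rule component_le_norm_cart)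
  also have "\<dots> \<le> L" using elliptic_norm_le[OF assms, of y "axis j 1"] by (simp add: norm_axis_1)
  finally show ?thesis .
qed

lemma norm_coord_dir: "norm (coord_dir i) = 1"
  by (cases i) (auto simp: coord_dir_def norm_Pair norm_axis_1)

lemma snd_coord_dir_Some: "snd (coord_dir (Some j)) = 0"
  by (simp add: coord_dir_def)

definition flux :: "(real \<Rightarrow> real ^ 'n option ^ 'n option) \<Rightarrow> ('n point \<Rightarrow> real ^ 'n option) \<Rightarrow>
    'n::finite option \<Rightarrow> 'n point \<Rightarrow> real"
  where "flux A F i X = (A (snd X) *v F X) $ i"

definition vec_sq_integrable :: "('n point \<Rightarrow> real ^ 'n::finite option) \<Rightarrow> bool"
  where "vec_sq_integrable F \<longleftrightarrow> (\<forall>i. sq_integrable (\<lambda>X. F X $ i) \<and> integrable lborel (\<lambda>X. F X $ i))"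

definition energy :: "'n point set \<Rightarrow> ('n point \<Rightarrow> real ^ 'n::finite option) \<Rightarrow> real"
  where "energy B F = (\<Sum>i\<in>UNIV. sqnorm B (\<lambda>X. F X $ i))"

text \<open>
  The pair \<open>w\<close>, \<open>F\<close> lives on the whole space, but \<open>F\<close> is tied to \<open>w\<close> and to the equation through test
  functions of \<open>E\<close> only.
\<close>

definition solves :: "(real \<Rightarrow> real ^ 'n option ^ 'n option) \<Rightarrow> 'n point set \<Rightarrow>
    ('n point \<Rightarrow> real) \<Rightarrow> ('n point \<Rightarrow> real ^ 'n::finite option) \<Rightarrow> bool"
  where "solves A E w F \<longleftrightarrow> sq_integrable w \<and> integrable lborel w \<and> vec_sq_integrable F \<and>
    (\<forall>\<phi>. test_function E \<phi> \<longrightarrow>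
      (\<forall>i. (LINT X|lborel. w X * dd \<phi> (coord_dir i) X) = - (LINT X|lborel. F X $ i * \<phi> X)) \<and>
      (\<Sum>i\<in>UNIV. LINT X|lborel. flux A F i X * dd \<phi> (coord_dir i) X) = 0)"

lemma energy_nonneg[simp]: "0 \<le> energy B F"
  by (simp add: energy_def sum_nonneg)

lemma sqnorm_le_energy: "sqnorm B (\<lambda>X. F X $ i) \<le> energy B F"
  unfolding energy_def by (rule member_le_sum) auto

lemma flux_sum: "flux A F i X = (\<Sum>j\<in>UNIV. A (snd X) $ i $ j * F X $ j)"
  by (simp add: flux_def matrix_vector_mult_def)

lemma entry_measurable:
  fixes A :: "real \<Rightarrow> real ^ 'n::finite option ^ 'n option"
  assumes "elliptic \<nu> L A"
  shows "(\<lambda>X. A (snd X) $ i $ j) \<in> borel_measurable (borel :: 'n point measure)"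
proof -
  have A: "(\<lambda>y. A y $ i $ j) \<in> borel_measurable borel" using assms by (simp add: elliptic_def)
  have s: "(snd :: 'n point \<Rightarrow> real) \<in> borel_measurable borel"
    by (intro borel_measurable_continuous_onI continuous_intros)
  show ?thesis using measurable_compose[OF s A] .
qed

lemma flux_sq:
  assumes A: "elliptic \<nu> L A" "0 < \<nu>" "0 < L" and F: "vec_sq_integrable F"
  shows "sq_integrable (flux A F i)" "integrable lborel (flux A F i)"
proof -
  have eq: "flux A F i = (\<lambda>X. \<Sum>j\<in>UNIV. A (snd X) $ i $ j * F X $ j)" by (rule ext) (rule flux_sum)
  show "sq_integrable (flux A F i)" unfolding eq
    by (intro sq_sum sq_mult_bounded[where B = L] entry_measurable[OF A(1)] elliptic_entry_le[OF A])
       (use F in \<open>auto simp: vec_sq_integrable_def\<close>)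
  have "integrable lborel (\<lambda>X. A (snd X) $ i $ j * F X $ j)" for j
    using integrable_mult_bounded[of "\<lambda>X. F X $ j", OF _ entry_measurable[OF A(1), of i j] elliptic_entry_le[OF A]] F
    by (simp add: vec_sq_integrable_def mult.commute)
  then show "integrable lborel (flux A F i)" unfolding eq
    by (intro Bochner_Integration.integrable_sum) auto
qed

lemma l2_mult_le:
  assumes "sq_integrable f" "b \<in> borel_measurable borel" "\<And>x. \<bar>b x\<bar> \<le> B"
  shows "l2_norm (\<lambda>x. b x * f x) \<le> B * l2_norm f"
proof (rule power2_le_imp_le)
  have B: "0 \<le> B" using assms(3)[of 0] by linarith
  have "(l2_norm (\<lambda>x. b x * f x))\<^sup>2 \<le> (LINT x|lborel. B\<^sup>2 * (f x)\<^sup>2)"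
    unfolding l2_power2 power_mult_distrib
    by (rule integral_le_of_dominated)
       (use assms sq_integrableD(2)[OF assms(1)] B abs_le_square_iff[of "b _" B] in \<open>auto intro!: mult_right_mono\<close>)
  then show "(l2_norm (\<lambda>x. b x * f x))\<^sup>2 \<le> (B * l2_norm f)\<^sup>2" by (simp add: power_mult_distrib l2_power2)
  show "0 \<le> B * l2_norm f" using B by simp
qed

text \<open>
  The equation tested with \<open>\<zeta> w\<close>, which is not smooth. Mollify \<open>w\<close>: where \<open>\<zeta>\<close> does not vanish, the
  gradient of the mollification is the mollification of \<open>F\<close>, so that all terms converge in \<open>L\<^sup>2\<close>.
\<close>

lemma test_with_solution:
  fixes w :: "'n::finite point \<Rightarrow> real"
  assumes A: "elliptic \<nu> L A" "0 < \<nu>" "0 < L" and s: "solves A (ball X0 R) w F"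
    and t: "test_function (ball X0 r) \<zeta>" and "r < R"
  shows "(LINT X|lborel. (\<Sum>i\<in>UNIV. flux A F i X * (dd \<zeta> (coord_dir i) X * w X + \<zeta> X * F X $ i))) = 0"
proof -
  have w: "sq_integrable w" "integrable lborel w" and F: "\<And>i. sq_integrable (\<lambda>X. F X $ i)" "\<And>i. integrable lborel (\<lambda>X. F X $ i)"
    and vF: "vec_sq_integrable F"
    using s by (auto simp: solves_def vec_sq_integrable_def)
  note fl = flux_sq[OF A vF]
  have t': "test_function (ball X0 r) (dd \<zeta> v)" for v by (rule test_function_dd[OF t])
  obtain B0 where B0: "B0 > 0" "\<And>X. \<bar>\<zeta> X\<bar> \<le> B0" using test_function_bounded[OF t] by blast
  have "\<forall>i. \<exists>B. \<forall>X. \<bar>dd \<zeta> (coord_dir i) X\<bar> \<le> B" using test_function_bounded[OF t'] by metis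
  then obtain B1 where B1: "\<And>i X. \<bar>dd \<zeta> (coord_dir i) X\<bar> \<le> B1 i" by metis
  have mt: "\<zeta> \<in> borel_measurable borel" "dd \<zeta> v \<in> borel_measurable borel" for v
    using test_function_measurable[OF t] test_function_measurable[OF t'] by auto
  define a where "a i X = dd \<zeta> (coord_dir i) X * w X + \<zeta> X * F X $ i" for i X
  have sa: "sq_integrable (a i)" for i
    unfolding a_def[abs_def] by (intro sq_add sq_mult_bounded[OF w(1) mt(2) B1] sq_mult_bounded[OF F(1) mt(1) B0(2)])
  define I where "I = (\<Sum>i\<in>UNIV. LINT X|lborel. flux A F i X * a i X)"
  have "\<bar>I\<bar> \<le> 0 + u * (\<Sum>i\<in>UNIV. l2_norm (flux A F i) * (B1 i + B0))" if u: "u > 0" for u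
  proof -
    have u2: "u\<^sup>2 > 0" using u by simp
    from approximate_identity[OF w u2]
    obtain dw where dw: "dw > 0" "\<forall>k. kernel dw k \<longrightarrow> sq_integrable (\<lambda>X. correlation w k X - w X) \<and> (LINT X|lborel. (correlation w k X - w X)\<^sup>2) \<le> u\<^sup>2"
      by (elim exE conjE) (rule that)
    have "\<forall>i. \<exists>d>0. \<forall>k. kernel d k \<longrightarrow> sq_integrable (\<lambda>X. correlation (\<lambda>X. F X $ i) k X - F X $ i) \<and>
        (LINT X|lborel. (correlation (\<lambda>X. F X $ i) k X - F X $ i)\<^sup>2) \<le> u\<^sup>2"
      using approximate_identity[OF F u2] by simp
    from choice[OF this]
    obtain dF where "\<forall>i. dF i > 0 \<and> (\<forall>k. kernel (dF i) k \<longrightarrow> sq_integrable (\<lambda>X. correlation (\<lambda>X. F X $ i) k X - F X $ i) \<and>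
        (LINT X|lborel. (correlation (\<lambda>X. F X $ i) k X - F X $ i)\<^sup>2) \<le> u\<^sup>2)" by (elim exE) (rule that)
    then have dF: "\<And>i. dF i > 0" "\<And>i k. kernel (dF i) k \<Longrightarrow> sq_integrable (\<lambda>X. correlation (\<lambda>X. F X $ i) k X - F X $ i) \<and>
        (LINT X|lborel. (correlation (\<lambda>X. F X $ i) k X - F X $ i)\<^sup>2) \<le> u\<^sup>2" by simp_all
    \<comment> \<open>one kernel for the function and for all components of its gradient\<close>
    define d where "d = Min (insert (R - r) (insert dw (range dF)))"
    have "d \<le> x" if "x \<in> insert (R - r) (insert dw (range dF))" for x
      unfolding d_def by (rule Min_le[OF _ that]) simp
    moreover have "d > 0" unfolding d_def using dw(1) dF(1) \<open>r < R\<close> by (subst Min_gr_iff) auto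
    ultimately have d: "d > 0" "d \<le> dw" "\<And>i. d \<le> dF i" "d \<le> R - r" by auto
    obtain k :: "'n point \<Rightarrow> real" where k: "kernel d k" "test_function UNIV k"
      using smooth_kernel_exists[OF d(1)] by blast
    have kd: "kernel d' k" if "d \<le> d'" for d' using k(1) that by (auto simp: kernel_def)
    define wk where "wk = correlation w k"
    define Fk where "Fk i = correlation (\<lambda>X. F X $ i) k" for i
    have ew: "sq_integrable (\<lambda>X. wk X - w X)" "l2_norm (\<lambda>X. wk X - w X) \<le> u"
      using dw(2)[rule_format, OF kd[OF d(2)]] u by (auto simp: wk_def l2_norm_def real_le_lsqrt)
    have eF: "sq_integrable (\<lambda>X. Fk i X - F X $ i)" "l2_norm (\<lambda>X. Fk i X - F X $ i) \<le> u" for i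
      using dF(2)[OF kd[OF d(3)]] u by (auto simp: Fk_def l2_norm_def real_le_lsqrt)
    have tw: "test_function (ball X0 R) (\<lambda>X. \<zeta> X * wk X)"
      unfolding wk_def using t \<open>r < R\<close>
      by (intro test_function_mult Ck_correlation[OF w(2) k(2)]) (auto intro: test_function_mono subset_ball)
    \<comment> \<open>the kernel translated to X is itself an admissible test function\<close>
    have grad_wk: "dd wk (coord_dir i) X = Fk i X" if X: "X \<in> ball X0 r" for i X
    proof -
      have tk: "test_function (ball X0 R) (\<lambda>Z. k (Z - X))"
      proof -
        have "Ck j (\<lambda>Z. k (Z - X))" for j
          using Ck_affine[OF test_function_Ck[OF k(2)], of j "- X" 1] by (simp add: algebra_simps)

        moreover have "k (Z - X) = 0" if "Z \<notin> ball X d" for Z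
        proof -
          have "\<forall>x. d \<le> norm x \<longrightarrow> k x = 0" using k(1) unfolding kernel_def by blast
          then have "d \<le> norm (Z - X) \<longrightarrow> k (Z - X) = 0" by (rule spec)
          then show ?thesis using that by (simp add: dist_norm norm_minus_commute not_less)
        qed
        ultimately show ?thesis
        proof (intro test_functionI[where K = "cball X d"])
          show "cball X d \<subseteq> ball X0 R"
          proof
            fix Z assume "Z \<in> cball X d"
            then show "Z \<in> ball X0 R" using X d(4) dist_triangle[of X0 Z X] by simp
          qed
        qed auto
      qed
      have "dd wk (coord_dir i) X = - (LINT Z|lborel. w Z * dd (\<lambda>Z. k (Z - X)) (coord_dir i) Z)"
        unfolding wk_def dd_correlation[OF w(2) k(2)] by (simp add: correlation_def dd_translate[OF k(2)])
      also have "\<dots> = Fk i X" using s tk by (simp add: solves_def Fk_def correlation_def)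
      finally show ?thesis .
    qed
    have dd_tw: "dd (\<lambda>X. \<zeta> X * wk X) (coord_dir i) X = dd \<zeta> (coord_dir i) X * wk X + \<zeta> X * Fk i X" for i X
    proof -
      have "((\<lambda>X. \<zeta> X * wk X) has_derivative (\<lambda>v. \<zeta> X * dd wk v X + dd \<zeta> v X * wk X)) (at X)"
        by (intro has_derivative_mult Ck_has_derivative test_function_Ck[OF t])
           (simp only: wk_def Ck_correlation[OF w(2) k(2)])
      then have "dd (\<lambda>X. \<zeta> X * wk X) (coord_dir i) X = \<zeta> X * dd wk (coord_dir i) X + dd \<zeta> (coord_dir i) X * wk X"
        by (simp add: frechet_derivative_eqI)
      then show ?thesis using grad_wk[of X i] test_function_zero[OF t, of X] by (cases "X \<in> ball X0 r") auto
    qed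
    define b where "b i X = dd \<zeta> (coord_dir i) X * (wk X - w X) + \<zeta> X * (Fk i X - F X $ i)" for i X
    have sb1: "sq_integrable (\<lambda>X. dd \<zeta> (coord_dir i) X * (wk X - w X))" and sb2: "sq_integrable (\<lambda>X. \<zeta> X * (Fk i X - F X $ i))" for i
      by (intro sq_mult_bounded[OF ew(1) mt(2) B1] sq_mult_bounded[OF eF(1) mt(1) B0(2)])+
    have sb: "sq_integrable (b i)" for i unfolding b_def[abs_def] by (rule sq_add[OF sb1 sb2])
    have lb: "l2_norm (b i) \<le> u * (B1 i + B0)" for i
    proof -
      have "l2_norm (b i) \<le> l2_norm (\<lambda>X. dd \<zeta> (coord_dir i) X * (wk X - w X)) + l2_norm (\<lambda>X. \<zeta> X * (Fk i X - F X $ i))"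
        unfolding b_def[abs_def] by (rule l2_triangle[OF sb1 sb2])
      also have "\<dots> \<le> B1 i * l2_norm (\<lambda>X. wk X - w X) + B0 * l2_norm (\<lambda>X. Fk i X - F X $ i)"
        by (intro add_mono l2_mult_le[OF ew(1) mt(2) B1] l2_mult_le[OF eF(1) mt(1) B0(2)])
      also have "\<dots> \<le> B1 i * u + B0 * u"
        using B1[where i = i and X = X0] B0(1) ew(2) eF(2) by (intro add_mono mult_left_mono) auto
      finally show ?thesis by (simp add: algebra_simps)
    qed
    have "0 = (\<Sum>i\<in>UNIV. LINT X|lborel. flux A F i X * dd (\<lambda>X. \<zeta> X * wk X) (coord_dir i) X)"
      using s tw by (simp add: solves_def)
    also have "\<dots> = (\<Sum>i\<in>UNIV. LINT X|lborel. flux A F i X * a i X + flux A F i X * b i X)"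
      by (simp add: dd_tw a_def b_def algebra_simps)
    also have "\<dots> = I + (\<Sum>i\<in>UNIV. LINT X|lborel. flux A F i X * b i X)"
      unfolding I_def sum.distrib[symmetric]
      by (intro sum.cong refl Bochner_Integration.integral_add sq_mult_integrable fl sa sb)
    finally have "\<bar>I\<bar> = \<bar>\<Sum>i\<in>UNIV. LINT X|lborel. flux A F i X * b i X\<bar>" by linarith
    also have "\<dots> \<le> (\<Sum>i\<in>UNIV. l2_norm (flux A F i) * (u * (B1 i + B0)))"
    proof (rule order_trans[OF sum_abs sum_mono])
      fix i
      have "\<bar>LINT X|lborel. flux A F i X * b i X\<bar> \<le> l2_norm (flux A F i) * l2_norm (b i)"
        by (rule l2_cauchy_schwarz[OF fl(1) sb])
      also have "\<dots> \<le> l2_norm (flux A F i) * (u * (B1 i + B0))" by (intro mult_left_mono lb) simp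
      finally show "\<bar>LINT X|lborel. flux A F i X * b i X\<bar> \<le> l2_norm (flux A F i) * (u * (B1 i + B0))" .
    qed
    also have "\<dots> = 0 + u * (\<Sum>i\<in>UNIV. l2_norm (flux A F i) * (B1 i + B0))"
      by (simp add: sum_distrib_left mult.left_commute)
    finally show ?thesis .
  qed
  then have "\<bar>I\<bar> \<le> 0" by (rule le_of_le_add_small)
  then have "I = 0" by simp
  moreover have "(LINT X|lborel. (\<Sum>i\<in>UNIV. flux A F i X * a i X)) = I"
    unfolding I_def by (intro Bochner_Integration.integral_sum sq_mult_integrable fl sa)
  ultimately show ?thesis by (simp add: a_def)
qed

lemma norm_vec_square: "(norm (x :: real ^ 'm))\<^sup>2 = (\<Sum>i\<in>UNIV. (x $ i)\<^sup>2)"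
  unfolding power2_norm_eq_inner inner_vec_def by (simp add: power2_eq_square)

lemma test_function_bump: "test_function UNIV (bump :: 'a::euclidean_space \<Rightarrow> real)"
  by (rule test_functionI[where K = "cball 0 1"]) (use Ck_bump bump_zero[OF less_imp_le] in \<open>auto simp: not_le\<close>)

text \<open>
  Test with \<open>\<eta>\<^sup>2 w\<close> for a bump \<open>\<eta>\<close>. The term with \<open>\<eta>\<^sup>2 F\<close> controls the energy, and Young's
  inequality absorbs half of it from the cross term with \<open>\<nabla>\<eta>\<close>.
\<close>

lemma caccioppoli:
  "\<exists>K\<ge>0. \<forall>(A :: real \<Rightarrow> real ^ 'n::finite option ^ 'n option) \<nu> L X0 \<rho> w F.
     elliptic \<nu> L A \<longrightarrow> 0 < \<nu> \<longrightarrow> 0 < L \<longrightarrow> 0 < \<rho> \<longrightarrow> solves A (ball X0 \<rho>) w F \<longrightarrow>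
     energy (ball X0 (\<rho> / 4)) F \<le> K * (L / \<nu>)\<^sup>2 / \<rho>\<^sup>2 * sqnorm (ball X0 \<rho>) w"
proof -
  have "\<forall>i. \<exists>B>0. \<forall>X :: 'n point. \<bar>dd bump (coord_dir i) X\<bar> \<le> B"
    using test_function_bounded[OF test_function_dd[OF test_function_bump]] by blast
  from choice[OF this] obtain Bi where Bi: "\<forall>i. Bi i > 0 \<and> (\<forall>X :: 'n point. \<bar>dd bump (coord_dir i) X\<bar> \<le> Bi i)"
    by (elim exE) (rule that)
  define B where "B = Max (range Bi)"
  have Bmax: "Bi i \<le> B" for i unfolding B_def by (rule Max_ge) auto
  then have B: "\<bar>dd bump (coord_dir i) X\<bar> \<le> B" for i and X :: "'n point"
    using Bi by (meson order_trans)
  define N where "N = real CARD('n option)"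
  define K where "K = 16 * exp 4 * N * B\<^sup>2"
  show ?thesis
  proof (intro exI[of _ K] conjI allI impI)
    show "0 \<le> K" by (simp add: K_def N_def)
    fix A :: "real \<Rightarrow> real ^ 'n option ^ 'n option" and \<nu> L \<rho> :: real and X0 :: "'n point" and w F
    assume A: "elliptic \<nu> L A" "0 < \<nu>" "0 < L" and \<rho>: "0 < \<rho>" and s: "solves A (ball X0 \<rho>) w F"
    have w: "sq_integrable w" and F: "\<And>i. sq_integrable (\<lambda>X. F X $ i)" and vF: "vec_sq_integrable F"
      using s by (auto simp: solves_def vec_sq_integrable_def)
    note fl = flux_sq[OF A vF]
    define c where "c = 2 / \<rho>"
    have c: "c > 0" using \<rho> by (simp add: c_def)
    define \<eta> where "\<eta> X = bump ((- c *\<^sub>R X0) + c *\<^sub>R X)" for X :: "'n point"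
    have Ck\<eta>: "Ck k \<eta>" for k unfolding \<eta>_def[abs_def] by (rule Ck_affine[OF Ck_bump])
    have arg: "norm ((- c *\<^sub>R X0) + c *\<^sub>R X) = c * dist X0 X" for X
    proof -
      have "(- c *\<^sub>R X0) + c *\<^sub>R X = c *\<^sub>R (X - X0)" by (simp add: algebra_simps)
      then show ?thesis using c by (simp add: dist_norm norm_minus_commute)
    qed
    have \<eta>0: "\<eta> X = 0" if "X \<notin> cball X0 (\<rho> / 2)" for X
      unfolding \<eta>_def using that \<rho> by (intro bump_zero, unfold arg) (auto simp: c_def field_simps)
    have \<eta>low: "exp (-2) \<le> \<eta> X" if "X \<in> ball X0 (\<rho> / 4)" for X
      unfolding \<eta>_def using that \<rho> by (intro bump_lower, unfold arg) (auto simp: c_def field_simps)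
    have t\<eta>: "test_function (ball X0 (3 / 4 * \<rho>)) \<eta>"
      by (rule test_functionI[where K = "cball X0 (\<rho> / 2)"]) (use Ck\<eta> \<eta>0 \<rho> in auto)
    define D where "D X = (\<chi> i. dd \<eta> (coord_dir i) X)" for X
    have D_B: "\<bar>dd \<eta> (coord_dir i) X\<bar> \<le> c * B" for i X
      unfolding \<eta>_def[abs_def] dd_affine[OF Ck_bump] using c B by (simp add: abs_mult mult_left_mono)
    have D_norm: "(norm (D X))\<^sup>2 \<le> indicator (ball X0 \<rho>) X * (N * (c * B)\<^sup>2)" for X
    proof (cases "X \<in> ball X0 \<rho>")
      case True
      have "(norm (D X))\<^sup>2 = (\<Sum>i\<in>UNIV. (dd \<eta> (coord_dir i) X)\<^sup>2)" by (simp add: norm_vec_square D_def)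
      also have "\<dots> \<le> (\<Sum>i\<in>(UNIV :: 'n option set). (c * B)\<^sup>2)"
        using D_B by (intro sum_mono) (metis abs_ge_zero abs_le_square_iff abs_of_nonneg order_trans)
      finally show ?thesis using True by (simp add: N_def)
    next
      case False
      then have "dd \<eta> (coord_dir i) X = 0" for i
        using test_function_zero[OF test_function_dd[OF t\<eta>], of X] \<rho> by simp
      then show ?thesis using False by (simp add: norm_vec_square D_def)
    qed
    have tz: "test_function (ball X0 (3 / 4 * \<rho>)) (\<lambda>X. \<eta> X * \<eta> X)" by (rule test_function_mult[OF t\<eta> Ck\<eta>])
    have ddz: "dd (\<lambda>X. \<eta> X * \<eta> X) (coord_dir i) X = 2 * \<eta> X * D X $ i" for i X
    proof -
      have "((\<lambda>X. \<eta> X * \<eta> X) has_derivative (\<lambda>v. \<eta> X * dd \<eta> v X + dd \<eta> v X * \<eta> X)) (at X)"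
        by (intro has_derivative_mult Ck_has_derivative Ck\<eta>)
      then show ?thesis by (simp add: frechet_derivative_eqI D_def)
    qed
    define J where "J X = (\<Sum>i\<in>UNIV. flux A F i X * (2 * \<eta> X * D X $ i * w X + \<eta> X * \<eta> X * F X $ i))" for X
    have J0: "(LINT X|lborel. J X) = 0"
      using test_with_solution[OF A s tz] \<rho> by (simp add: J_def ddz)
    obtain E where E: "\<And>X. \<bar>\<eta> X\<bar> \<le> E" using test_function_bounded[OF t\<eta>] by blast
    have m\<eta>: "\<eta> \<in> borel_measurable borel" by (rule test_function_measurable[OF t\<eta>])
    have mD: "(\<lambda>X. D X $ i) \<in> borel_measurable borel" for i
      using test_function_measurable[OF test_function_dd[OF t\<eta>]] by (simp add: D_def)
    have iJ: "integrable lborel J"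
    proof -
      have s1: "sq_integrable (\<lambda>X. \<eta> X * f X)" if "sq_integrable f" for f by (rule sq_mult_bounded[OF that m\<eta> E])
      have s2: "sq_integrable (\<lambda>X. D X $ i * w X)" for i
        by (rule sq_mult_bounded[OF w mD, where B = "c * B"]) (use D_B in \<open>simp add: D_def\<close>)
      have "sq_integrable (\<lambda>X. 2 * (\<eta> X * (D X $ i * w X)) + \<eta> X * (\<eta> X * F X $ i))" for i
        by (intro sq_add sq_cmult s1 s2 F)
      then have "sq_integrable (\<lambda>X. 2 * \<eta> X * D X $ i * w X + \<eta> X * \<eta> X * F X $ i)" for i
        by (simp add: mult.assoc)
      then show ?thesis unfolding J_def[abs_def]
        by (intro Bochner_Integration.integrable_sum sq_mult_integrable fl)
    qed
    have lower: "\<nu> / 2 * exp (-4) * (\<Sum>i\<in>UNIV. indicator (ball X0 (\<rho> / 4)) X * (F X $ i)\<^sup>2) -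
        2 * L\<^sup>2 / \<nu> * (N * (c * B)\<^sup>2) * (indicator (ball X0 \<rho>) X * (w X)\<^sup>2) \<le> J X" for X
    proof -
      let ?f = "norm (F X)" and ?d = "norm (D X)"
      have J: "J X = 2 * \<eta> X * w X * ((A (snd X) *v F X) \<bullet> D X) + (\<eta> X)\<^sup>2 * ((A (snd X) *v F X) \<bullet> F X)"
        unfolding J_def flux_def inner_vec_def
        by (simp add: sum_distrib_left sum.distrib[symmetric] power2_eq_square algebra_simps)
      have a1: "(\<eta> X)\<^sup>2 * (\<nu> * ?f\<^sup>2) \<le> (\<eta> X)\<^sup>2 * ((A (snd X) *v F X) \<bullet> F X)"
        using A by (intro mult_left_mono) (auto simp: elliptic_def)
      have "\<bar>(A (snd X) *v F X) \<bullet> D X\<bar> \<le> norm (A (snd X) *v F X) * ?d" by (rule Cauchy_Schwarz_ineq2)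
      also have "\<dots> \<le> L * ?f * ?d" by (intro mult_right_mono elliptic_norm_le[OF A]) simp
      finally have a2: "\<bar>(A (snd X) *v F X) \<bullet> D X\<bar> \<le> L * ?f * ?d" .
      have "\<bar>2 * \<eta> X * w X * ((A (snd X) *v F X) \<bullet> D X)\<bar> = 2 * \<bar>\<eta> X\<bar> * \<bar>w X\<bar> * \<bar>(A (snd X) *v F X) \<bullet> D X\<bar>"
        by (simp add: abs_mult)
      also have "\<dots> \<le> 2 * \<bar>\<eta> X\<bar> * \<bar>w X\<bar> * (L * ?f * ?d)" by (intro mult_left_mono a2) auto
      also have "\<dots> \<le> \<nu> / 2 * ((\<eta> X)\<^sup>2 * ?f\<^sup>2) + 2 * L\<^sup>2 / \<nu> * ((w X)\<^sup>2 * ?d\<^sup>2)"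
      proof -
        \<comment> \<open>Young's inequality with the weights that leave half of the ellipticity constant\<close>
        have "0 \<le> (\<nu> * (\<bar>\<eta> X\<bar> * ?f) - 2 * L * (\<bar>w X\<bar> * ?d))\<^sup>2 / (2 * \<nu>)" using A(2) by simp
        also have "\<dots> = \<nu> / 2 * (\<bar>\<eta> X\<bar> * ?f)\<^sup>2 + 2 * L\<^sup>2 / \<nu> * (\<bar>w X\<bar> * ?d)\<^sup>2 - 2 * \<bar>\<eta> X\<bar> * \<bar>w X\<bar> * (L * ?f * ?d)"
          using A(2) by (simp add: power2_diff field_simps power2_eq_square)
        finally show ?thesis by (simp add: power_mult_distrib)
      qed
      finally have a3: "- (2 * \<eta> X * w X * ((A (snd X) *v F X) \<bullet> D X)) \<le>
          \<nu> / 2 * ((\<eta> X)\<^sup>2 * ?f\<^sup>2) + 2 * L\<^sup>2 / \<nu> * ((w X)\<^sup>2 * ?d\<^sup>2)" by linarith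
      have a4: "2 * L\<^sup>2 / \<nu> * ((w X)\<^sup>2 * ?d\<^sup>2) \<le> 2 * L\<^sup>2 / \<nu> * ((w X)\<^sup>2 * (indicator (ball X0 \<rho>) X * (N * (c * B)\<^sup>2)))"
        using A(2) by (intro mult_left_mono D_norm) auto
      have a5: "\<nu> / 2 * (exp (-4) * (indicator (ball X0 (\<rho> / 4)) X * ?f\<^sup>2)) \<le> \<nu> / 2 * ((\<eta> X)\<^sup>2 * ?f\<^sup>2)"
      proof (cases "X \<in> ball X0 (\<rho> / 4)")
        case True
        have "exp (-2) ^ 2 \<le> (\<eta> X)\<^sup>2" using \<eta>low[OF True] by (intro power_mono) auto
        then have "exp (-4) \<le> (\<eta> X)\<^sup>2" by (simp add: exp_of_nat_mult[symmetric] power2_eq_square mult_exp_exp)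
        then show ?thesis using True A(2) by (simp add: mult_right_mono)
      qed (use A(2) in simp)
      have "(\<Sum>i\<in>UNIV. indicator (ball X0 (\<rho> / 4)) X * (F X $ i)\<^sup>2) = indicator (ball X0 (\<rho> / 4)) X * ?f\<^sup>2"
        unfolding norm_vec_square by (rule sum_distrib_left[symmetric])
      then have g1: "\<nu> / 2 * exp (-4) * (\<Sum>i\<in>UNIV. indicator (ball X0 (\<rho> / 4)) X * (F X $ i)\<^sup>2) =
          \<nu> / 2 * (exp (-4) * (indicator (ball X0 (\<rho> / 4)) X * ?f\<^sup>2))" by (simp only: mult.assoc)
      have g2: "2 * L\<^sup>2 / \<nu> * (N * (c * B)\<^sup>2) * (indicator (ball X0 \<rho>) X * (w X)\<^sup>2) =
          2 * L\<^sup>2 / \<nu> * ((w X)\<^sup>2 * (indicator (ball X0 \<rho>) X * (N * (c * B)\<^sup>2)))" by (simp only: mult_ac)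
      have g3: "(\<eta> X)\<^sup>2 * (\<nu> * ?f\<^sup>2) = 2 * (\<nu> / 2 * ((\<eta> X)\<^sup>2 * ?f\<^sup>2))" by simp
      show ?thesis using a1 a3 a4 a5 unfolding g1 g2 g3 J by linarith
    qed
    have iF: "integrable lborel (\<lambda>X. indicator (ball X0 (\<rho> / 4)) X * (F X $ i)\<^sup>2)" for i
      by (rule sqnorm_integrable[OF F]) simp
    have iw: "integrable lborel (\<lambda>X. indicator (ball X0 \<rho>) X * (w X)\<^sup>2)"
      by (rule sqnorm_integrable[OF w]) simp
    define S where "S X = (\<Sum>i\<in>UNIV. indicator (ball X0 (\<rho> / 4)) X * (F X $ i)\<^sup>2)" for X
    have S: "integrable lborel S" "(LINT X|lborel. S X) = energy (ball X0 (\<rho> / 4)) F"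
      unfolding S_def[abs_def] energy_def sqnorm_def
      by (rule Bochner_Integration.integrable_sum[OF iF]) (rule Bochner_Integration.integral_sum[OF iF])
    have i2: "integrable lborel (\<lambda>X. \<nu> / 2 * exp (-4) * S X)"
       "integrable lborel (\<lambda>X. 2 * L\<^sup>2 / \<nu> * (N * (c * B)\<^sup>2) * (indicator (ball X0 \<rho>) X * (w X)\<^sup>2))"
      by (intro integrable_mult_right S iw)+
    have "\<nu> / 2 * exp (-4) * energy (ball X0 (\<rho> / 4)) F - 2 * L\<^sup>2 / \<nu> * (N * (c * B)\<^sup>2) * sqnorm (ball X0 \<rho>) w =
      (LINT X|lborel. \<nu> / 2 * exp (-4) * S X -
        2 * L\<^sup>2 / \<nu> * (N * (c * B)\<^sup>2) * (indicator (ball X0 \<rho>) X * (w X)\<^sup>2))"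
      unfolding Bochner_Integration.integral_diff[OF i2] sqnorm_def S(2)[symmetric] by simp
    also have "\<dots> \<le> (LINT X|lborel. J X)"
      by (rule integral_mono[OF Bochner_Integration.integrable_diff[OF i2] iJ lower[folded S_def]])
    finally have "\<nu> / 2 * exp (-4) * energy (ball X0 (\<rho> / 4)) F \<le> 2 * L\<^sup>2 / \<nu> * (N * (c * B)\<^sup>2) * sqnorm (ball X0 \<rho>) w"
      using J0 by simp
    then have "2 / \<nu> * exp 4 * (\<nu> / 2 * exp (-4) * energy (ball X0 (\<rho> / 4)) F) \<le>
       2 / \<nu> * exp 4 * (2 * L\<^sup>2 / \<nu> * (N * (c * B)\<^sup>2) * sqnorm (ball X0 \<rho>) w)"
      using A(2) by (intro mult_left_mono) auto
    moreover have "2 / \<nu> * exp 4 * (\<nu> / 2 * exp (-4) * energy (ball X0 (\<rho> / 4)) F) = energy (ball X0 (\<rho> / 4)) F"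
      using A(2) by (simp add: exp_minus)
    moreover have "2 / \<nu> * exp 4 * (2 * L\<^sup>2 / \<nu> * (N * (c * B)\<^sup>2) * sqnorm (ball X0 \<rho>) w) =
       K * (L / \<nu>)\<^sup>2 / \<rho>\<^sup>2 * sqnorm (ball X0 \<rho>) w"
      using A(2) \<rho> by (simp add: K_def c_def power2_eq_square field_simps)
    ultimately show "energy (ball X0 (\<rho> / 4)) F \<le> K * (L / \<nu>)\<^sup>2 / \<rho>\<^sup>2 * sqnorm (ball X0 \<rho>) w" by linarith
  qed
qed

section \<open>Horizontal regularity\<close>

text \<open>
  The equations tested with translates of a test function, as long as these stay in the ball.
\<close>

lemma solves_correlation:
  assumes s: "solves A (ball X0 R) w F" and t: "test_function (ball X0 r) \<phi>" and a: "norm a + r \<le> R"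
  shows "correlation w (dd \<phi> (coord_dir i)) a = - correlation (\<lambda>X. F X $ i) \<phi> a"
    "(\<Sum>i\<in>UNIV. correlation (flux A F i) (dd \<phi> (coord_dir i)) a) = 0"
  using s test_function_translate_ball[OF t a]
  by (auto simp: solves_def correlation_def dd_translate[OF t, symmetric])

lemma diff_quot_component: "diff_quot e h F X $ i = diff_quot e h (\<lambda>X. F X $ i) X"
  by (simp add: diff_quot_def)

lemma flux_diff_quot:
  assumes "snd e = 0" shows "flux A (diff_quot e h F) i = diff_quot e h (flux A F i)"
  using assms by (auto simp: fun_eq_iff flux_def diff_quot_def matrix_vector_mult_scaleR matrix_vector_mult_diff_distrib)

lemma vec_sq_diff_quot: "vec_sq_integrable F \<Longrightarrow> vec_sq_integrable (diff_quot e h F)"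
  by (simp add: vec_sq_integrable_def diff_quot_component sq_diff_quot integrable_diff_quot)

text \<open>
  The coefficients depend on \<open>y\<close> only, so that a translation in a direction \<open>e\<close> with \<open>snd e = 0\<close>
  preserves the equation.
\<close>

lemma diff_quot_solves:
  assumes A: "elliptic \<nu> L A" "0 < \<nu>" "0 < L" and s: "solves A (ball X0 R) w F"
    and e: "snd e = 0" "norm e = 1" and h: "\<bar>h\<bar> + r \<le> R"
  shows "solves A (ball X0 r) (diff_quot e h w) (diff_quot e h F)"
  unfolding solves_def
proof (intro conjI allI impI)
  have w: "sq_integrable w" "integrable lborel w" and F: "\<And>i. integrable lborel (\<lambda>X. F X $ i)" and vF: "vec_sq_integrable F"
    using s by (auto simp: solves_def vec_sq_integrable_def)
  show "sq_integrable (diff_quot e h w)" "integrable lborel (diff_quot e h w)" "vec_sq_integrable (diff_quot e h F)"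
    by (intro sq_diff_quot integrable_diff_quot vec_sq_diff_quot w vF)+
  fix \<phi> assume t: "test_function (ball X0 r) \<phi>"
  have a: "norm (h *\<^sub>R e) + r \<le> R" "norm (0 :: 'a point) + r \<le> R" using e h by auto
  note sc = solves_correlation[OF s t a(1)] solves_correlation[OF s t a(2)]
  have t': "test_function (ball X0 r) (dd \<phi> v)" for v by (rule test_function_dd[OF t])
  show "(LINT X|lborel. diff_quot e h w X * dd \<phi> (coord_dir i) X) = - (LINT X|lborel. diff_quot e h F X $ i * \<phi> X)" for i
    unfolding diff_quot_component diff_quot_test[OF w(2) t'] diff_quot_test[OF F t] sc by (simp add: diff_divide_distrib)
  show "(\<Sum>i\<in>UNIV. LINT X|lborel. flux A (diff_quot e h F) i X * dd \<phi> (coord_dir i) X) = 0"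
    unfolding flux_diff_quot[OF e(1)] diff_quot_test[OF flux_sq(2)[OF A vF] t'] sum_divide_distrib[symmetric] sum_subtractf sc
    by simp
qed

text \<open>
  In the discrete Sobolev inequality the vertical direction comes last in the list of directions, so
  all difference quotients except possibly the last one are horizontal.
\<close>

lemma subseqs_snocE:
  assumes "S \<in> set (subseqs (us @ [v]))" "S \<noteq> []"
  obtains S' b where "S = S' @ [b]" "set S' \<subseteq> set us" "b \<in> insert v (set us)" "length S' \<le> length us"
proof -
  have cons: "T \<in> set (subseqs (z # zs)) \<longleftrightarrow> T \<in> set (subseqs zs) \<or> (\<exists>T'\<in>set (subseqs zs). T = z # T')"
    for T z and zs :: "'a list" by (auto simp: Let_def)
  have sub: "set T \<subseteq> set zs \<and> length T \<le> length zs" if "T \<in> set (subseqs zs)" for T zs :: "'a list"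
    using that
  proof (induction zs arbitrary: T)
    case (Cons z zs)
    from Cons.prems consider "T \<in> set (subseqs zs)" | T' where "T' \<in> set (subseqs zs)" "T = z # T'"
      unfolding cons by blast
    then show ?case
    proof cases
      case 1
      show ?thesis using Cons.IH[OF 1] by auto
    next
      case 2
      show ?thesis using Cons.IH[OF 2(1)] 2(2) by auto
    qed
  qed simp
  have "S \<in> set (subseqs us) \<or> (\<exists>S'\<in>set (subseqs us). S = S' @ [v])"
    using assms(1)
  proof (induction us arbitrary: S)
    case (Cons z zs)
    from Cons.prems consider "S \<in> set (subseqs (zs @ [v]))" | T' where "T' \<in> set (subseqs (zs @ [v]))" "S = z # T'"
      unfolding append_Cons cons by blast
    then show ?case
    proof cases
      case 1
      from Cons.IH[OF 1] show ?thesis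
      proof
        assume "\<exists>S'\<in>set (subseqs zs). S = S' @ [v]"
        then obtain S' where "S' \<in> set (subseqs zs)" "S = S' @ [v]" by (elim bexE)
        moreover from this(1) have "S' \<in> set (subseqs (z # zs))" by (simp add: Let_def)
        ultimately show ?thesis by (intro disjI2 bexI)
      qed (simp add: Let_def)
    next
      case 2
      from Cons.IH[OF 2(1)] show ?thesis
      proof
        assume "T' \<in> set (subseqs zs)"
        then show ?thesis using 2(2) by (simp add: Let_def)
      next
        assume "\<exists>S'\<in>set (subseqs zs). T' = S' @ [v]"
        then obtain S' where S': "S' \<in> set (subseqs zs)" "T' = S' @ [v]" by (elim bexE)
        then have "z # S' \<in> set (subseqs (z # zs))" by (simp add: Let_def)
        then show ?thesis using S'(2) 2(2) by (intro disjI2 bexI[of _ "z # S'"]) simp_all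
      qed
    qed
  qed auto
  then show ?thesis
  proof
    assume S: "S \<in> set (subseqs us)"
    obtain S' b where "S = S' @ [b]" using assms(2) by (metis rev_exhaust)
    then show ?thesis using sub[OF S] by (intro that[of S' b]) auto
  next
    assume "\<exists>S'\<in>set (subseqs us). S = S' @ [v]"
    then show ?thesis using sub that by blast
  qed
qed

lemma solves_mono: "solves A E w F \<Longrightarrow> E' \<subseteq> E \<Longrightarrow> solves A E' w F"
  unfolding solves_def using test_function_mono by blast

lemma sqnorm_test_cs:
  assumes f: "sq_integrable f" and t: "test_function B \<phi>" and B: "B \<in> sets borel"
  shows "(LINT X|lborel. f X * \<phi> X)\<^sup>2 \<le> sqnorm B f * (LINT X|lborel. (\<phi> X)\<^sup>2)"
proof -
  have "(LINT X|lborel. f X * \<phi> X) = (LINT X|lborel. (indicator B X * f X) * \<phi> X)"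
    by (rule Bochner_Integration.integral_cong) (use test_function_zero[OF t] in \<open>auto simp: indicator_def\<close>)
  then show ?thesis
    using cauchy_schwarz_sq[OF sq_indicator[OF f B] test_function_sq(1)[OF t]]
    by (simp add: sqnorm_def power_mult_distrib indicator_power2)
qed

lemma vec_sq_diff_quots: "vec_sq_integrable F \<Longrightarrow> vec_sq_integrable (diff_quots ps F)"
  by (induction ps arbitrary: F) (auto simp: vec_sq_diff_quot)

lemma flux_diff_quots:
  "(\<And>p. p \<in> set ps \<Longrightarrow> snd (fst p) = 0) \<Longrightarrow> flux A (diff_quots ps F) i = diff_quots ps (flux A F i)"
  by (induction ps arbitrary: F) (auto simp: flux_diff_quot)

lemma energy_mono:
  assumes "vec_sq_integrable F" "B \<subseteq> B'" "B' \<in> sets borel" shows "energy B F \<le> energy B' F"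
  unfolding energy_def using assms by (intro sum_mono sqnorm_mono_set) (auto simp: vec_sq_integrable_def)

lemma Basis_eq_range_coord_dir: "Basis = range (coord_dir :: 'n::finite option \<Rightarrow> 'n point)"
proof -
  have "range (coord_dir :: 'n option \<Rightarrow> 'n point) = insert (coord_dir None) ((\<lambda>j. coord_dir (Some j)) ` UNIV)"
    unfolding UNIV_option_conv by (simp add: image_image)
  then show ?thesis
    by (auto simp: Basis_prod_def Basis_vec_def coord_dir_def axis_eq_axis)
qed

lemma inj_coord_dir: "inj (coord_dir :: 'n::finite option \<Rightarrow> 'n point)"
  by (rule injI) (auto simp: coord_dir_def axis_eq_axis split: option.splits)

text \<open>
  The energy inequality is assumed with a constant \<open>\<kappa>\<close>, to make visible that all later constants
  depend on \<open>\<kappa>\<close>, on \<open>L / \<nu>\<close> and on the dimension only.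
\<close>

locale layered =
  fixes A :: "real \<Rightarrow> real ^ 'n::finite option ^ 'n option" and \<nu> L \<kappa> :: real
  assumes ell: "elliptic \<nu> L A" and \<nu>: "0 < \<nu>" and L: "0 < L" and \<kappa>: "1 \<le> \<kappa>"
    and cacc: "\<And>X0 \<rho> w F. 0 < \<rho> \<Longrightarrow> solves A (ball X0 \<rho>) w F \<Longrightarrow>
        energy (ball X0 (\<rho> / 4)) F \<le> \<kappa> / \<rho>\<^sup>2 * sqnorm (ball X0 \<rho>) w"
begin

lemma sqnorm_diff_quot_le_energy:
  assumes s: "solves A (ball X0 \<rho>) w F" and h: "h \<noteq> 0" "r + \<bar>h\<bar> < \<rho>"
  shows "sqnorm (ball X0 r) (diff_quot (coord_dir i) h w) \<le> energy (ball X0 \<rho>) F"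
proof -
  have F: "sq_integrable (\<lambda>X. F X $ i)" and w: "sq_integrable w" "integrable lborel w" using s by (auto simp: solves_def vec_sq_integrable_def)
  have "sqnorm (ball X0 r) (diff_quot (coord_dir i) h w) \<le> sqnorm (ball X0 \<rho>) (\<lambda>X. F X $ i)"
  proof (rule diff_quot_l2_bound[OF w norm_coord_dir _ h])
    fix \<phi> assume t: "test_function (ball X0 \<rho>) \<phi>"
    have "(LINT X|lborel. w X * dd \<phi> (coord_dir i) X) = - (LINT X|lborel. F X $ i * \<phi> X)"
      using s t by (simp add: solves_def)
    then show "(LINT X|lborel. w X * dd \<phi> (coord_dir i) X)\<^sup>2 \<le> sqnorm (ball X0 \<rho>) (\<lambda>X. F X $ i) * (LINT X|lborel. (\<phi> X)\<^sup>2)"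
      using sqnorm_test_cs[OF F t] by simp
  qed simp
  also have "\<dots> \<le> energy (ball X0 \<rho>) F" by (rule sqnorm_le_energy)
  finally show ?thesis .
qed

text \<open>
  The difference quotient is a solution itself, and its \<open>L\<^sup>2\<close> norm is bounded by the energy of the
  original solution; apply the energy inequality to it.
\<close>

lemma diff_quot_energy:
  assumes s: "solves A (ball X0 \<rho>) w F" and \<rho>: "0 < \<rho>" and h: "h \<noteq> 0" "\<bar>h\<bar> < \<rho> / 2"
  shows "solves A (ball X0 (\<rho> / 8)) (diff_quot (coord_dir (Some j)) h w) (diff_quot (coord_dir (Some j)) h F)"
    "energy (ball X0 (\<rho> / 8)) (diff_quot (coord_dir (Some j)) h F) \<le> 4 * \<kappa> / \<rho>\<^sup>2 * energy (ball X0 \<rho>) F"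
proof -
  have s2: "solves A (ball X0 (\<rho> / 2)) (diff_quot (coord_dir (Some j)) h w) (diff_quot (coord_dir (Some j)) h F)"
    by (rule diff_quot_solves[OF ell \<nu> L s snd_coord_dir_Some norm_coord_dir]) (use h in simp)
  show "solves A (ball X0 (\<rho> / 8)) (diff_quot (coord_dir (Some j)) h w) (diff_quot (coord_dir (Some j)) h F)"
    by (rule solves_mono[OF s2]) (use \<rho> in \<open>auto intro: subset_ball\<close>)
  have "energy (ball X0 (\<rho> / 8)) (diff_quot (coord_dir (Some j)) h F) \<le>
      \<kappa> / (\<rho> / 2)\<^sup>2 * sqnorm (ball X0 (\<rho> / 2)) (diff_quot (coord_dir (Some j)) h w)"
    using cacc[OF _ s2] \<rho> by simp
  also have "\<dots> \<le> \<kappa> / (\<rho> / 2)\<^sup>2 * energy (ball X0 \<rho>) F"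
    by (intro mult_left_mono sqnorm_diff_quot_le_energy[OF s]) (use h \<kappa> in auto)
  finally show "energy (ball X0 (\<rho> / 8)) (diff_quot (coord_dir (Some j)) h F) \<le> 4 * \<kappa> / \<rho>\<^sup>2 * energy (ball X0 \<rho>) F"
    by (simp add: power_divide mult.commute)
qed

definition horizontal :: "real \<Rightarrow> ('n point \<times> real) list \<Rightarrow> bool"
  where "horizontal d ps \<longleftrightarrow> (\<forall>p\<in>set ps. fst p \<in> range (\<lambda>j. coord_dir (Some j)) \<and> snd p \<noteq> 0 \<and> \<bar>snd p\<bar> < d)"

text \<open>
  Each step shrinks the radius by the factor \<open>8\<close>. The power \<open>64 ^ length ps\<close> is a crude common bound
  for the factors \<open>64\<close> that the shrinking radii contribute.
\<close>

lemma diff_quots_energy: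
  assumes "solves A (ball X0 \<rho>) w F" "0 < \<rho>" "horizontal (\<rho> / (2 * 8 ^ length ps)) ps"
  shows "solves A (ball X0 (\<rho> / 8 ^ length ps)) (diff_quots ps w) (diff_quots ps F) \<and>
    energy (ball X0 (\<rho> / 8 ^ length ps)) (diff_quots ps F) \<le>
      (4 * \<kappa> * 64 ^ length ps / \<rho>\<^sup>2) ^ length ps * energy (ball X0 \<rho>) F"
  using assms
proof (induction ps arbitrary: w F \<rho>)
  case (Cons p ps)
  define m where "m = length ps"
  obtain j where j: "fst p = coord_dir (Some j)" using Cons.prems(3) by (auto simp: horizontal_def)
  have h: "snd p \<noteq> 0" "\<bar>snd p\<bar> < \<rho> / (2 * 8 ^ Suc m)" using Cons.prems(3) by (auto simp: horizontal_def m_def)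
  have "\<rho> / (2 * 8 ^ Suc m) \<le> \<rho> / 2"
    using Cons.prems(2) one_le_power[of "8 :: real" "Suc m"] by (intro divide_left_mono) auto
  then have h2: "\<bar>snd p\<bar> < \<rho> / 2" using h(2) by linarith
  note st = diff_quot_energy[OF Cons.prems(1,2) h(1) h2, of j, folded j]
  have hor: "horizontal (\<rho> / 8 / (2 * 8 ^ length ps)) ps"
    using Cons.prems(3) by (auto simp: horizontal_def)
  note IH = Cons.IH[OF st(1) _ hor]
  have "energy (ball X0 (\<rho> / 8 ^ Suc m)) (diff_quots (p # ps) F) \<le>
      (4 * \<kappa> * 64 ^ m / (\<rho> / 8)\<^sup>2) ^ m * energy (ball X0 (\<rho> / 8)) (diff_quot (fst p) (snd p) F)"
    using IH Cons.prems(2) by (simp add: m_def)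
  also have "(4 * \<kappa> * 64 ^ m / (\<rho> / 8)\<^sup>2) = 4 * \<kappa> * 64 ^ Suc m / \<rho>\<^sup>2"
    by (simp add: power_divide)
  also have "(4 * \<kappa> * 64 ^ Suc m / \<rho>\<^sup>2) ^ m * energy (ball X0 (\<rho> / 8)) (diff_quot (fst p) (snd p) F) \<le>
     (4 * \<kappa> * 64 ^ Suc m / \<rho>\<^sup>2) ^ m * ((4 * \<kappa> * 64 ^ Suc m / \<rho>\<^sup>2) * energy (ball X0 \<rho>) F)"
  proof (intro mult_left_mono order_trans[OF st(2)] mult_right_mono)
    have "1 \<le> (64::real) ^ Suc m" by (rule one_le_power) simp
    then have "4 * \<kappa> * 1 \<le> 4 * \<kappa> * 64 ^ Suc m" using \<kappa> by (intro mult_left_mono) auto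
    then show "4 * \<kappa> / \<rho>\<^sup>2 \<le> 4 * \<kappa> * 64 ^ Suc m / \<rho>\<^sup>2" by (intro divide_right_mono) auto
  qed (use \<kappa> in auto)
  finally have "energy (ball X0 (\<rho> / 8 ^ Suc m)) (diff_quots (p # ps) F) \<le>
     (4 * \<kappa> * 64 ^ Suc m / \<rho>\<^sup>2) ^ Suc m * energy (ball X0 \<rho>) F" by (simp add: mult.assoc mult.left_commute)
  moreover have "solves A (ball X0 (\<rho> / 8 ^ Suc m)) (diff_quots (p # ps) w) (diff_quots (p # ps) F)"
    using IH Cons.prems(2) by (simp add: m_def)
  ultimately show ?case by (simp only: length_Cons m_def)
qed auto

end

lemma sqnorm_flux_le:
  assumes A: "elliptic \<nu> L A" "0 < \<nu>" "0 < L" and F: "vec_sq_integrable F" and B: "B \<in> sets borel"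
  shows "sqnorm B (flux A F i) \<le> L\<^sup>2 * energy B F"
proof -
  have i: "integrable lborel (\<lambda>X. indicator B X * (F X $ i)\<^sup>2)" for i
    using F B by (intro sqnorm_integrable) (auto simp: vec_sq_integrable_def)
  define S where "S X = (\<Sum>i\<in>UNIV. indicator B X * (F X $ i)\<^sup>2)" for X
  have S: "integrable lborel S" "(LINT X|lborel. S X) = energy B F"
    unfolding S_def[abs_def] energy_def sqnorm_def
    by (rule Bochner_Integration.integrable_sum[OF i]) (rule Bochner_Integration.integral_sum[OF i])
  have S': "S X = indicator B X * (norm (F X))\<^sup>2" for X
    unfolding S_def norm_vec_square by (rule sum_distrib_left[symmetric])
  have "sqnorm B (flux A F i) \<le> (LINT X|lborel. L\<^sup>2 * S X)"
    unfolding sqnorm_def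
  proof (rule integral_le_of_dominated)
    show "integrable lborel (\<lambda>X. L\<^sup>2 * S X)" using S(1) by simp
    fix X
    show "0 \<le> L\<^sup>2 * S X" by (simp add: S')
    have "\<bar>flux A F i X\<bar> \<le> norm (A (snd X) *v F X)" unfolding flux_def by (rule component_le_norm_cart)
    also have "\<dots> \<le> L * norm (F X)" by (rule elliptic_norm_le[OF A])
    finally have "\<bar>flux A F i X\<bar>\<^sup>2 \<le> (L * norm (F X))\<^sup>2" by (intro power_mono) auto
    then show "indicator B X * (flux A F i X)\<^sup>2 \<le> L\<^sup>2 * S X"
      by (cases "X \<in> B") (auto simp: S' power_mult_distrib)
  qed
  then show ?thesis using S by simp
qed

text \<open>
  The equation itself: \<open>\<partial>\<^sub>y\<close> of the vertical flux is minus the sum of the horizontal derivatives of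
  the horizontal fluxes, and these are controlled by the horizontal difference quotients of \<open>F\<close>.
\<close>

lemma vertical_dual_bound:
  assumes A: "elliptic \<nu> L A" "0 < \<nu>" "0 < L" and s: "solves A (ball X0 R) w F" and "0 < \<delta>"
    and bound: "\<And>j h. h \<noteq> 0 \<Longrightarrow> \<bar>h\<bar> < \<delta> \<Longrightarrow> energy (ball X0 R) (diff_quot (coord_dir (Some j)) h F) \<le> C"
    and t: "test_function (ball X0 R) (\<phi> :: 'n::finite point \<Rightarrow> real)"
  shows "(LINT X|lborel. flux A F None X * dd \<phi> (coord_dir None) X)\<^sup>2 \<le>
     (real CARD('n))\<^sup>2 * L\<^sup>2 * C * (LINT X|lborel. (\<phi> X)\<^sup>2)"
proof -
  have vF: "vec_sq_integrable F" using s by (simp add: solves_def)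
  define u where "u j = (LINT X|lborel. flux A F (Some j) X * dd \<phi> (coord_dir (Some j)) X)" for j
  have u: "(u j)\<^sup>2 \<le> L\<^sup>2 * C * (LINT X|lborel. (\<phi> X)\<^sup>2)" for j
    unfolding u_def
  proof (rule dual_bound_of_diff_quot[OF flux_sq[OF A vF] \<open>0 < \<delta>\<close> _ t])
    fix h :: real assume h: "0 < \<bar>h\<bar>" "\<bar>h\<bar> < \<delta>"
    have "sqnorm (ball X0 R) (diff_quot (coord_dir (Some j)) h (flux A F (Some j))) \<le>
       L\<^sup>2 * energy (ball X0 R) (diff_quot (coord_dir (Some j)) h F)"
      unfolding flux_diff_quot[OF snd_coord_dir_Some, symmetric]
      by (rule sqnorm_flux_le[OF A vec_sq_diff_quot[OF vF]]) simp
    also have "\<dots> \<le> L\<^sup>2 * C" using h by (intro mult_left_mono bound) auto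
    finally show "sqnorm (ball X0 R) (diff_quot (coord_dir (Some j)) h (flux A F (Some j))) \<le> L\<^sup>2 * C" .
  qed
  have split: "(\<Sum>i\<in>UNIV. g i) = g None + (\<Sum>j\<in>UNIV. g (Some j))" for g :: "'n option \<Rightarrow> real"
    by (simp add: UNIV_option_conv sum.reindex)
  have "(LINT X|lborel. flux A F None X * dd \<phi> (coord_dir None) X) = - (\<Sum>j\<in>UNIV. u j)"
    using s t split[of "\<lambda>i. LINT X|lborel. flux A F i X * dd \<phi> (coord_dir i) X"]
    by (simp add: solves_def u_def)
  then have eq: "\<bar>LINT X|lborel. flux A F None X * dd \<phi> (coord_dir None) X\<bar> = \<bar>\<Sum>j\<in>UNIV. u j\<bar>" by simp
  have le: "\<bar>\<Sum>j\<in>UNIV. u j\<bar> \<le> real CARD('n) * sqrt (L\<^sup>2 * C * (LINT X|lborel. (\<phi> X)\<^sup>2))"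
  proof -
    have "\<bar>\<Sum>j\<in>UNIV. u j\<bar> \<le> (\<Sum>j\<in>UNIV. \<bar>u j\<bar>)" by (rule sum_abs)
    also have "\<dots> \<le> (\<Sum>j\<in>(UNIV::'n set). sqrt (L\<^sup>2 * C * (LINT X|lborel. (\<phi> X)\<^sup>2)))"
    proof (rule sum_mono)
      show "\<bar>u j\<bar> \<le> sqrt (L\<^sup>2 * C * (LINT X|lborel. (\<phi> X)\<^sup>2))" for j
        using real_sqrt_le_mono[OF u[of j]] by (simp only: real_sqrt_abs)
    qed
    finally show ?thesis by simp
  qed
  have pos: "0 \<le> L\<^sup>2 * C * (LINT X|lborel. (\<phi> X)\<^sup>2)"
    by (rule order_trans[OF zero_le_power2 u])
  have "(LINT X|lborel. flux A F None X * dd \<phi> (coord_dir None) X)\<^sup>2 \<le>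
      (real CARD('n) * sqrt (L\<^sup>2 * C * (LINT X|lborel. (\<phi> X)\<^sup>2)))\<^sup>2"
    using power_mono[OF le[folded eq], of 2] by simp
  also have "\<dots> = (real CARD('n))\<^sup>2 * (L\<^sup>2 * C * (LINT X|lborel. (\<phi> X)\<^sup>2))"
    unfolding power_mult_distrib real_sqrt_pow2[OF pos] ..
  finally show ?thesis by (simp only: mult.assoc)
qed

section \<open>The interior gradient bound\<close>

lemma DIM_point: "DIM('n::finite point) = Suc CARD('n)"
  by simp

definition sobolev_const :: "'n::finite itself \<Rightarrow> real"
  where "sobolev_const _ = (64 * (real (Suc CARD('n)))\<^sup>2) ^ Suc CARD('n) * measure lborel (ball (0 :: 'n point) 1)"

lemma sobolev_const_nonneg: "0 \<le> sobolev_const TYPE('n::finite)"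
  by (simp add: sobolev_const_def)

text \<open>
  The inequality \<open>discrete_sobolev\<close> for the list of directions that has the vertical one at the end,
  with grid length \<open>l = R / (4 d)\<close>, \<open>d\<close> being the dimension.
\<close>

lemma layered_sobolev:
  fixes f :: "'n::finite point \<Rightarrow> real"
  assumes f: "sq_integrable f" "integrable lborel f" and R: "0 < R"
    and base: "sqnorm (ball X0 R) f \<le> K"
    and step: "\<And>T i h. set T \<subseteq> range (\<lambda>j. coord_dir (Some j)) \<Longrightarrow> length T \<le> CARD('n) \<Longrightarrow> 0 < h \<Longrightarrow> h < R / 2 \<Longrightarrow>
       R ^ (2 * Suc (length T)) * sqnorm (ball X0 R) (diff_quot (coord_dir i) h (diff_quots (map (\<lambda>b. (b, h)) T) f)) \<le> K"
  shows "AE X in lborel. X \<in> ball X0 (R / 2) \<longrightarrow> (f X)\<^sup>2 \<le> sobolev_const TYPE('n) / R ^ Suc CARD('n) * K"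
proof -
  let ?m = "Suc CARD('n)"
  define l where "l = R / (4 * real ?m)"
  have l: "0 < l" "l \<le> R" using R by (auto simp: l_def field_simps)
  obtain xs where xs: "set xs = (UNIV :: 'n set)" "distinct xs" using finite_distinct_list[of "UNIV :: 'n set"] by auto
  define us where "us = map (\<lambda>j. coord_dir (Some j) :: 'n point) xs"
  define bs where "bs = us @ [coord_dir None]"
  have set_us: "set us = range (\<lambda>j. coord_dir (Some j))" using xs by (simp add: us_def)
  have len_us: "length us = CARD('n)" using distinct_card[OF xs(2)] xs(1) by (simp add: us_def)
  have inj: "coord_dir i = (coord_dir j :: 'n point) \<longleftrightarrow> i = j" for i j using inj_coord_dir by (auto simp: inj_def)
  have dist: "distinct bs"
    using xs by (auto simp: bs_def us_def distinct_map inj_on_def inj)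
  have set_bs: "set bs = Basis"
    unfolding Basis_eq_range_coord_dir by (auto simp: bs_def set_us UNIV_option_conv)
  have K: "0 \<le> K" by (rule order_trans[OF sqnorm_nonneg base])
  have "AE X in lborel. X \<in> ball X0 (R / 2) \<longrightarrow>
     (f X)\<^sup>2 \<le> (4 / l\<^sup>2) ^ DIM('n point) * (measure lborel (ball X0 R) * K)"
  proof (rule discrete_sobolev[OF f dist set_bs l(1)])
    show "R / 2 + 2 * real DIM('n point) * l \<le> R" unfolding DIM_point l_def using R by (simp add: field_simps)
    show "0 < R / 2" using R by simp
    fix h :: real and S assume h: "0 < h" "h < R / 2" and S: "S \<in> set (subseqs bs)"
    show "l ^ (2 * length S) * sqnorm (ball X0 R) (diff_quots (map (\<lambda>b. (b, h)) S) f) \<le> K"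
    proof (cases "S = []")
      case True then show ?thesis using base by simp
    next
      case False
      from subseqs_snocE[OF S[unfolded bs_def] False] obtain T b where
        T: "S = T @ [b]" "set T \<subseteq> set us" "b \<in> insert (coord_dir None) (set us)" "length T \<le> length us" .
      obtain i where i: "b = coord_dir i" using T(3) by (auto simp: set_us)
      have "l ^ (2 * length S) * sqnorm (ball X0 R) (diff_quots (map (\<lambda>b. (b, h)) S) f) \<le>
        R ^ (2 * length S) * sqnorm (ball X0 R) (diff_quots (map (\<lambda>b. (b, h)) S) f)"
        using l by (intro mult_right_mono power_mono) auto
      also have "\<dots> \<le> K"
        using step[of T h i] T h by (simp add: i diff_quots_append set_us len_us)
      finally show ?thesis .
    qed
  qed
  moreover have "(4 / l\<^sup>2) ^ DIM('n point) * (measure lborel (ball X0 R) * K) = sobolev_const TYPE('n) / R ^ ?m * K"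
  proof -
    define m where "m = Suc CARD('n)"
    define \<omega> where "\<omega> = measure lborel (ball (0 :: 'n point) 1)"
    have e1: "measure lborel (ball X0 R) = R ^ m * \<omega>"
      using content_ball_conv_unit_ball[of R X0] R by (simp add: m_def \<omega>_def)
    have "l = R / (4 * real m)" by (simp only: l_def m_def)
    then have e2: "4 / l\<^sup>2 = 64 * (real m)\<^sup>2 / R\<^sup>2" by (simp add: power_divide power_mult_distrib)
    have e3: "(R\<^sup>2) ^ m = R ^ m * R ^ m" by (simp add: power_mult_distrib power2_eq_square)
    have "(4 / l\<^sup>2) ^ m * (measure lborel (ball X0 R) * K) = (64 * (real m)\<^sup>2) ^ m / (R ^ m * R ^ m) * (R ^ m * \<omega> * K)"
      unfolding e1 e2 power_divide e3 ..
    also have "\<dots> = (64 * (real m)\<^sup>2) ^ m * \<omega> / R ^ m * K" using R by simp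
    finally show ?thesis unfolding DIM_point sobolev_const_def m_def[symmetric] \<omega>_def[symmetric] .
  qed
  ultimately show ?thesis by simp
qed

context layered
begin

text \<open>
  At most \<open>CARD('n) + 1\<close> difference quotients are taken, each at the price of a factor \<open>8\<close>. One more
  factor leaves room for the steps.
\<close>

definition inner_radius :: "real \<Rightarrow> real"
  where "inner_radius \<rho> = \<rho> / 8 ^ (CARD('n) + 2)"

definition energy_const :: real
  where "energy_const = (4 * \<kappa> * 64 ^ Suc CARD('n)) ^ Suc CARD('n)"

lemma energy_const_ge_1: "1 \<le> energy_const"
proof -
  have "1 * 1 \<le> 4 * \<kappa> * 64 ^ Suc CARD('n)" using \<kappa> one_le_power[of "64 :: real" "Suc CARD('n)"] by (intro mult_mono) auto
  then show ?thesis unfolding energy_const_def by (intro one_le_power) simp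
qed

text \<open>
  The powers of the radius in the Sobolev inequality cancel those in \<open>diff_quots_energy\<close>, leaving a
  bound independent of the radius.
\<close>

lemma power_le_energy_const:
  assumes "0 < r" "r \<le> \<rho>" "k \<le> Suc CARD('n)"
  shows "r ^ (2 * k) * (4 * \<kappa> * 64 ^ k / \<rho>\<^sup>2) ^ k \<le> energy_const"
proof -
  have \<rho>: "0 < \<rho>" using assms by simp
  have "r ^ (2 * k) * (4 * \<kappa> * 64 ^ k / \<rho>\<^sup>2) ^ k = (r\<^sup>2 * (4 * \<kappa> * 64 ^ k / \<rho>\<^sup>2)) ^ k"
    by (simp only: power_mult power_mult_distrib)
  also have "\<dots> \<le> (4 * \<kappa> * 64 ^ Suc CARD('n)) ^ k"
  proof (rule power_mono)
    have "r\<^sup>2 * (4 * \<kappa> * 64 ^ k / \<rho>\<^sup>2) \<le> \<rho>\<^sup>2 * (4 * \<kappa> * 64 ^ k / \<rho>\<^sup>2)"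
      using assms \<kappa> by (intro mult_right_mono power_mono) auto
    also have "\<dots> = 4 * \<kappa> * 64 ^ k" using \<rho> by simp
    also have "\<dots> \<le> 4 * \<kappa> * 64 ^ Suc CARD('n)" using assms(3) \<kappa> by (intro mult_left_mono power_increasing) auto
    finally show "r\<^sup>2 * (4 * \<kappa> * 64 ^ k / \<rho>\<^sup>2) \<le> 4 * \<kappa> * 64 ^ Suc CARD('n)" .
    show "0 \<le> r\<^sup>2 * (4 * \<kappa> * 64 ^ k / \<rho>\<^sup>2)" using \<kappa> by simp
  qed
  also have "\<dots> \<le> energy_const" unfolding energy_const_def
  proof (rule power_increasing[OF assms(3)])
    have "1 * 1 \<le> 4 * \<kappa> * 64 ^ Suc CARD('n)" using \<kappa> one_le_power[of "64 :: real" "Suc CARD('n)"] by (intro mult_mono) auto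
    then show "1 \<le> 4 * \<kappa> * 64 ^ Suc CARD('n)" by simp
  qed
  finally show ?thesis .
qed

lemma inner_radius_bounds:
  assumes "0 < \<rho>"
  shows "0 < inner_radius \<rho>" "inner_radius \<rho> \<le> \<rho>"
    "k \<le> Suc CARD('n) \<Longrightarrow> 8 * inner_radius \<rho> \<le> \<rho> / 8 ^ k"
    "k \<le> Suc CARD('n) \<Longrightarrow> inner_radius \<rho> / 2 \<le> \<rho> / (2 * 8 ^ k)"
proof -
  show p: "0 < inner_radius \<rho>" using assms by (simp add: inner_radius_def)
  have *: "8 * inner_radius \<rho> \<le> \<rho> / 8 ^ k" if "k \<le> Suc CARD('n)" for k
  proof -
    have "8 * inner_radius \<rho> = \<rho> / 8 ^ Suc CARD('n)" by (simp add: inner_radius_def)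
    also have "\<dots> \<le> \<rho> / 8 ^ k"
      using assms that by (intro divide_left_mono power_increasing) auto
    finally show ?thesis .
  qed
  then show "k \<le> Suc CARD('n) \<Longrightarrow> 8 * inner_radius \<rho> \<le> \<rho> / 8 ^ k" .
  show "inner_radius \<rho> \<le> \<rho>" using *[of 0] p by simp
  show "k \<le> Suc CARD('n) \<Longrightarrow> inner_radius \<rho> / 2 \<le> \<rho> / (2 * 8 ^ k)"
    using *[of k] p by simp
qed

lemma horizontal_map:
  "set T \<subseteq> range (\<lambda>j. coord_dir (Some j)) \<Longrightarrow> 0 < h \<Longrightarrow> h < d \<Longrightarrow> horizontal d (map (\<lambda>b. (b, h)) T)"
  by (auto simp: horizontal_def)

text \<open>
  The Sobolev inequality bounds the difference quotients \<open>(w (X + h e\<^sub>j) - w X) / h\<close> uniformly in \<open>h\<close>.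
  Its last difference quotient may fall on \<open>y\<close>, where the energy still controls the first
  derivative. The bound passes to the weak derivative by duality.
\<close>

lemma horizontal_derivative_bound:
  assumes s: "solves A (ball X0 \<rho>) w F" and \<rho>: "0 < \<rho>"
  shows "AE X in lborel. X \<in> ball X0 (inner_radius \<rho> / 4) \<longrightarrow>
     \<bar>F X $ Some j\<bar> \<le> sqrt (sobolev_const TYPE('n) / inner_radius \<rho> ^ Suc CARD('n) * (energy_const * energy (ball X0 \<rho>) F))"
    (is "AE X in lborel. _ \<longrightarrow> _ \<le> ?M")
proof -
  let ?R = "inner_radius \<rho>" and ?E = "energy (ball X0 \<rho>) F"
  note sb = inner_radius_bounds[OF \<rho>]
  have w: "sq_integrable w" "integrable lborel w" and F: "sq_integrable (\<lambda>X. F X $ Some j)" using s by (auto simp: solves_def vec_sq_integrable_def)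
  have dqb: "AE X in lborel. X \<in> ball X0 (?R / 2) \<longrightarrow> \<bar>diff_quot (coord_dir (Some j)) h0 w X\<bar> \<le> ?M"
    if h0: "0 < \<bar>h0\<bar>" "\<bar>h0\<bar> < ?R / 2" for h0
  proof -
    let ?f = "diff_quot (coord_dir (Some j)) h0 w"
    have "AE X in lborel. X \<in> ball X0 (?R / 2) \<longrightarrow>
      (?f X)\<^sup>2 \<le> sobolev_const TYPE('n) / ?R ^ Suc CARD('n) * (energy_const * ?E)"
    proof (rule layered_sobolev[OF sq_diff_quot[OF w(1)] integrable_diff_quot[OF w(2)] sb(1)])
      have "sqnorm (ball X0 ?R) ?f \<le> ?E"
        by (rule sqnorm_diff_quot_le_energy[OF s]) (use h0 sb(1) sb(3)[of 0] in auto)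
      also have "\<dots> \<le> energy_const * ?E" using mult_right_mono[OF energy_const_ge_1, of ?E] by simp
      finally show "sqnorm (ball X0 ?R) ?f \<le> energy_const * ?E" .
      fix T i and h :: real assume T: "set T \<subseteq> range (\<lambda>j. coord_dir (Some j) :: 'n point)" "length T \<le> CARD('n)" and h: "0 < h" "h < ?R / 2"
      \<comment> \<open>the quotient in direction i is left out of this list because it may be vertical\<close>
      define ps where "ps = (coord_dir (Some j), h0) # map (\<lambda>b. (b, h)) T"
      define k where "k = length ps"
      have k: "k \<le> Suc CARD('n)" "k = Suc (length T)" using T by (auto simp: k_def ps_def)
      have "horizontal (\<rho> / (2 * 8 ^ k)) ps"
        using horizontal_map[OF T(1) h(1), of "\<rho> / (2 * 8 ^ k)"] h(2) h0 sb(4)[OF k(1)]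
        by (auto simp: ps_def horizontal_def)
      note de = diff_quots_energy[OF s \<rho> this[unfolded k_def], folded k_def]
      have "sqnorm (ball X0 ?R) (diff_quot (coord_dir i) h (diff_quots ps w)) \<le> energy (ball X0 (\<rho> / 8 ^ k)) (diff_quots ps F)"
        by (rule sqnorm_diff_quot_le_energy[OF conjunct1[OF de]]) (use h sb(1) sb(3)[OF k(1)] in auto)
      also have "\<dots> \<le> (4 * \<kappa> * 64 ^ k / \<rho>\<^sup>2) ^ k * ?E" by (rule conjunct2[OF de])
      finally have "?R ^ (2 * k) * sqnorm (ball X0 ?R) (diff_quot (coord_dir i) h (diff_quots ps w)) \<le>
        ?R ^ (2 * k) * ((4 * \<kappa> * 64 ^ k / \<rho>\<^sup>2) ^ k * ?E)" using sb(1) by (intro mult_left_mono) auto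
      also have "\<dots> \<le> energy_const * ?E"
        unfolding mult.assoc[symmetric] by (intro mult_right_mono power_le_energy_const sb k) auto
      finally show "?R ^ (2 * Suc (length T)) * sqnorm (ball X0 ?R) (diff_quot (coord_dir i) h (diff_quots (map (\<lambda>b. (b, h)) T) ?f)) \<le> energy_const * ?E"
        by (simp add: k(2) ps_def)
    qed
    then show ?thesis by eventually_elim (auto intro: real_le_rsqrt simp flip: real_sqrt_abs intro!: real_sqrt_le_mono)
  qed
  show ?thesis
  proof (rule linf_dual[OF F, where R = "?R / 2"])
    show "0 \<le> ?M" using sobolev_const_nonneg energy_const_ge_1 sb(1) by (auto intro!: mult_nonneg_nonneg divide_nonneg_nonneg)
    show "?R / 4 < ?R / 2" using sb(1) by simp
    fix \<phi> assume t: "test_function (ball X0 (?R / 2)) \<phi>"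
    have t': "test_function (ball X0 \<rho>) \<phi>"
      by (rule test_function_mono[OF t]) (use sb in \<open>auto intro!: subset_ball\<close>)
    have "\<bar>LINT X|lborel. F X $ Some j * \<phi> X\<bar> = \<bar>LINT X|lborel. w X * dd \<phi> (coord_dir (Some j)) X\<bar>"
      using s t' by (simp add: solves_def)
    also have "\<dots> \<le> ?M * (LINT X|lborel. \<bar>\<phi> X\<bar>)"
      by (rule dual_linf_bound_of_diff_quot[OF w _ dqb t, where \<delta> = "?R / 2"]) (use sb(1) in auto)
    finally show "\<bar>LINT X|lborel. F X $ Some j * \<phi> X\<bar> \<le> ?M * (LINT X|lborel. \<bar>\<phi> X\<bar>)" .
  qed
qed

text \<open>
  Horizontal difference quotients commute with the formation of the flux. A vertical one, which can
  only be the last, is bounded by \<open>vertical_dual_bound\<close>.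
\<close>

lemma vertical_flux_bound:
  assumes s: "solves A (ball X0 \<rho>) w F" and \<rho>: "0 < \<rho>"
  shows "AE X in lborel. X \<in> ball X0 (inner_radius \<rho> / 2) \<longrightarrow>
     \<bar>flux A F None X\<bar> \<le> real CARD('n) * L *
       sqrt (sobolev_const TYPE('n) / inner_radius \<rho> ^ Suc CARD('n) * (energy_const * energy (ball X0 \<rho>) F))"
    (is "AE X in lborel. _ \<longrightarrow> _ \<le> _ * _ * sqrt (?S * _)")
proof -
  let ?R = "inner_radius \<rho>" and ?E = "energy (ball X0 \<rho>) F" and ?n = "real CARD('n)"
  note sb = inner_radius_bounds[OF \<rho>]
  have vF: "vec_sq_integrable F" using s by (simp add: solves_def)
  note A = ell \<nu> L
  have n1: "1 \<le> ?n" by simp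
  have n2: "1 \<le> ?n\<^sup>2" using one_le_power[OF n1] .
  have "AE X in lborel. X \<in> ball X0 (?R / 2) \<longrightarrow> (flux A F None X)\<^sup>2 \<le> ?S * (?n\<^sup>2 * L\<^sup>2 * (energy_const * ?E))"
  proof (rule layered_sobolev[OF flux_sq[OF A vF] sb(1)])
    have "sqnorm (ball X0 ?R) (flux A F None) \<le> L\<^sup>2 * energy (ball X0 ?R) F"
      by (rule sqnorm_flux_le[OF A vF]) simp
    also have "\<dots> \<le> L\<^sup>2 * (1 * ?E)"
      using energy_mono[OF vF subset_ball[OF sb(2)], of X0] by (intro mult_left_mono) auto
    also have "\<dots> \<le> (?n\<^sup>2 * L\<^sup>2) * (energy_const * ?E)"
      using n2 energy_const_ge_1 mult_right_mono[OF n2, of "L\<^sup>2"] by (intro mult_mono) auto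
    finally show "sqnorm (ball X0 ?R) (flux A F None) \<le> ?n\<^sup>2 * L\<^sup>2 * (energy_const * ?E)" .
    fix T i and h :: real assume T: "set T \<subseteq> range (\<lambda>j. coord_dir (Some j) :: 'n point)" "length T \<le> CARD('n)" and h: "0 < h" "h < ?R / 2"
    define ps where "ps = map (\<lambda>b. (b, h)) T"
    define k where "k = Suc (length ps)"
    have k: "k \<le> Suc CARD('n)" "k = Suc (length T)" using T by (auto simp: k_def ps_def)
    let ?C = "(4 * \<kappa> * 64 ^ k / \<rho>\<^sup>2) ^ k * ?E"
    have hps: "horizontal (\<rho> / (2 * 8 ^ k)) ps"
      unfolding ps_def by (rule horizontal_map[OF T(1) h(1)]) (use h sb(4)[OF k(1)] in auto)
    have ext: "energy (ball X0 (\<rho> / 8 ^ k)) (diff_quot (coord_dir (Some j)) h' (diff_quots ps F)) \<le> ?C"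
      if h': "h' \<noteq> 0" "\<bar>h'\<bar> < ?R / 2" for j h'
    proof -
      have "horizontal (\<rho> / (2 * 8 ^ k)) (ps @ [(coord_dir (Some j), h')])"
        using hps h' sb(4)[OF k(1)] by (auto simp: horizontal_def)
      then have "horizontal (\<rho> / (2 * 8 ^ length (ps @ [(coord_dir (Some j), h')]))) (ps @ [(coord_dir (Some j), h')])"
        by (simp add: k_def)
      from conjunct2[OF diff_quots_energy[OF s \<rho> this]] show ?thesis by (simp add: k_def diff_quots_append)
    qed
    have hps': "horizontal (\<rho> / (2 * 8 ^ length ps)) ps"
      unfolding ps_def by (rule horizontal_map[OF T(1) h(1)]) (use h sb(4)[of "length T"] T in auto)
    have s': "solves A (ball X0 (\<rho> / 8 ^ k)) (diff_quots ps w) (diff_quots ps F)"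
      by (rule solves_mono[OF conjunct1[OF diff_quots_energy[OF s \<rho> hps']]])
         (use \<rho> in \<open>auto simp: k_def intro!: subset_ball divide_left_mono\<close>)
    have vF': "vec_sq_integrable (diff_quots ps F)" by (rule vec_sq_diff_quots[OF vF])
    have fl: "flux A (diff_quots ps F) None = diff_quots ps (flux A F None)"
    proof (rule flux_diff_quots)
      fix p assume "p \<in> set ps"
      then have "fst p \<in> set T" by (auto simp: ps_def)
      then obtain j where "fst p = coord_dir (Some j)" using T(1) by blast
      then show "snd (fst p) = 0" by (simp only: snd_coord_dir_Some)
    qed
    have C0: "0 \<le> ?C" using \<kappa> by simp
    have "sqnorm (ball X0 ?R) (diff_quot (coord_dir i) h (flux A (diff_quots ps F) None)) \<le> ?n\<^sup>2 * L\<^sup>2 * ?C"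
    proof (cases i)
      case (Some j)
      have "sqnorm (ball X0 ?R) (diff_quot (coord_dir i) h (flux A (diff_quots ps F) None)) \<le>
         L\<^sup>2 * energy (ball X0 ?R) (diff_quot (coord_dir (Some j)) h (diff_quots ps F))"
        unfolding Some flux_diff_quot[OF snd_coord_dir_Some, symmetric]
        by (rule sqnorm_flux_le[OF A vec_sq_diff_quot[OF vF']]) simp
      also have "\<dots> \<le> L\<^sup>2 * energy (ball X0 (\<rho> / 8 ^ k)) (diff_quot (coord_dir (Some j)) h (diff_quots ps F))"
        using sb(1) sb(3)[OF k(1)] by (intro mult_left_mono energy_mono vec_sq_diff_quot vF' subset_ball) auto
      also have "\<dots> \<le> L\<^sup>2 * ?C" using h by (intro mult_left_mono ext) auto
      also have "\<dots> \<le> ?n\<^sup>2 * L\<^sup>2 * ?C" using n2 C0 mult_right_mono[OF n2, of "L\<^sup>2"] by (intro mult_right_mono) auto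
      finally show ?thesis .
    next
      case None
      show ?thesis unfolding None
      proof (rule diff_quot_l2_bound[OF flux_sq[OF A vF'] norm_coord_dir, where R = "\<rho> / 8 ^ k"])
        show "0 \<le> ?n\<^sup>2 * L\<^sup>2 * ?C" using C0 by simp
        show "h \<noteq> 0" "?R + \<bar>h\<bar> < \<rho> / 8 ^ k" using h sb(1) sb(3)[OF k(1)] by auto
        fix \<phi> :: "'n point \<Rightarrow> real" assume t: "test_function (ball X0 (\<rho> / 8 ^ k)) \<phi>"
        show "(LINT X|lborel. flux A (diff_quots ps F) None X * dd \<phi> (coord_dir None) X)\<^sup>2 \<le>
          ?n\<^sup>2 * L\<^sup>2 * ?C * (LINT X|lborel. (\<phi> X)\<^sup>2)"
          by (rule vertical_dual_bound[OF A s' _ ext t, where \<delta> = "?R / 2"]) (use sb(1) in auto)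
      qed
    qed
    then have "?R ^ (2 * k) * sqnorm (ball X0 ?R) (diff_quot (coord_dir i) h (diff_quots ps (flux A F None))) \<le>
      ?R ^ (2 * k) * (?n\<^sup>2 * L\<^sup>2 * ?C)" unfolding fl using sb(1) by (intro mult_left_mono) auto
    also have "\<dots> = ?n\<^sup>2 * L\<^sup>2 * (?R ^ (2 * k) * (4 * \<kappa> * 64 ^ k / \<rho>\<^sup>2) ^ k * ?E)" by (simp only: mult_ac)
    also have "\<dots> \<le> ?n\<^sup>2 * L\<^sup>2 * (energy_const * ?E)"
      by (intro mult_left_mono mult_right_mono power_le_energy_const sb k) auto
    finally show "?R ^ (2 * Suc (length T)) * sqnorm (ball X0 ?R) (diff_quot (coord_dir i) h (diff_quots (map (\<lambda>b. (b, h)) T) (flux A F None))) \<le>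
        ?n\<^sup>2 * L\<^sup>2 * (energy_const * ?E)"
      by (simp only: k(2) ps_def)
  qed
  then show ?thesis
  proof eventually_elim
    case (elim X)
    show ?case
    proof
      assume "X \<in> ball X0 (?R / 2)"
      with elim have "(flux A F None X)\<^sup>2 \<le> (?n * L)\<^sup>2 * (?S * (energy_const * ?E))"
        by (simp add: power_mult_distrib mult_ac)
      then have "\<bar>flux A F None X\<bar> \<le> sqrt ((?n * L)\<^sup>2 * (?S * (energy_const * ?E)))"
        by (metis real_sqrt_abs real_sqrt_le_mono)
      moreover have "sqrt ((?n * L)\<^sup>2 * Y) = ?n * L * sqrt Y" for Y
        using L by (simp add: real_sqrt_mult)
      ultimately show "\<bar>flux A F None X\<bar> \<le> ?n * L * sqrt (?S * (energy_const * ?E))"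
        by (simp only:)
    qed
  qed
qed

text \<open>
  Solve \<open>U = A\<^sub>y\<^sub>y \<partial>\<^sub>y w + \<Sum>\<^sub>j A\<^sub>y\<^sub>j \<partial>\<^sub>j w\<close> for \<open>\<partial>\<^sub>y w\<close>, using \<open>A\<^sub>y\<^sub>y \<ge> \<nu>\<close>.
\<close>

lemma gradient_bound:
  assumes s: "solves A (ball X0 \<rho>) w F" and \<rho>: "0 < \<rho>"
  shows "AE X in lborel. X \<in> ball X0 (inner_radius \<rho> / 4) \<longrightarrow>
     norm (F X) \<le> real CARD('n) * (1 + 2 * (L / \<nu>)) *
       sqrt (sobolev_const TYPE('n) / inner_radius \<rho> ^ Suc CARD('n) * (energy_const * energy (ball X0 \<rho>) F))"
    (is "AE X in lborel. _ \<longrightarrow> _ \<le> _ * ?M")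
proof -
  let ?n = "real CARD('n)"
  note A = ell \<nu> L
  have "AE X in lborel. \<forall>j. X \<in> ball X0 (inner_radius \<rho> / 4) \<longrightarrow> \<bar>F X $ Some j\<bar> \<le> ?M"
    using horizontal_derivative_bound[OF s \<rho>] by (intro AE_finite_allI[of UNIV, simplified]) auto
  then show ?thesis using vertical_flux_bound[OF s \<rho>]
  proof eventually_elim
    case (elim X)
    show ?case
    proof
      assume X: "X \<in> ball X0 (inner_radius \<rho> / 4)"
      then have X2: "X \<in> ball X0 (inner_radius \<rho> / 2)" using inner_radius_bounds(1)[OF \<rho>] by auto
      have h: "\<bar>F X $ Some j\<bar> \<le> ?M" for j using elim(1) X by blast
      have u: "\<bar>flux A F None X\<bar> \<le> ?n * L * ?M" using elim(2) X2 by blast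
      have M0: "0 \<le> ?M" using h abs_ge_zero order_trans by blast
      let ?y = "F X $ None" and ?a = "A (snd X) $ None"
      have split: "(\<Sum>i\<in>UNIV. g i) = g None + (\<Sum>j\<in>UNIV. g (Some j))" for g :: "'n option \<Rightarrow> real"
        by (simp add: UNIV_option_conv sum.reindex)
      have "\<nu> \<le> ?a $ None"
      proof -
        have "\<nu> * (norm (axis None 1 :: real ^ 'n option))\<^sup>2 \<le> (A (snd X) *v axis None 1) \<bullet> axis None 1"
          using ell unfolding elliptic_def by blast
        then show ?thesis by (simp add: norm_axis_1 matrix_vector_mult_basis column_def inner_axis)
      qed
      then have "\<nu> * \<bar>?y\<bar> \<le> \<bar>?a $ None * ?y\<bar>" using \<nu> by (simp add: abs_mult mult_right_mono)
      also have "?a $ None * ?y = flux A F None X - (\<Sum>j\<in>UNIV. ?a $ Some j * F X $ Some j)"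
        by (simp add: flux_sum split)
      also have "\<bar>\<dots>\<bar> \<le> ?n * L * ?M + ?n * (L * ?M)"
      proof -
        have "\<bar>\<Sum>j\<in>UNIV. ?a $ Some j * F X $ Some j\<bar> \<le> (\<Sum>j\<in>(UNIV::'n set). L * ?M)"
        proof (rule order_trans[OF sum_abs sum_mono])
          fix j
          show "\<bar>?a $ Some j * F X $ Some j\<bar> \<le> L * ?M"
            unfolding abs_mult
            by (rule mult_mono[OF elliptic_entry_le[OF A] h less_imp_le[OF L] abs_ge_zero])
        qed
        then have "\<bar>\<Sum>j\<in>UNIV. ?a $ Some j * F X $ Some j\<bar> \<le> ?n * (L * ?M)"
          by (simp only: sum_constant)
        then show ?thesis using u by linarith
      qed
      finally have "\<bar>?y\<bar> \<le> (?n * L * ?M + ?n * (L * ?M)) / \<nu>" using \<nu> by (simp add: field_simps)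
      then have y: "\<bar>?y\<bar> \<le> 2 * ?n * (L / \<nu>) * ?M" by (simp add: field_simps)
      have "norm (F X) \<le> (\<Sum>i\<in>UNIV. \<bar>F X $ i\<bar>)" by (rule norm_le_l1_cart)
      also have "\<dots> \<le> 2 * ?n * (L / \<nu>) * ?M + (\<Sum>j\<in>(UNIV::'n set). ?M)"
        unfolding split by (intro add_mono y sum_mono h)
      also have "\<dots> = ?n * (1 + 2 * (L / \<nu>)) * ?M" by (simp add: algebra_simps)
      finally show "norm (F X) \<le> ?n * (1 + 2 * (L / \<nu>)) * ?M" .
    qed
  qed
qed

end

text \<open>
  The constants are chosen before the equation: they depend on the ratio \<open>q\<close> and the dimension only.
\<close>

lemma interior_gradient_estimate:
  fixes q :: real
  assumes "0 < q"
  shows "\<exists>C\<ge>0. \<exists>c>0. \<forall>(A :: real \<Rightarrow> real ^ 'n::finite option ^ 'n option) \<nu> L X0 \<rho> w F.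
     elliptic \<nu> L A \<longrightarrow> 0 < \<nu> \<longrightarrow> 0 < L \<longrightarrow> L \<le> q * \<nu> \<longrightarrow> 0 < \<rho> \<longrightarrow> solves A (ball X0 \<rho>) w F \<longrightarrow>
     (AE X in lborel. X \<in> ball X0 (c * \<rho>) \<longrightarrow>
        norm (F X) \<le> C * sqrt (energy (ball X0 \<rho>) F / \<rho> ^ Suc CARD('n)))"
proof -
  obtain K where K: "0 \<le> K" "\<forall>(A :: real \<Rightarrow> real ^ 'n option ^ 'n option) \<nu> L X0 \<rho> w F.
     elliptic \<nu> L A \<longrightarrow> 0 < \<nu> \<longrightarrow> 0 < L \<longrightarrow> 0 < \<rho> \<longrightarrow> solves A (ball X0 \<rho>) w F \<longrightarrow>
     energy (ball X0 (\<rho> / 4)) F \<le> K * (L / \<nu>)\<^sup>2 / \<rho>\<^sup>2 * sqnorm (ball X0 \<rho>) w"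
    using caccioppoli[where 'n = 'n] by (elim exE conjE) (rule that)
  define \<kappa> where "\<kappa> = max 1 (K * q\<^sup>2)"
  let ?m = "Suc CARD('n)"
  define N where "N = real CARD('n)"
  define E where "E = (4 * \<kappa> * 64 ^ ?m) ^ ?m"
  define D where "D = sobolev_const TYPE('n) * (8 ^ (CARD('n) + 2)) ^ ?m * E"
  define C where "C = N * (1 + 2 * q) * sqrt D"
  have "0 \<le> \<kappa>" by (simp add: \<kappa>_def)
  then have D: "0 \<le> D" unfolding D_def E_def using sobolev_const_nonneg by (intro mult_nonneg_nonneg) auto
  show ?thesis
  proof (rule exI[of _ C], rule conjI, goal_cases)
    case 1
    show "0 \<le> C" using D assms by (simp add: C_def N_def)
  next
    case 2
    show ?case
    proof (rule exI[of _ "1 / (4 * 8 ^ (CARD('n) + 2))"], intro conjI allI impI)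
      show "(0::real) < 1 / (4 * 8 ^ (CARD('n) + 2))" by simp
      fix A :: "real \<Rightarrow> real ^ 'n option ^ 'n option" and \<nu> L \<rho> :: real and X0 :: "'n point" and w F
      assume A: "elliptic \<nu> L A" "0 < \<nu>" "0 < L" and q: "L \<le> q * \<nu>" and \<rho>: "0 < \<rho>"
        and s: "solves A (ball X0 \<rho>) w F"
      have Lq: "L / \<nu> \<le> q" using q A(2) by (simp add: field_simps)
      interpret layered A \<nu> L \<kappa>
      proof
        fix X0 :: "'n point" and \<rho> w F assume "0 < \<rho>" "solves A (ball X0 \<rho>) w F"
        then have "energy (ball X0 (\<rho> / 4)) F \<le> K * (L / \<nu>)\<^sup>2 / \<rho>\<^sup>2 * sqnorm (ball X0 \<rho>) w" using K(2) A by blast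
        also have "\<dots> \<le> \<kappa> / \<rho>\<^sup>2 * sqnorm (ball X0 \<rho>) w"
        proof (intro mult_right_mono divide_right_mono)
          have "K * (L / \<nu>)\<^sup>2 \<le> K * q\<^sup>2" using K(1) Lq A by (intro mult_left_mono power_mono) auto
          then show "K * (L / \<nu>)\<^sup>2 \<le> \<kappa>" by (simp add: \<kappa>_def)
        qed auto
        finally show "energy (ball X0 (\<rho> / 4)) F \<le> \<kappa> / \<rho>\<^sup>2 * sqnorm (ball X0 \<rho>) w" .
      qed (use A in \<open>auto simp: \<kappa>_def\<close>)
      let ?e = "energy (ball X0 \<rho>) F"
      have eq: "sobolev_const TYPE('n) / inner_radius \<rho> ^ ?m * (energy_const * ?e) = D * (?e / \<rho> ^ ?m)"
        unfolding D_def E_def energy_const_def inner_radius_def power_divide using \<rho> by simp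
      have c: "inner_radius \<rho> / 4 = 1 / (4 * 8 ^ (CARD('n) + 2)) * \<rho>" by (simp add: inner_radius_def)
      have "AE X in lborel. X \<in> ball X0 (1 / (4 * 8 ^ (CARD('n) + 2)) * \<rho>) \<longrightarrow>
        norm (F X) \<le> N * (1 + 2 * (L / \<nu>)) * sqrt (D * (?e / \<rho> ^ ?m))"
        using gradient_bound[OF s \<rho>] unfolding eq c N_def .
      then show "AE X in lborel. X \<in> ball X0 (1 / (4 * 8 ^ (CARD('n) + 2)) * \<rho>) \<longrightarrow>
        norm (F X) \<le> C * sqrt (?e / \<rho> ^ ?m)"
      proof eventually_elim
        case (elim X)
        have "N * (1 + 2 * (L / \<nu>)) * sqrt (D * (?e / \<rho> ^ ?m)) \<le> N * (1 + 2 * q) * sqrt (D * (?e / \<rho> ^ ?m))"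
          using Lq D \<rho> by (intro mult_right_mono mult_left_mono) (auto simp: N_def)
        also have "\<dots> = C * sqrt (?e / \<rho> ^ ?m)" by (simp only: C_def real_sqrt_mult mult.assoc)
        finally show ?case using elim by (meson order_trans)
      qed
    qed
  qed
qed

section \<open>Borel representatives\<close>

lemma lebesgue_representative:
  fixes f g :: "'a::euclidean_space \<Rightarrow> real"
  assumes g: "g \<in> borel_measurable borel" and ae: "AE X in lborel. f X = g X"
  shows "f \<in> borel_measurable lebesgue" "(LINT X|lebesgue. f X) = (LINT X|lborel. g X)"
    "integrable lebesgue f \<longleftrightarrow> integrable lborel g"
proof -
  have gl: "g \<in> borel_measurable lborel" using g by simp
  have gL: "g \<in> borel_measurable lebesgue" by (rule measurable_completion[OF gl])
  have aeL: "AE X in lebesgue. f X = g X" using ae by (rule AE_completion)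
  then have aeL': "AE X in lebesgue. g X = f X" by eventually_elim simp
  show fL: "f \<in> borel_measurable lebesgue" by (rule borel_measurable_AE[OF gL aeL'])
  have "(LINT X|lebesgue. f X) = (LINT X|lebesgue. g X)" by (rule integral_cong_AE[OF fL gL aeL])
  then show "(LINT X|lebesgue. f X) = (LINT X|lborel. g X)" by (simp add: integral_completion[OF gl])
  show "integrable lebesgue f \<longleftrightarrow> integrable lborel g"
    using integrable_cong_AE[OF fL gL aeL] integrable_completion[OF gl] by simp
qed

lemma AE_exceptional_null_set:
  assumes "AE y in M. P y" shows "\<exists>N\<in>null_sets M. \<forall>y\<in>space M. y \<notin> N \<longrightarrow> P y"
  using assms unfolding eventually_ae_filter by blast

lemma AE_lborel_snd:
  assumes "AE y in lborel. P (y :: real)"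
  shows "AE X in (lborel :: ('a::euclidean_space \<times> real) measure). P (snd X)"
proof -
  obtain N where N: "N \<in> null_sets lborel" "{y. \<not> P y} \<subseteq> N"
    using assms by (auto simp: eventually_ae_filter)
  have "UNIV \<times> N \<in> null_sets (lborel \<Otimes>\<^sub>M (lborel :: real measure))"
    by (rule lborel.times_in_null_sets2[OF _ N(1)]) simp
  then have "(UNIV :: 'a set) \<times> N \<in> null_sets lborel" by (simp add: lborel_prod)
  then have "AE X in (lborel :: ('a \<times> real) measure). X \<notin> UNIV \<times> N" by (rule AE_not_in)
  then show ?thesis by eventually_elim (use N(2) in auto)
qed

lemma AE_on_interval_witness:
  assumes ae: "AE y in lebesgue_on {0<..<1::real}. P y" and J: "a < b" "0 \<le> a" "b \<le> 1"
  shows "\<exists>y. a < y \<and> y < b \<and> P y"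
proof (rule ccontr)
  assume none: "\<not> ?thesis"
  have "AE y in lebesgue. y \<in> {0<..<1} \<longrightarrow> P y" using ae by (subst (asm) AE_restrict_space_iff) auto
  then have "AE y in lborel. y \<in> {0<..<1} \<longrightarrow> P y" by (simp add: AE_completion_iff)
  then have "AE y in lborel. y \<notin> {a<..<b}"
  proof eventually_elim
    case (elim y)
    then show ?case using none J by auto
  qed
  then have "emeasure lborel {a<..<b} = 0"
    by (subst (asm) AE_iff_measurable[of "{a<..<b}"]) auto
  then show False using J by simp
qed

section \<open>From the weighted to the uniformly elliptic equation\<close>

text \<open>
  The point \<open>y0\<close> may be \<open>1\<close> or exceptional for the almost-everywhere hypothesis. But \<open>\<tau> < y0 / 2\<close> is
  strict, so the interval around \<open>y0\<close> is contained in an admissible one around a slightly smaller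
  and unexceptional \<open>y\<close>. The constant is the infimum of the weight there.
\<close>

lemma weight_comparable:
  fixes \<mu> :: "real \<Rightarrow> real"
  assumes ae: "AE y in lebesgue_on {0<..<1}. \<forall>\<tau>. 0 < \<tau> \<and> \<tau> < y / 2 \<longrightarrow>
         bdd_below (\<mu> ` {y - 3 * \<tau> / 2 <..< y + 3 * \<tau> / 2}) \<and>
         bdd_above (\<mu> ` {y - 3 * \<tau> / 2 <..< y + 3 * \<tau> / 2}) \<and>
         0 < (INF s\<in>{y - 3 * \<tau> / 2 <..< y + 3 * \<tau> / 2}. \<mu> s)"
    and sup: "(SUP (y, \<tau>)\<in>{(y, \<tau>). 0 < y \<and> y < 1 \<and> 0 < \<tau> \<and> \<tau> < y / 2}.
         ereal ((SUP s\<in>{y - 3 * \<tau> / 2 <..< y + 3 * \<tau> / 2}. \<mu> s) /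
                (INF s\<in>{y - 3 * \<tau> / 2 <..< y + 3 * \<tau> / 2}. \<mu> s))) \<le> ereal C1"
    and y0: "y0 \<le> 1" and \<tau>: "0 < \<tau>" "2 * \<tau> < y0"
  shows "\<exists>m>0. \<forall>s. y0 - 3 * \<tau> / 2 < s \<and> s < y0 + 3 * \<tau> / 2 \<longrightarrow> m \<le> \<mu> s \<and> \<mu> s \<le> C1 * m"
proof -
  define g where "g = y0 / 2 - \<tau>"
  have g: "0 < g" "g < y0 / 2" using \<tau> by (auto simp: g_def)
  obtain y where y: "y0 - g / 2 < y" "y < y0"
    "\<forall>\<tau>. 0 < \<tau> \<and> \<tau> < y / 2 \<longrightarrow>
         bdd_below (\<mu> ` {y - 3 * \<tau> / 2 <..< y + 3 * \<tau> / 2}) \<and>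
         bdd_above (\<mu> ` {y - 3 * \<tau> / 2 <..< y + 3 * \<tau> / 2}) \<and>
         0 < (INF s\<in>{y - 3 * \<tau> / 2 <..< y + 3 * \<tau> / 2}. \<mu> s)"
    using AE_on_interval_witness[OF ae, of "y0 - g / 2" y0] g y0 by auto
  \<comment> \<open>the interval around y with this radius contains the one around y0 with radius tau\<close>
  define \<sigma> where "\<sigma> = \<tau> + g / 2"
  have \<sigma>: "0 < \<sigma>" "\<sigma> < y / 2" using \<tau> g y(1,2) unfolding \<sigma>_def g_def by (simp_all add: field_simps)
  define J where "J = {y - 3 * \<sigma> / 2 <..< y + 3 * \<sigma> / 2}"
  have J: "bdd_below (\<mu> ` J)" "bdd_above (\<mu> ` J)" "0 < (INF s\<in>J. \<mu> s)"
    using y(3) \<sigma> by (auto simp: J_def)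
  have "y < 1" "0 < y" using y y0 g by linarith+
  then have "(y, \<sigma>) \<in> {(y, \<tau>). 0 < y \<and> y < 1 \<and> 0 < \<tau> \<and> \<tau> < y / 2}" using \<sigma> by simp
  from order_trans[OF SUP_upper[OF this] sup]
  have "(SUP s\<in>J. \<mu> s) / (INF s\<in>J. \<mu> s) \<le> C1" by (simp add: J_def)
  then have ratio: "(SUP s\<in>J. \<mu> s) \<le> C1 * (INF s\<in>J. \<mu> s)" using J(3) by (simp add: field_simps)
  show ?thesis
  proof (intro exI[of _ "INF s\<in>J. \<mu> s"] conjI allI impI J(3))
    fix s assume s: "y0 - 3 * \<tau> / 2 < s \<and> s < y0 + 3 * \<tau> / 2"
    have s12: "y0 - 3 * \<tau> / 2 < s" "s < y0 + 3 * \<tau> / 2" using s by auto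
    have "y - 3 * (\<tau> + g / 2) / 2 < s" "s < y + 3 * (\<tau> + g / 2) / 2"
      using s12 y(1,2) g(1) by argo+
    then have sJ: "s \<in> J" unfolding J_def \<sigma>_def by simp
    show "(INF s\<in>J. \<mu> s) \<le> \<mu> s" by (rule cINF_lower[OF J(1) sJ])
    show "\<mu> s \<le> C1 * (INF s\<in>J. \<mu> s)" using cSUP_upper[OF sJ J(2)] ratio by linarith
  qed
qed

text \<open>
  Off the set where the entries agree with their Borel representatives and the bounds hold, \<open>A\<close> is
  set to a multiple of the identity. This makes it elliptic for every \<open>y\<close>, which needs
  \<open>m / \<Lambda> \<le> \<Lambda> C1 m\<close>; the inequality follows from ellipticity at a single good point.
\<close>

lemma elliptic_representative:
  fixes A0 :: "real \<Rightarrow> real ^ 'n::finite option ^ 'n option"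
  assumes A0: "A0 \<in> borel_measurable (lebesgue_on {0<..<2})"
    and sym: "\<forall>y\<in>{0<..<2}. transpose (A0 y) = A0 y"
    and ell: "AE y in lebesgue_on {0<..<2}. \<forall>\<xi>.
         inverse \<Lambda> * \<mu> y * (norm \<xi>)\<^sup>2 \<le> (A0 y *v \<xi>) \<bullet> \<xi> \<and>
         (A0 y *v \<xi>) \<bullet> \<xi> \<le> \<Lambda> * \<mu> y * (norm \<xi>)\<^sup>2"
    and \<Lambda>: "0 < \<Lambda>" and m: "\<And>s. a < s \<Longrightarrow> s < b \<Longrightarrow> m \<le> \<mu> s \<and> \<mu> s \<le> C1 * m"
    and ab: "0 < a" "a < b" "b < 2"
  shows "\<exists>A. elliptic (m / \<Lambda>) (\<Lambda> * C1 * m) A \<and> (AE y in lborel. a < y \<and> y < b \<longrightarrow> A0 y = A y) \<and>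
    m / \<Lambda> \<le> \<Lambda> * C1 * m"
proof -
  have ex: "\<exists>B. B \<in> borel_measurable borel \<and> (AE y in lborel. y \<in> {0<..<2} \<longrightarrow> A0 y $ i $ j = B y)" for i j
  proof -
    have e: "(\<lambda>M::real^'n option^'n option. M $ i $ j) \<in> borel_measurable borel"
      by (intro borel_measurable_continuous_onI continuous_intros)
    have "(\<lambda>y. A0 y $ i $ j) \<in> borel_measurable (lebesgue_on {0<..<2})"
      using measurable_compose[OF A0 e] .
    then have "(\<lambda>y. indicator {0<..<2} y *\<^sub>R A0 y $ i $ j) \<in> borel_measurable lebesgue"
      by (subst (asm) borel_measurable_restrict_space_iff) auto
    from completion_ex_borel_measurable_real[OF this]
    obtain B where "B \<in> borel_measurable lborel" "AE y in lborel. indicator {0<..<2} y *\<^sub>R A0 y $ i $ j = B y" by blast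
    then show ?thesis by (intro exI[of _ B]) (auto elim!: eventually_mono)
  qed
  define B where "B i j = (SOME B. B \<in> borel_measurable borel \<and>
      (AE y in lborel. y \<in> {0<..<2} \<longrightarrow> A0 y $ i $ j = B y))" for i j
  have B: "B i j \<in> borel_measurable borel" "AE y in lborel. y \<in> {0<..<2} \<longrightarrow> A0 y $ i $ j = B i j y" for i j
    using someI_ex[OF ex[of i j]] unfolding B_def by blast+
  have "AE y in lborel. \<forall>i j. y \<in> {0<..<2} \<longrightarrow> A0 y $ i $ j = B i j y"
  proof -
    have "AE y in lborel. \<forall>i\<in>UNIV. \<forall>j\<in>UNIV. y \<in> {0<..<2} \<longrightarrow> A0 y $ i $ j = B i j y"
      by (rule AE_finite_allI[OF finite], rule AE_finite_allI[OF finite], rule B(2))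
    then show ?thesis by simp
  qed
  moreover have "AE y in lborel. y \<in> {0<..<2} \<longrightarrow> (\<forall>\<xi>.
         inverse \<Lambda> * \<mu> y * (norm \<xi>)\<^sup>2 \<le> (A0 y *v \<xi>) \<bullet> \<xi> \<and>
         (A0 y *v \<xi>) \<bullet> \<xi> \<le> \<Lambda> * \<mu> y * (norm \<xi>)\<^sup>2)"
    using ell by (subst (asm) AE_restrict_space_iff) (auto simp: AE_completion_iff)
  ultimately have good: "AE y in lborel. y \<in> {0<..<2} \<longrightarrow> (\<forall>i j. A0 y $ i $ j = B i j y) \<and> (\<forall>\<xi>.
         inverse \<Lambda> * \<mu> y * (norm \<xi>)\<^sup>2 \<le> (A0 y *v \<xi>) \<bullet> \<xi> \<and>
         (A0 y *v \<xi>) \<bullet> \<xi> \<le> \<Lambda> * \<mu> y * (norm \<xi>)\<^sup>2)"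
    by eventually_elim blast
  then obtain N where N: "N \<in> null_sets lborel" and N': "\<And>y. y \<notin> N \<Longrightarrow> y \<in> {0<..<2} \<Longrightarrow>
       (\<forall>i j. A0 y $ i $ j = B i j y) \<and> (\<forall>\<xi>.
         inverse \<Lambda> * \<mu> y * (norm \<xi>)\<^sup>2 \<le> (A0 y *v \<xi>) \<bullet> \<xi> \<and>
         (A0 y *v \<xi>) \<bullet> \<xi> \<le> \<Lambda> * \<mu> y * (norm \<xi>)\<^sup>2)"
    using AE_exceptional_null_set[OF good] by auto
  have Ns: "N \<in> sets borel" using N by auto
  define I where "I = {a<..<b} - N"
  have Is: "I \<in> sets borel" using Ns by (simp add: I_def)
  define A where "A y = (if y \<in> I then (\<chi> i j. B i j y) else mat (m / \<Lambda>))" for y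
  have A_I: "A y = A0 y" if "y \<in> I" for y
    using that N'[of y] ab by (auto simp: A_def I_def vec_eq_iff)
  have bounds: "m / \<Lambda> * (norm \<xi>)\<^sup>2 \<le> (A0 y *v \<xi>) \<bullet> \<xi> \<and> (A0 y *v \<xi>) \<bullet> \<xi> \<le> \<Lambda> * C1 * m * (norm \<xi>)\<^sup>2"
    if y: "y \<in> I" for y \<xi>
  proof -
    have y': "a < y" "y < b" "y \<notin> N" "y \<in> {0<..<2}" using y ab by (auto simp: I_def)
    have "m / \<Lambda> * (norm \<xi>)\<^sup>2 \<le> inverse \<Lambda> * \<mu> y * (norm \<xi>)\<^sup>2"
      using m[OF y'(1,2)] \<Lambda> by (intro mult_right_mono) (auto simp: field_simps)
    moreover have "\<Lambda> * \<mu> y * (norm \<xi>)\<^sup>2 \<le> \<Lambda> * (C1 * m) * (norm \<xi>)\<^sup>2"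
      using m[OF y'(1,2)] \<Lambda> by (intro mult_right_mono mult_left_mono) auto
    ultimately show ?thesis using N'[OF y'(3,4)] by (auto simp: mult.assoc intro: order_trans)
  qed
  have aeI: "AE y in lborel. a < y \<and> y < b \<longrightarrow> y \<in> I"
    using AE_not_in[OF N] by eventually_elim (auto simp: I_def)
  have "\<exists>y. y \<in> I"
  proof (rule ccontr)
    assume none: "\<not> ?thesis"
    from aeI have "AE y in lborel. y \<notin> {a<..<b}" by eventually_elim (use none in auto)
    then have "emeasure lborel {a<..<b} = 0" by (subst (asm) AE_iff_measurable[of "{a<..<b}"]) auto
    then show False using ab by simp
  qed
  then obtain y where "y \<in> I" ..
  from bounds[OF this, of "axis None 1"] have le: "m / \<Lambda> \<le> \<Lambda> * C1 * m" by (simp add: norm_axis_1)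
  have "elliptic (m / \<Lambda>) (\<Lambda> * C1 * m) A"
    unfolding elliptic_def
  proof (intro conjI allI)
    fix i j
    have "(\<lambda>y. if y \<in> I then B i j y else (mat (m / \<Lambda>) :: real ^ 'n option ^ 'n option) $ i $ j) \<in> borel_measurable borel"
      by (rule measurable_If_set[OF B(1)]) (use Is in auto)
    moreover have "A y $ i $ j = (if y \<in> I then B i j y else (mat (m / \<Lambda>) :: real ^ 'n option ^ 'n option) $ i $ j)" for y
      by (simp add: A_def)
    ultimately show "(\<lambda>y. A y $ i $ j) \<in> borel_measurable borel" by simp
  next
    fix y
    show "transpose (A y) = A y"
    proof (cases "y \<in> I")
      case True
      then have "y \<in> {0<..<2}" using ab by (auto simp: I_def)
      then show ?thesis using sym A_I[OF True] by simp
    next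
      case False
      then show ?thesis by (simp add: A_def)
    qed
  next
    fix y \<xi>
    have id: "(mat c :: real ^ 'n option ^ 'n option) *v \<xi> = c *\<^sub>R \<xi>" for c
      by (simp add: vec_eq_iff matrix_vector_mult_def mat_def if_distrib[where f = "\<lambda>x. x * _"] cong: if_cong)
    show "m / \<Lambda> * (norm \<xi>)\<^sup>2 \<le> (A y *v \<xi>) \<bullet> \<xi>"
      using bounds[of y \<xi>] A_I[of y] by (cases "y \<in> I") (auto simp: A_def id power2_norm_eq_inner)
    show "(A y *v \<xi>) \<bullet> \<xi> \<le> \<Lambda> * C1 * m * (norm \<xi>)\<^sup>2"
      using bounds[of y \<xi>] A_I[of y] mult_right_mono[OF le, of "(norm \<xi>)\<^sup>2"]
      by (cases "y \<in> I") (auto simp: A_def id power2_norm_eq_inner)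
  qed
  moreover have "AE y in lborel. a < y \<and> y < b \<longrightarrow> A0 y = A y"
    using aeI by eventually_elim (auto simp: A_I)
  ultimately show ?thesis using le by blast
qed

text \<open>
  Square integrability is inherited from the weighted function \<open>h\<close>, as the weight is at least \<open>m\<close>.
\<close>

lemma square_integrable_representative:
  fixes f :: "'a::euclidean_space \<Rightarrow> real"
  assumes f: "set_integrable lebesgue K f" and h: "set_integrable lebesgue E h"
    and KE: "K \<subseteq> E" and m: "0 < m" and le: "\<And>X. X \<in> E \<Longrightarrow> m * (f X)\<^sup>2 \<le> h X"
  shows "\<exists>g. sq_integrable g \<and> integrable lborel g \<and> (AE X in lborel. indicator K X * f X = g X)"
proof -
  have fi: "integrable lebesgue (\<lambda>X. indicator K X * f X)" using f by (simp add: set_integrable_def)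
  obtain g where g: "g \<in> borel_measurable borel" and ae: "AE X in lborel. indicator K X * f X = g X"
    using completion_ex_borel_measurable_real[OF borel_measurable_integrable[OF fi]] by auto
  have ae2: "AE X in lborel. (indicator K X * f X)\<^sup>2 = (g X)\<^sup>2" using ae by eventually_elim simp
  have g2: "(\<lambda>X. (g X)\<^sup>2) \<in> borel_measurable borel" using g by simp
  note r2 = lebesgue_representative[OF g2 ae2]
  have "integrable lebesgue (\<lambda>X. (indicator K X * f X)\<^sup>2)"
  proof (rule Bochner_Integration.integrable_bound[OF _ r2(1)])
    show "integrable lebesgue (\<lambda>X. (1 / m) * (indicator E X *\<^sub>R h X))"
      using h unfolding set_integrable_def by (rule integrable_mult_right)
    show "AE X in lebesgue. norm ((indicator K X * f X)\<^sup>2) \<le> norm ((1 / m) * (indicator E X *\<^sub>R h X))"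
    proof (rule AE_I2)
      fix X
      show "norm ((indicator K X * f X)\<^sup>2) \<le> norm ((1 / m) * (indicator E X *\<^sub>R h X))"
      proof (cases "X \<in> K")
        case True
        then have X: "X \<in> E" using KE by auto
        have "0 \<le> m * (f X)\<^sup>2" using m by simp
        then have "0 \<le> h X" using le[OF X] by linarith
        then show ?thesis using le[OF X] True X m by (simp add: field_simps)
      qed simp
    qed
  qed
  then have "sq_integrable g" using r2(3) g by (simp add: sq_integrable_def)
  moreover have "integrable lborel g" using lebesgue_representative(3)[OF g ae] fi by simp
  ultimately show ?thesis using ae by blast
qed

text \<open>
  Integrals against functions supported in \<open>K\<close> do not see the cutoff.
\<close>

lemma set_integral_test_representative:
  fixes f g \<psi> :: "'a::euclidean_space \<Rightarrow> real"
  assumes ae: "AE X in lborel. indicator K X * f X = g X" and KE: "K \<subseteq> E"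
    and g: "g \<in> borel_measurable borel" and \<psi>: "\<psi> \<in> borel_measurable borel" "\<And>X. X \<notin> K \<Longrightarrow> \<psi> X = 0"
  shows "(LINT X:E|lebesgue. f X * \<psi> X) = (LINT X|lborel. g X * \<psi> X)"
  unfolding set_lebesgue_integral_def
proof (rule lebesgue_representative(2))
  show "(\<lambda>X. g X * \<psi> X) \<in> borel_measurable borel" using g \<psi> by simp
  show "AE X in lborel. indicat_real E X *\<^sub>R (f X * \<psi> X) = g X * \<psi> X"
    using ae
  proof eventually_elim
    case (elim X)
    then show ?case using \<psi>(2)[of X] KE by (cases "X \<in> K") auto
  qed
qed

text \<open>
  Cut \<open>v\<close> and \<open>G\<close> off outside a closed ball, on which local integrability makes them integrable, and
  pass to Borel representatives.
\<close>

lemma solves_representative: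
  fixes v :: "'n::finite point \<Rightarrow> real" and G :: "'n point \<Rightarrow> real ^ 'n option"
  assumes W: "W12 E \<mu> v G" and ws: "weak_solution A0 E G" and KE: "cball X1 \<rho> \<subseteq> E"
    and m: "0 < m" "\<And>X. X \<in> E \<Longrightarrow> m \<le> \<mu> (snd X)"
    and A: "elliptic \<nu> L A" "0 < \<nu>" "0 < L"
    and aeA: "AE X in lborel. X \<in> E \<longrightarrow> A0 (snd X) = A (snd X)"
  shows "\<exists>w F. solves A (ball X1 \<rho>) w F \<and> (AE X in lborel. X \<in> ball X1 \<rho> \<longrightarrow> F X = G X) \<and>
     energy (ball X1 \<rho>) F \<le> (1 / m) * (LINT X:E|lebesgue. (norm (G X))\<^sup>2 * \<mu> (snd X))"
proof -
  let ?K = "cball X1 \<rho>"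
  have wg: "has_weak_gradient E v G" and iv: "set_integrable lebesgue E (\<lambda>X. (v X)\<^sup>2 * \<mu> (snd X))"
    and iG: "set_integrable lebesgue E (\<lambda>X. (norm (G X))\<^sup>2 * \<mu> (snd X))"
    using W by (auto simp: W12_def)
  have loc: "set_integrable lebesgue ?K v" "set_integrable lebesgue ?K G"
    using wg KE compact_cball by (auto simp: has_weak_gradient_def locally_integrable_def)
  have loci: "set_integrable lebesgue ?K (\<lambda>X. G X $ i)" for i
    using integrable_bounded_linear[OF bounded_linear_vec_nth[of i] loc(2)[unfolded set_integrable_def]]
    by (simp add: set_integrable_def)
  have bv: "m * (v X)\<^sup>2 \<le> (v X)\<^sup>2 * \<mu> (snd X)" if "X \<in> E" for X
    using mult_left_mono[OF m(2)[OF that], of "(v X)\<^sup>2"] by (simp add: mult.commute)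
  have bG: "m * (G X $ i)\<^sup>2 \<le> (norm (G X))\<^sup>2 * \<mu> (snd X)" if "X \<in> E" for X i
  proof -
    have "(G X $ i)\<^sup>2 \<le> (norm (G X))\<^sup>2"
      using power_mono[OF component_le_norm_cart[of "G X" i], of 2] by simp
    then have "m * (G X $ i)\<^sup>2 \<le> \<mu> (snd X) * (norm (G X))\<^sup>2"
      using m(1) m(2)[OF that] by (intro mult_mono) auto
    then show ?thesis by (simp add: mult.commute)
  qed
  obtain w where w: "sq_integrable w" "integrable lborel w" "AE X in lborel. indicator ?K X * v X = w X"
    using square_integrable_representative[OF loc(1) iv KE m(1) bv] by blast
  have "\<forall>i. \<exists>g. sq_integrable g \<and> integrable lborel g \<and> (AE X in lborel. indicator ?K X * G X $ i = g X)"
    using square_integrable_representative[OF loci iG KE m(1) bG] by blast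
  from choice[OF this] obtain Fi where Fi: "\<And>i. sq_integrable (Fi i)" "\<And>i. integrable lborel (Fi i)"
    "\<And>i. AE X in lborel. indicator ?K X * G X $ i = Fi i X" by auto
  define F where "F X = (\<chi> i. Fi i X)" for X
  have vF: "vec_sq_integrable F" using Fi by (simp add: vec_sq_integrable_def F_def)
  have "AE X in lborel. \<forall>i\<in>UNIV. indicator ?K X * G X $ i = Fi i X"
    by (rule AE_finite_allI[OF finite], rule Fi(3))
  then have aeF: "AE X in lborel. F X = indicator ?K X *\<^sub>R G X"
    by eventually_elim (auto simp: F_def vec_eq_iff)
  have "solves A (ball X1 \<rho>) w F"
    unfolding solves_def
  proof (intro conjI allI impI w vF)
    fix \<phi> :: "'n point \<Rightarrow> real" assume t: "test_function (ball X1 \<rho>) \<phi>"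
    have tE: "test_function E \<phi>" by (rule test_function_mono[OF t]) (use KE in auto)
    have t': "test_function (ball X1 \<rho>) (dd \<phi> u)" for u by (rule test_function_dd[OF t])
    have off: "\<phi> X = 0" "dd \<phi> u X = 0" if "X \<notin> ?K" for X u
      using that test_function_zero[OF t, of X] test_function_zero[OF t', of X] by auto
    have meas: "\<phi> \<in> borel_measurable borel" "dd \<phi> u \<in> borel_measurable borel" for u
      using test_function_measurable[OF t] test_function_measurable[OF t'] by auto
    show "(LINT X|lborel. w X * dd \<phi> (coord_dir i) X) = - (LINT X|lborel. F X $ i * \<phi> X)" for i
    proof -
      have "(LINT X|lborel. w X * dd \<phi> (coord_dir i) X) = (LINT X:E|lebesgue. v X * dd \<phi> (coord_dir i) X)"
        by (rule set_integral_test_representative[OF w(3) KE, symmetric]) (use w off meas in auto)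
      also have "\<dots> = - (LINT X:E|lebesgue. G X $ i * \<phi> X)"
        using wg tE by (simp add: has_weak_gradient_def grad_def)
      also have "(LINT X:E|lebesgue. G X $ i * \<phi> X) = (LINT X|lborel. Fi i X * \<phi> X)"
        by (rule set_integral_test_representative[OF Fi(3) KE]) (use Fi(1) off meas in auto)
      finally show ?thesis by (simp add: F_def)
    qed
    show "(\<Sum>i\<in>UNIV. LINT X|lborel. flux A F i X * dd \<phi> (coord_dir i) X) = 0"
    proof -
      note fl = flux_sq[OF A vF]
      have i: "integrable lborel (\<lambda>X. flux A F i X * dd \<phi> (coord_dir i) X)" for i
        by (rule sq_mult_integrable[OF fl(1) test_function_sq(1)[OF t']])
      have "(LINT X:E|lebesgue. (A0 (snd X) *v G X) \<bullet> grad \<phi> X) =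
        (LINT X|lborel. (\<Sum>i\<in>UNIV. flux A F i X * dd \<phi> (coord_dir i) X))"
        unfolding set_lebesgue_integral_def
      proof (rule lebesgue_representative(2))
        show "(\<lambda>X. \<Sum>i\<in>UNIV. flux A F i X * dd \<phi> (coord_dir i) X) \<in> borel_measurable borel"
          using borel_measurable_integrable[OF Bochner_Integration.integrable_sum[OF i]] by simp
        show "AE X in lborel. indicat_real E X *\<^sub>R ((A0 (snd X) *v G X) \<bullet> grad \<phi> X) =
          (\<Sum>i\<in>UNIV. flux A F i X * dd \<phi> (coord_dir i) X)"
          using aeF aeA
        proof eventually_elim
          case (elim X)
          show ?case
          proof (cases "X \<in> ?K")
            case True
            then have "F X = G X" "X \<in> E" "A0 (snd X) = A (snd X)" using elim KE by auto
            then show ?thesis by (simp add: flux_def inner_vec_def grad_def)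
          next
            case False
            then show ?thesis using off(2)[OF False] by (simp add: grad_def inner_vec_def)
          qed
        qed
      qed
      then have "(LINT X|lborel. (\<Sum>i\<in>UNIV. flux A F i X * dd \<phi> (coord_dir i) X)) = 0"
        using ws tE by (simp add: weak_solution_def)
      moreover have "(LINT X|lborel. (\<Sum>i\<in>UNIV. flux A F i X * dd \<phi> (coord_dir i) X)) =
          (\<Sum>i\<in>UNIV. LINT X|lborel. flux A F i X * dd \<phi> (coord_dir i) X)"
        by (rule Bochner_Integration.integral_sum) (rule i)
      ultimately show ?thesis by simp
    qed
  qed
  moreover have "AE X in lborel. X \<in> ball X1 \<rho> \<longrightarrow> F X = G X"
    using aeF by eventually_elim (auto simp: indicator_def)
  moreover have "energy (ball X1 \<rho>) F \<le> (1 / m) * (LINT X:E|lebesgue. (norm (G X))\<^sup>2 * \<mu> (snd X))"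
  proof -
    have i: "integrable lborel (\<lambda>X. indicator (ball X1 \<rho>) X * (F X $ i)\<^sup>2)" for i
      using vF by (intro sqnorm_integrable) (auto simp: vec_sq_integrable_def)
    define S where "S X = (\<Sum>i\<in>UNIV. indicator (ball X1 \<rho>) X * (F X $ i)\<^sup>2)" for X
    have S: "integrable lborel S" "(LINT X|lborel. S X) = energy (ball X1 \<rho>) F"
      unfolding S_def[abs_def] energy_def sqnorm_def
      by (rule Bochner_Integration.integrable_sum[OF i]) (rule Bochner_Integration.integral_sum[OF i])
    have S': "S X = indicator (ball X1 \<rho>) X * (norm (F X))\<^sup>2" for X
      unfolding S_def norm_vec_square by (rule sum_distrib_left[symmetric])
    have mS: "S \<in> borel_measurable borel" using borel_measurable_integrable[OF S(1)] by simp
    have "AE X in lborel. indicator (ball X1 \<rho>) X * (norm (G X))\<^sup>2 = S X"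
      using aeF by eventually_elim (auto simp: S' indicator_def)
    note r = lebesgue_representative[OF mS this]
    have "energy (ball X1 \<rho>) F = (LINT X|lebesgue. indicator (ball X1 \<rho>) X * (norm (G X))\<^sup>2)"
      using S(2) r(2) by simp
    also have "\<dots> \<le> (LINT X|lebesgue. (1 / m) * (indicator E X *\<^sub>R ((norm (G X))\<^sup>2 * \<mu> (snd X))))"
    proof (rule integral_mono)
      show "integrable lebesgue (\<lambda>X. indicator (ball X1 \<rho>) X * (norm (G X))\<^sup>2)" using r(3) S(1) by simp
      show "integrable lebesgue (\<lambda>X. (1 / m) * (indicator E X *\<^sub>R ((norm (G X))\<^sup>2 * \<mu> (snd X))))"
        using iG unfolding set_integrable_def by (rule integrable_mult_right)
      fix X
      show "indicator (ball X1 \<rho>) X * (norm (G X))\<^sup>2 \<le> (1 / m) * (indicator E X *\<^sub>R ((norm (G X))\<^sup>2 * \<mu> (snd X)))"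
      proof (cases "X \<in> E")
        case True
        have "1 * (norm (G X))\<^sup>2 \<le> \<mu> (snd X) / m * (norm (G X))\<^sup>2"
          using m(1) m(2)[OF True] by (intro mult_right_mono) (auto simp: field_simps)
        moreover have "indicator (ball X1 \<rho>) X * (norm (G X))\<^sup>2 \<le> 1 * (norm (G X))\<^sup>2"
          by (intro mult_right_mono) (auto simp: indicator_def)
        ultimately show ?thesis using True by (simp add: mult.commute)
      next
        case False
        then have "X \<notin> ball X1 \<rho>" using KE ball_subset_cball by blast
        then show ?thesis using False by simp
      qed
    qed
    also have "\<dots> = (1 / m) * (LINT X:E|lebesgue. (norm (G X))\<^sup>2 * \<mu> (snd X))"
      unfolding set_lebesgue_integral_def by (rule integral_mult_right_zero)
    finally show ?thesis .
  qed
  ultimately show ?thesis by blast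
qed

section \<open>Cylinders and the gradient estimate\<close>

lemma open_cylinder: "open (cylinder X0 r)"
  unfolding cylinder_def by (intro open_Times) auto

lemma mem_cylinder: "X \<in> cylinder X0 r \<longleftrightarrow> dist (fst X0) (fst X) < r \<and> \<bar>snd X - snd X0\<bar> < r"
  by (auto simp: cylinder_def mem_Times_iff)

lemma ball_subset_cylinder: "ball X0 r \<subseteq> cylinder X0 r"
proof
  fix X assume "X \<in> ball X0 r"
  then have "dist X0 X < r" by simp
  then show "X \<in> cylinder X0 r"
    using dist_fst_le[of X0 X] dist_snd_le[of X0 X]
    by (simp add: mem_cylinder dist_real_def abs_minus_commute)
qed

lemma cylinder_subset_ball: "cylinder X0 r \<subseteq> ball X0 (2 * r)"
proof
  fix X assume "X \<in> cylinder X0 r"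
  then have "dist (fst X0) (fst X) < r" "dist (snd X0) (snd X) < r"
    by (auto simp: mem_cylinder dist_real_def abs_minus_commute)
  moreover have "dist X0 X \<le> dist (fst X0) (fst X) + dist (snd X0) (snd X)"
    unfolding dist_prod_def by (rule sqrt_sum_squares_le_sum) auto
  ultimately show "X \<in> ball X0 (2 * r)" by simp
qed

lemma cball_subset_cylinder:
  assumes "X1 \<in> cylinder X0 s" "s + \<rho> \<le> r" shows "cball X1 \<rho> \<subseteq> cylinder X0 r"
proof
  fix X assume X: "X \<in> cball X1 \<rho>"
  have "dist (fst X0) (fst X) \<le> dist (fst X0) (fst X1) + dist (fst X1) (fst X)" by (rule dist_triangle)
  moreover have "\<bar>snd X - snd X0\<bar> \<le> \<bar>snd X1 - snd X0\<bar> + dist (snd X1) (snd X)" by (simp add: dist_real_def)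
  ultimately show "X \<in> cylinder X0 r"
    using X assms dist_fst_le[of X1 X] dist_snd_le[of X1 X] by (auto simp: mem_cylinder)
qed

text \<open>
  The positive lower bound also excludes the default value \<open>0\<close> of the Bochner integral.
\<close>

lemma weighted_vol_bounds:
  fixes X0 :: "'n::finite point"
  assumes mu: "weight \<mu>" and m: "0 < m" "\<And>X. X \<in> cylinder X0 r \<Longrightarrow> m \<le> \<mu> (snd X) \<and> \<mu> (snd X) \<le> M"
    and r: "0 < r"
  shows "0 < weighted_vol \<mu> (cylinder X0 r)"
    "weighted_vol \<mu> (cylinder X0 r) \<le> M * measure lborel (ball X0 (2 * r))"
proof -
  let ?E = "cylinder X0 r"
  have Es: "?E \<in> sets borel" by (rule borel_open[OF open_cylinder])
  obtain g where g: "g \<in> borel_measurable borel" "AE y in lborel. \<mu> y = g y"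
    using completion_ex_borel_measurable_real[of \<mu> lborel] mu by (auto simp: weight_def)
  have s: "(snd :: 'n point \<Rightarrow> real) \<in> borel_measurable borel"
    by (intro borel_measurable_continuous_onI continuous_intros)
  have mg: "(\<lambda>X :: 'n point. g (snd X)) \<in> borel_measurable borel" using measurable_compose[OF s g(1)] .
  have m1: "(\<lambda>X. indicat_real ?E X * g (snd X)) \<in> borel_measurable borel"
    using mg Es by simp
  have "AE X in lborel. \<mu> (snd X) = g (snd (X :: 'n point))" by (rule AE_lborel_snd[OF g(2)])
  then have "AE X in lborel. indicat_real ?E X *\<^sub>R \<mu> (snd X) = indicator ?E X * g (snd X)"
    by eventually_elim simp
  note r1 = lebesgue_representative[OF m1 this]
  have iE: "integrable lebesgue (indicat_real A)" "(LINT X|lebesgue. indicat_real A X) = measure lborel A"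
    if "bounded A" "A \<in> sets borel" for A :: "'n point set"
    using integrable_indicator_bounded[OF that] that
    by (auto simp: integrable_completion integral_completion)
  have bE: "bounded ?E" by (rule bounded_subset[OF _ cylinder_subset_ball]) auto
  have M: "m \<le> M" using m(2)[of X0] r by (auto simp: mem_cylinder)
  have pw: "m * indicator ?E X \<le> indicat_real ?E X *\<^sub>R \<mu> (snd X)" "indicat_real ?E X *\<^sub>R \<mu> (snd X) \<le> M * indicator ?E X" for X
    using m(2)[of X] by (auto simp: indicator_def)
  have int: "integrable lebesgue (\<lambda>X. indicat_real ?E X *\<^sub>R \<mu> (snd X))"
  proof (rule Bochner_Integration.integrable_bound[OF _ r1(1)])
    show "integrable lebesgue (\<lambda>X. M * indicator ?E X)" using iE(1)[OF bE Es] by simp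
    show "AE X in lebesgue. norm (indicat_real ?E X *\<^sub>R \<mu> (snd X)) \<le> norm (M * indicator ?E X)"
    proof (rule AE_I2)
      fix X
      have "0 \<le> m * indicator ?E X" using m(1) by simp
      then show "norm (indicat_real ?E X *\<^sub>R \<mu> (snd X)) \<le> norm (M * indicator ?E X)"
        using pw[of X] unfolding real_norm_def by linarith
    qed
  qed
  have low: "m * measure lborel ?E \<le> weighted_vol \<mu> ?E"
    unfolding weighted_vol_def set_lebesgue_integral_def iE(2)[OF bE Es, symmetric] integral_mult_right_zero[symmetric]
    using iE(1)[OF bE Es] by (intro integral_mono int pw) auto
  have up: "weighted_vol \<mu> ?E \<le> M * measure lborel ?E"
    unfolding weighted_vol_def set_lebesgue_integral_def iE(2)[OF bE Es, symmetric] integral_mult_right_zero[symmetric]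
    using iE(1)[OF bE Es] by (intro integral_mono int pw) auto
  have meas_mono: "measure lborel A \<le> measure lborel B" if "A \<subseteq> B" "bounded B" "A \<in> sets borel" "B \<in> sets borel" for A B :: "'n point set"
    using that emeasure_bounded_finite[OF that(2)] by (intro measure_mono_fmeasurable) (auto simp: fmeasurable_def)
  have "0 < measure lborel (ball X0 r)" using content_ball_pos[OF r] by simp
  also have "\<dots> \<le> measure lborel ?E" by (rule meas_mono[OF ball_subset_cylinder bE _ Es]) simp
  finally show "0 < weighted_vol \<mu> ?E" using low m(1) by (smt (verit) mult_pos_pos)
  have "measure lborel ?E \<le> measure lborel (ball X0 (2 * r))"
    by (rule meas_mono[OF cylinder_subset_ball _ Es]) auto
  from mult_left_mono[OF this, of M]
  show "weighted_vol \<mu> ?E \<le> M * measure lborel (ball X0 (2 * r))" using up M m(1) by linarith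
qed

text \<open>
  By the Lindelof property countably many of the balls suffice.
\<close>

lemma AE_of_local:
  fixes S :: "'a::euclidean_space set"
  assumes "0 < r" "\<And>Z. Z \<in> S \<Longrightarrow> AE X in lborel. X \<in> ball Z r \<longrightarrow> P X"
  shows "AE X in lborel. X \<in> S \<longrightarrow> P X"
proof -
  obtain \<F> where \<F>: "\<F> \<subseteq> (\<lambda>Z. ball Z r) ` S" "countable \<F>" "\<Union>\<F> = \<Union>((\<lambda>Z. ball Z r) ` S)"
    using Lindelof[of "(\<lambda>Z. ball Z r) ` S"] by auto
  have "AE X in lborel. \<forall>B\<in>\<F>. X \<in> B \<longrightarrow> P X"
  proof (subst AE_ball_countable[OF \<F>(2)], rule ballI)
    fix B assume "B \<in> \<F>"
    then obtain Z where "Z \<in> S" "B = ball Z r" using \<F>(1) by blast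
    then show "AE X in lborel. X \<in> B \<longrightarrow> P X" using assms(2) by simp
  qed
  then show ?thesis
  proof eventually_elim
    case (elim X)
    show ?case
    proof
      assume "X \<in> S"
      then have "X \<in> \<Union>\<F>" unfolding \<F>(3) using assms(1) by (intro UN_I[of X]) auto
      then show "P X" using elim by blast
    qed
  qed
qed

theorem lemma8p3:
  fixes \<Lambda> C1 \<theta> :: real
  assumes "\<Lambda> > 0" and "C1 > 0" and "0 < \<theta>" and "\<theta> < 1"
  shows "\<exists>C::real.
    \<forall>(A0 :: real \<Rightarrow> real ^ ('n::finite) option ^ 'n option) (\<mu> :: real \<Rightarrow> real).
      A0 \<in> borel_measurable (lebesgue_on {0<..<2}) \<and>
      (\<forall>y\<in>{0<..<2}. transpose (A0 y) = A0 y) \<and>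
      weight \<mu> \<and>
      (AE y in lebesgue_on {0<..<2}. \<forall>\<xi>.
         inverse \<Lambda> * \<mu> y * (norm \<xi>)\<^sup>2 \<le> (A0 y *v \<xi>) \<bullet> \<xi> \<and>
         (A0 y *v \<xi>) \<bullet> \<xi> \<le> \<Lambda> * \<mu> y * (norm \<xi>)\<^sup>2) \<and>
      (AE y in lebesgue_on {0<..<1}. \<forall>\<tau>. 0 < \<tau> \<and> \<tau> < y / 2 \<longrightarrow>
         bdd_below (\<mu> ` {y - 3 * \<tau> / 2 <..< y + 3 * \<tau> / 2}) \<and>
         bdd_above (\<mu> ` {y - 3 * \<tau> / 2 <..< y + 3 * \<tau> / 2}) \<and>
         0 < (INF s\<in>{y - 3 * \<tau> / 2 <..< y + 3 * \<tau> / 2}. \<mu> s)) \<and>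
      (SUP (y, \<tau>)\<in>{(y, \<tau>). 0 < y \<and> y < 1 \<and> 0 < \<tau> \<and> \<tau> < y / 2}.
         ereal ((SUP s\<in>{y - 3 * \<tau> / 2 <..< y + 3 * \<tau> / 2}. \<mu> s) /
                (INF s\<in>{y - 3 * \<tau> / 2 <..< y + 3 * \<tau> / 2}. \<mu> s))) \<le> ereal C1
      \<longrightarrow>
      (\<forall>X0 \<tau> v (G :: (real ^ 'n) \<times> real \<Rightarrow> real ^ 'n option).
         X0 \<in> closure Q1 \<and> 0 < \<tau> \<and> \<tau> < 1 \<and> snd X0 - 2 * \<tau> > 0 \<and>
         W12 (cylinder X0 (3 * \<tau> / 2)) \<mu> v G \<and>
         weak_solution A0 (cylinder X0 (3 * \<tau> / 2)) G
         \<longrightarrow>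
         Linf_norm (cylinder X0 (3 * \<theta> * \<tau> / 2)) G
           \<le> ereal (C * sqrt (1 / weighted_vol \<mu> (cylinder X0 (3 * \<tau> / 2)) *
               (LINT X:cylinder X0 (3 * \<tau> / 2)|lebesgue. (norm (G X))\<^sup>2 * \<mu> (snd X)))))"
proof -
  define k where "k = Suc CARD('n)"
  define q where "q = \<Lambda>\<^sup>2 * C1"
  have q: "0 < q" using assms by (simp add: q_def)
  obtain C c where C: "0 \<le> C" and c: "0 < c" and est: "\<And>(A :: real \<Rightarrow> real ^ 'n option ^ 'n option) \<nu> L X0 \<rho> w F X1.
     elliptic \<nu> L A \<Longrightarrow> 0 < \<nu> \<Longrightarrow> 0 < L \<Longrightarrow> L \<le> q * \<nu> \<Longrightarrow> 0 < \<rho> \<Longrightarrow> solves A (ball X0 \<rho>) w F \<Longrightarrow>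
     (AE X in lborel. X \<in> ball X0 (c * \<rho>) \<longrightarrow>
        norm (F X) \<le> C * sqrt (energy (ball X0 \<rho>) F / \<rho> ^ k))"
    using interior_gradient_estimate[OF q, where 'n = 'n] unfolding k_def by blast
  define \<omega> where "\<omega> = measure lborel (ball (0 :: 'n point) 1)"
  \<comment> \<open>C1 times the volume of a ball of radius 3 tau (it contains the cylinder) over the k-th power of (1 - theta) tau\<close>
  define H where "H = C1 * (3 / (1 - \<theta>)) ^ k * \<omega>"
  show ?thesis
  proof (rule exI[of _ "C * sqrt H"], intro allI impI, elim conjE)
    fix A0 :: "real \<Rightarrow> real ^ 'n option ^ 'n option" and \<mu> :: "real \<Rightarrow> real" and X0 :: "'n point" and \<tau> v
      and G :: "'n point \<Rightarrow> real ^ 'n option"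
    assume A0: "A0 \<in> borel_measurable (lebesgue_on {0<..<2})"
      and sym: "\<forall>y\<in>{0<..<2}. transpose (A0 y) = A0 y" and mu: "weight \<mu>"
      and ell: "AE y in lebesgue_on {0<..<2}. \<forall>\<xi>.
         inverse \<Lambda> * \<mu> y * (norm \<xi>)\<^sup>2 \<le> (A0 y *v \<xi>) \<bullet> \<xi> \<and>
         (A0 y *v \<xi>) \<bullet> \<xi> \<le> \<Lambda> * \<mu> y * (norm \<xi>)\<^sup>2"
      and ae: "AE y in lebesgue_on {0<..<1}. \<forall>\<tau>. 0 < \<tau> \<and> \<tau> < y / 2 \<longrightarrow>
         bdd_below (\<mu> ` {y - 3 * \<tau> / 2 <..< y + 3 * \<tau> / 2}) \<and>
         bdd_above (\<mu> ` {y - 3 * \<tau> / 2 <..< y + 3 * \<tau> / 2}) \<and>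
         0 < (INF s\<in>{y - 3 * \<tau> / 2 <..< y + 3 * \<tau> / 2}. \<mu> s)"
      and sup: "(SUP (y, \<tau>)\<in>{(y, \<tau>). 0 < y \<and> y < 1 \<and> 0 < \<tau> \<and> \<tau> < y / 2}.
         ereal ((SUP s\<in>{y - 3 * \<tau> / 2 <..< y + 3 * \<tau> / 2}. \<mu> s) /
                (INF s\<in>{y - 3 * \<tau> / 2 <..< y + 3 * \<tau> / 2}. \<mu> s))) \<le> ereal C1"
      and X0: "X0 \<in> closure Q1" and \<tau>: "0 < \<tau>" "\<tau> < 1" and pos: "0 < snd X0 - 2 * \<tau>"
      and W: "W12 (cylinder X0 (3 * \<tau> / 2)) \<mu> v G"
      and ws: "weak_solution A0 (cylinder X0 (3 * \<tau> / 2)) G"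
    define y0 where "y0 = snd X0"
    define r where "r = 3 * \<tau> / 2"
    let ?E = "cylinder X0 r"
    have r: "0 < r" using \<tau> by (simp add: r_def)
    have "closed {X :: 'n point. snd X \<le> 1}" by (intro closed_Collect_le continuous_intros)
    then have "closure Q1 \<subseteq> {X :: 'n point. snd X \<le> 1}" by (intro closure_minimal) (auto simp: Q1_def)
    then have y1: "y0 \<le> 1" using X0 by (auto simp: y0_def)
    have y2: "2 * \<tau> < y0" using pos by (simp add: y0_def)
    obtain m where m: "0 < m" "\<And>s. y0 - r < s \<Longrightarrow> s < y0 + r \<Longrightarrow> m \<le> \<mu> s \<and> \<mu> s \<le> C1 * m"
      using weight_comparable[OF ae sup y1 \<tau>(1) y2] unfolding r_def by blast
    have mE: "m \<le> \<mu> (snd X) \<and> \<mu> (snd X) \<le> C1 * m" if "X \<in> ?E" for X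
      using that by (intro m(2)) (auto simp: mem_cylinder y0_def)
    have ab: "0 < y0 - r" "y0 - r < y0 + r" "y0 + r < 2" using y1 y2 \<tau> by (auto simp: r_def)
    obtain A where A: "elliptic (m / \<Lambda>) (\<Lambda> * C1 * m) A"
      and aeA0: "AE y in lborel. y0 - r < y \<and> y < y0 + r \<longrightarrow> A0 y = A y"
      using elliptic_representative[OF A0 sym ell assms(1) m(2) ab] by blast
    have aeA: "AE X in lborel. X \<in> ?E \<longrightarrow> A0 (snd X) = A (snd X)"
      using AE_lborel_snd[OF aeA0] by eventually_elim (auto simp: mem_cylinder y0_def)
    have \<nu>L: "0 < m / \<Lambda>" "0 < \<Lambda> * C1 * m" "\<Lambda> * C1 * m \<le> q * (m / \<Lambda>)"
      using m(1) assms by (auto simp: q_def power2_eq_square)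
    define D where "D = (LINT X:?E|lebesgue. (norm (G X))\<^sup>2 * \<mu> (snd X))"
    define V where "V = weighted_vol \<mu> ?E"
    have V: "0 < V" "V \<le> C1 * m * ((3 * \<tau>) ^ k * \<omega>)"
    proof -
      have "measure lborel (ball X0 (2 * r)) = (3 * \<tau>) ^ k * \<omega>"
        using content_ball_conv_unit_ball[of "2 * r" X0] r by (simp add: k_def \<omega>_def r_def)
      then show "0 < V" "V \<le> C1 * m * ((3 * \<tau>) ^ k * \<omega>)"
        using weighted_vol_bounds[of \<mu> m X0 r "C1 * m", OF mu m(1) mE r] unfolding V_def by simp_all
    qed
    have D: "0 \<le> D" unfolding D_def set_lebesgue_integral_def
      using mu by (intro Bochner_Integration.integral_nonneg_AE AE_I2) (auto simp: weight_def)
    \<comment> \<open>balls of this radius around points of the smaller cylinder are compactly contained in the larger one\<close>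
    define \<rho> where "\<rho> = (1 - \<theta>) * \<tau>"
    have \<rho>: "0 < \<rho>" using assms \<tau> by (simp add: \<rho>_def)
    have radii: "3 * \<theta> * \<tau> / 2 + \<rho> \<le> r"
    proof -
      have "r - (3 * \<theta> * \<tau> / 2 + \<rho>) = (1 - \<theta>) * \<tau> / 2" by (simp add: r_def \<rho>_def field_simps)
      also have "0 \<le> (1 - \<theta>) * \<tau> / 2" using \<rho> by (simp add: \<rho>_def)
      finally show ?thesis by simp
    qed
    let ?S = "cylinder X0 (3 * \<theta> * \<tau> / 2)" and ?B = "C * sqrt H * sqrt (1 / V * D)"
    have local: "AE X in lborel. X \<in> ball X1 (min c 1 * \<rho>) \<longrightarrow> norm (G X) \<le> ?B" if X1: "X1 \<in> ?S" for X1
    proof -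
      have KE: "cball X1 \<rho> \<subseteq> ?E" by (rule cball_subset_cylinder[OF X1 radii])
      obtain w F where s: "solves A (ball X1 \<rho>) w F" and FG: "AE X in lborel. X \<in> ball X1 \<rho> \<longrightarrow> F X = G X"
        and e: "energy (ball X1 \<rho>) F \<le> (1 / m) * D"
        using solves_representative[OF W[folded r_def] ws[folded r_def] KE m(1) _ A \<nu>L(1,2) aeA] mE
        unfolding D_def by blast
      have "energy (ball X1 \<rho>) F / \<rho> ^ k \<le> H * (1 / V * D)"
      proof -
        have "1 / m \<le> C1 * ((3 * \<tau>) ^ k * \<omega>) / V"
          using V m(1) by (simp add: field_simps)
        then have "(1 / m) * D / \<rho> ^ k \<le> C1 * ((3 * \<tau>) ^ k * \<omega>) / V * D / \<rho> ^ k"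
          using D \<rho> by (intro divide_right_mono mult_right_mono) auto
        also have "\<dots> = H * (1 / V * D)"
          using \<tau>(1) by (simp add: H_def \<rho>_def power_mult_distrib power_divide mult_ac)
        finally show ?thesis using divide_right_mono[OF e, of "\<rho> ^ k"] \<rho> by simp
      qed
      then have "C * sqrt (energy (ball X1 \<rho>) F / \<rho> ^ k) \<le> C * sqrt (H * (1 / V * D))"
        using C by (intro mult_left_mono real_sqrt_le_mono)
      also have "\<dots> = ?B" by (simp only: real_sqrt_mult mult.assoc)
      finally have le: "C * sqrt (energy (ball X1 \<rho>) F / \<rho> ^ k) \<le> ?B" .
      have sub: "ball X1 (min c 1 * \<rho>) \<subseteq> ball X1 (c * \<rho>)" "ball X1 (min c 1 * \<rho>) \<subseteq> ball X1 \<rho>"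
        using \<rho> mult_right_mono[of "min c 1" c \<rho>] mult_right_mono[of "min c 1" 1 \<rho>] by (auto intro!: subset_ball)
      show ?thesis
        using est[OF A \<nu>L \<rho> s] FG
      proof eventually_elim
        case (elim X)
        show ?case
        proof
          assume "X \<in> ball X1 (min c 1 * \<rho>)"
          then have "X \<in> ball X1 (c * \<rho>)" "X \<in> ball X1 \<rho>" using sub by blast+
          then show "norm (G X) \<le> ?B" using elim le by (metis order_trans)
        qed
      qed
    qed
    have Ss: "?S \<in> sets lebesgue"
      by (rule sets_completionI_sets) (simp add: borel_open open_cylinder)
    have "AE X in lborel. X \<in> ?S \<longrightarrow> norm (G X) \<le> ?B"
      by (rule AE_of_local[OF _ local]) (use c \<rho> in auto)
    then have "AE X in lebesgue. X \<in> ?S \<longrightarrow> norm (G X) \<le> ?B" by (rule AE_completion)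
    then have aeS: "AE X in lebesgue_on ?S. ereal (norm (G X)) \<le> ereal ?B"
      by (subst AE_restrict_space_iff) (use Ss in auto)
    have meas: "(\<lambda>X. ereal (norm (G X))) \<in> borel_measurable (lebesgue_on ?S)"
    proof -
      define K where "K = cball (fst X0) (3 * \<theta> * \<tau> / 2) \<times> cball (snd X0) (3 * \<theta> * \<tau> / 2)"
      have "3 * \<theta> * \<tau> / 2 < r" using radii \<rho> by simp
      then have "K \<subseteq> ?E" by (auto simp: K_def mem_cylinder dist_real_def abs_minus_commute)
      moreover have "compact K" unfolding K_def by (intro compact_Times compact_cball)
      ultimately have "set_integrable lebesgue K G"
        using W unfolding r_def[symmetric] W12_def has_weak_gradient_def locally_integrable_def by blast
      moreover have "?S \<subseteq> K" by (auto simp: K_def mem_cylinder dist_real_def abs_minus_commute)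
      ultimately have "set_integrable lebesgue ?S G" using Ss by (meson set_integrable_subset)
      then have "(\<lambda>X. indicat_real ?S X *\<^sub>R G X) \<in> borel_measurable lebesgue"
        unfolding set_integrable_def by (rule borel_measurable_integrable)
      then have "G \<in> borel_measurable (lebesgue_on ?S)"
        by (subst borel_measurable_restrict_space_iff) (use Ss in auto)
      then show ?thesis by measurable
    qed
    show "Linf_norm (cylinder X0 (3 * \<theta> * \<tau> / 2)) G
           \<le> ereal (C * sqrt H * sqrt (1 / weighted_vol \<mu> (cylinder X0 (3 * \<tau> / 2)) *
               (LINT X:cylinder X0 (3 * \<tau> / 2)|lebesgue. (norm (G X))\<^sup>2 * \<mu> (snd X))))"
      unfolding Linf_norm_def r_def[symmetric] V_def[symmetric] D_def[symmetric]
      by (rule esssup_I[OF meas aeS])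
  qed
qed

end
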